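(* Let $n\geqslant 1$, $\alpha\in[0,1)$, $0<p,q\leqslant\infty$, $s\in\mathbb{R}$. Then the embedding $$L^1(\mathbb{R}^n)\subset M^{s,\alpha}_{p,q}(\mathbb{R}^n)$$ holds if and only if $1/p\leqslant 1$ and $$s\leqslant n\alpha(1/p-1)+(1-\alpha)A(1,q),$$ with strict inequality in the last condition when $q<\infty$.
   Context: Convention $1/\infty=0$. For $(p,q)\in(0,\infty]^2$, $A(p,q)=\min\{0,\ n(1-1/p-1/q),\ n(1/p-1/q)\}$. $X\subset Y$ for (quasi-)normed spaces denotes embedding: $X\subset Y$ as sets with $\|f\|_Y\leqslant C\|f\|_X$ for all $f\in X$. Fourier transform: $\mathscr{F}f(\xi)=\hat f(\xi)=\int_{\mathbb{R}^n}f(x)e^{-2\pi i x\cdot\xi}dx$. Write $\langle k\rangle=(1+|k|^2)^{1/2}$. $\alpha$-modulation space: for $\alpha\in[0,1)$, take suitable constants $c,C>0$ and Schwartz functions $\{\eta_k^\alpha\}_{k\in\mathbb{Z}^n}$ such that: $|\eta_k^\alpha(\xi)|\geqslant 1$ if $|\xi-\langle k\rangle^{\frac{\alpha}{1-\alpha}}k|<c\langle k\rangle^{\frac{\alpha}{1-\alpha}}$; $\operatorname{supp}\eta_k^\alpha\subset\{\xi:|\xi-\langle k\rangle^{\frac{\alpha}{1-\alpha}}k|<C\langle k\rangle^{\frac{\alpha}{1-\alpha}}\}$; $\sum_{k\in\mathbb{Z}^n}\eta_k^\alpha(\xi)=1$ for all $\xi\in\mathbb{R}^n$; and for every multi-index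 $\gamma$ there is $C_{\gamma}$ with $|\partial^\gamma\eta_k^\alpha(\xi)|\leqslant C_{\gamma}\langle k\rangle^{-\frac{\alpha|\gamma|}{1-\alpha}}$ for all $\xi\in\mathbb{R}^n$, $k\in\mathbb{Z}^n$. Put $\Box_k^\alpha=\mathscr{F}^{-1}\eta_k^\alpha\mathscr{F}$. For $0<p,q\leqslant\infty$, $s\in\mathbb{R}$, $M^{s,\alpha}_{p,q}(\mathbb{R}^n)$ is the set of $f\in\mathscr{S}'(\mathbb{R}^n)$ with $\|f\|_{M^{s,\alpha}_{p,q}}=\big(\sum_{k\in\mathbb{Z}^n}\langle k\rangle^{\frac{sq}{1-\alpha}}\|\Box_k^\alpha f\|_{L^p}^q\big)^{1/q}<\infty$ (supremum over $k$ of $\langle k\rangle^{\frac{s}{1-\alpha}}\|\Box_k^\alpha f\|_{L^p}$ if $q=\infty$). Different choices of $\{\eta_k^\alpha\}$ give the same space with equivalent (quasi-)norms. *)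

theory Defs
  imports "HOL-Analysis.Analysis" "HOL-Probability.Essential_Supremum"
begin

section \<open>Exponents\<close>

text \<open>Lebesgue exponents in \<open>(0, \<infinity>]\<close> are positive elements of \<^typ>\<open>ennreal\<close>.
  Since \<open>inverse \<infinity> = 0\<close> in \<^typ>\<open>ennreal\<close>, the following real number is \<open>1 / p\<close> with the
  convention \<open>1 / \<infinity> = 0\<close>.\<close>

definition recip :: "ennreal \<Rightarrow> real" where
  "recip p = enn2real (inverse p)"

definition A_index :: "nat \<Rightarrow> ennreal \<Rightarrow> ennreal \<Rightarrow> real" where
  "A_index n p q =
     min 0 (min (real n * (1 - recip p - recip q)) (real n * (recip p - recip q)))"

text \<open>The power \<open>x\<^sup>r\<close> for \<open>x \<in> [0, \<infinity>]\<close> and a real exponent \<open>r > 0\<close>, so that \<open>\<infinity>\<^sup>r = \<infinity>\<close>.\<close>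

definition ennpow :: "ennreal \<Rightarrow> real \<Rightarrow> ennreal" where
  "ennpow x r = (if x = \<infinity> then \<infinity> else ennreal (enn2real x powr r))"

section \<open>Schwartz functions and tempered distributions\<close>

definition partial_deriv :: "'n \<Rightarrow> (real^'n::finite \<Rightarrow> complex) \<Rightarrow> real^'n \<Rightarrow> complex" where
  "partial_deriv i f x = frechet_derivative f (at x) (axis i 1)"

text \<open>A multi-index is encoded as the list of coordinate directions in which one differentiates
  successively; its order is the length of the list. For smooth functions the order of
  differentiation is irrelevant, so these are the usual \<open>\<partial>\<^sup>\<gamma>\<close>, each occurring (possibly repeatedly).\<close>

definition partial_derivs :: "'n list \<Rightarrow> (real^'n::finite \<Rightarrow> complex) \<Rightarrow> real^'n \<Rightarrow> complex" where
  "partial_derivs \<gamma> f = foldr partial_deriv \<gamma> f"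

definition smooth :: "(real^'n::finite \<Rightarrow> complex) \<Rightarrow> bool" where
  "smooth f \<longleftrightarrow> (\<forall>\<gamma> x. partial_derivs \<gamma> f differentiable (at x))"

definition schwartz :: "(real^'n::finite \<Rightarrow> complex) set" where
  "schwartz = {\<phi>. smooth \<phi> \<and>
     (\<forall>\<gamma> m. \<exists>B. \<forall>x. (1 + norm x) ^ m * norm (partial_derivs \<gamma> \<phi> x) \<le> B)}"

definition schwartz_seminorm :: "nat \<Rightarrow> (real^'n::finite \<Rightarrow> complex) \<Rightarrow> real" where
  "schwartz_seminorm N \<phi> =
     Sup {(1 + norm x) ^ N * norm (partial_derivs \<gamma> \<phi> x) | \<gamma> x. length \<gamma> \<le> N}"

text \<open>Functionals on the Schwartz space are extensional functions (\<^const>\<open>undefined\<close> outside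
  \<^const>\<open>schwartz\<close>), so that equality of distributions is equality in HOL.\<close>

type_synonym 'n functional = "(real^'n \<Rightarrow> complex) \<Rightarrow> complex"

definition tempered :: "('n::finite) functional set" where
  "tempered = {T \<in> extensional schwartz.
     (\<forall>\<phi>\<in>schwartz. \<forall>\<psi>\<in>schwartz. T (\<lambda>x. \<phi> x + \<psi> x) = T \<phi> + T \<psi>) \<and>
     (\<forall>\<phi>\<in>schwartz. \<forall>c. T (\<lambda>x. c * \<phi> x) = c * T \<phi>) \<and>
     (\<exists>N C. \<forall>\<phi>\<in>schwartz. norm (T \<phi>) \<le> C * schwartz_seminorm N \<phi>)}"

definition regular_distr :: "(real^'n::finite \<Rightarrow> complex) \<Rightarrow> 'n functional" where
  "regular_distr g = (\<lambda>\<phi>\<in>schwartz. \<integral>x. g x * \<phi> x \<partial>lebesgue)"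

section \<open>Fourier transform\<close>

definition fourier :: "(real^'n::finite \<Rightarrow> complex) \<Rightarrow> real^'n \<Rightarrow> complex" where
  "fourier f \<xi> = (\<integral>x. f x * exp (- 2 * of_real pi * \<i> * of_real (x \<bullet> \<xi>)) \<partial>lebesgue)"

definition inv_fourier :: "(real^'n::finite \<Rightarrow> complex) \<Rightarrow> real^'n \<Rightarrow> complex" where
  "inv_fourier g x = (\<integral>\<xi>. g \<xi> * exp (2 * of_real pi * \<i> * of_real (x \<bullet> \<xi>)) \<partial>lebesgue)"

definition fourier_distr :: "('n::finite) functional \<Rightarrow> 'n functional" where
  "fourier_distr T = (\<lambda>\<phi>\<in>schwartz. T (fourier \<phi>))"

definition inv_fourier_distr :: "('n::finite) functional \<Rightarrow> 'n functional" where
  "inv_fourier_distr T = (\<lambda>\<phi>\<in>schwartz. T (inv_fourier \<phi>))"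

definition mult_distr :: "(real^'n::finite \<Rightarrow> complex) \<Rightarrow> 'n functional \<Rightarrow> 'n functional" where
  "mult_distr \<eta> T = (\<lambda>\<phi>\<in>schwartz. T (\<lambda>x. \<eta> x * \<phi> x))"

section \<open>Lebesgue (quasi-)norms\<close>

definition Lp_norm :: "ennreal \<Rightarrow> (real^'n::finite \<Rightarrow> complex) \<Rightarrow> ennreal" where
  "Lp_norm p g =
     (if p = \<infinity> then esssup lebesgue (\<lambda>x. ennreal (norm (g x)))
      else ennpow (\<integral>\<^sup>+x. ennpow (ennreal (norm (g x))) (enn2real p) \<partial>lebesgue) (recip p))"

text \<open>The \<open>L\<^sup>p\<close> (quasi-)norm of a tempered distribution: that of the function representing it, and
  \<open>\<infinity>\<close> (the infimum of the empty set) if it is not given by a function. The representing function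
  is unique up to null sets, so the infimum is otherwise over a single value.\<close>

definition Lp_norm_distr :: "ennreal \<Rightarrow> ('n::finite) functional \<Rightarrow> ennreal" where
  "Lp_norm_distr p T =
     Inf {Lp_norm p g | g. g \<in> borel_measurable lebesgue \<and>
            (\<forall>\<phi>\<in>schwartz. integrable lebesgue (\<lambda>x. g x * \<phi> x)) \<and> T = regular_distr g}"

definition L1_space :: "('n::finite) functional set" where
  "L1_space = regular_distr ` {f. integrable lebesgue f}"

section \<open>The \<open>\<alpha>\<close>-modulation spaces\<close>

definition int_vec :: "int^'n::finite \<Rightarrow> real^'n" where
  "int_vec k = (\<chi> i. real_of_int (k $ i))"

definition bracket :: "int^'n::finite \<Rightarrow> real" where
  "bracket k = sqrt (1 + (norm (int_vec k))\<^sup>2)"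

definition alpha_decomposition ::
    "real \<Rightarrow> (int^'n::finite \<Rightarrow> real^'n \<Rightarrow> complex) \<Rightarrow> bool" where
  "alpha_decomposition \<alpha> \<eta> \<longleftrightarrow>
     (\<forall>k. \<eta> k \<in> schwartz) \<and>
     (\<exists>c>0. \<forall>k \<xi>.
        norm (\<xi> - (bracket k powr (\<alpha> / (1 - \<alpha>))) *\<^sub>R int_vec k) < c * bracket k powr (\<alpha> / (1 - \<alpha>))
        \<longrightarrow> norm (\<eta> k \<xi>) \<ge> 1) \<and>
     (\<exists>C>0. \<forall>k. closure {\<xi>. \<eta> k \<xi> \<noteq> 0} \<subseteq>
        {\<xi>. norm (\<xi> - (bracket k powr (\<alpha> / (1 - \<alpha>))) *\<^sub>R int_vec k)
             < C * bracket k powr (\<alpha> / (1 - \<alpha>))}) \<and>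
     (\<forall>\<xi>. ((\<lambda>k. \<eta> k \<xi>) has_sum 1) UNIV) \<and>
     (\<forall>\<gamma>. \<exists>C. \<forall>\<xi> k. norm (partial_derivs \<gamma> (\<eta> k) \<xi>)
        \<le> C * bracket k powr (- (\<alpha> * real (length \<gamma>) / (1 - \<alpha>))))"

definition box_op :: "(real^'n::finite \<Rightarrow> complex) \<Rightarrow> 'n functional \<Rightarrow> 'n functional" where
  "box_op \<eta> T = inv_fourier_distr (mult_distr \<eta> (fourier_distr T))"

definition modulation_norm ::
    "(int^'n::finite \<Rightarrow> real^'n \<Rightarrow> complex) \<Rightarrow> real \<Rightarrow> real \<Rightarrow> ennreal \<Rightarrow> ennreal \<Rightarrow>
     'n functional \<Rightarrow> ennreal" where
  "modulation_norm \<eta> s \<alpha> p q T =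
     (if q = \<infinity> then
        (SUP k. ennreal (bracket k powr (s / (1 - \<alpha>))) * Lp_norm_distr p (box_op (\<eta> k) T))
      else
        ennpow (\<Sum>\<^sub>\<infinity>k. ennreal (bracket k powr (s * enn2real q / (1 - \<alpha>))) *
                     ennpow (Lp_norm_distr p (box_op (\<eta> k) T)) (enn2real q)) (recip q))"

definition modulation_space ::
    "(int^'n::finite \<Rightarrow> real^'n \<Rightarrow> complex) \<Rightarrow> real \<Rightarrow> real \<Rightarrow> ennreal \<Rightarrow> ennreal \<Rightarrow>
     'n functional set" where
  "modulation_space \<eta> s \<alpha> p q = {T \<in> tempered. modulation_norm \<eta> s \<alpha> p q T < \<infinity>}"

section \<open>Embeddings\<close>

definition embedded ::
    "'a set \<Rightarrow> ('a \<Rightarrow> ennreal) \<Rightarrow> 'a set \<Rightarrow> ('a \<Rightarrow> ennreal) \<Rightarrow> bool" where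
  "embedded X normX Y normY \<longleftrightarrow>
     X \<subseteq> Y \<and> (\<exists>C::real. \<forall>f\<in>X. normY f \<le> ennreal C * normX f)"

end

theory Submission
  imports Defs "HOL-Probability.Characteristic_Functions" "HOL-Probability.Sinc_Integral"
begin

text \<open>
  Let \<open>R\<^sub>k\<close> be the power \<open>\<alpha> / (1 - \<alpha>)\<close> of the bracket of \<open>k\<close>, which is the size of the \<open>k\<close>-th frequency ball, and let \<open>K\<^sub>k\<close> be
  the inverse Fourier transform of \<open>\<eta>\<^sub>k\<close>. On integrable functions the \<open>k\<close>-th box operator is convolution with
  \<open>K\<^sub>k\<close>, and the uniform derivative bounds say that \<open>K\<^sub>k\<close> is a modulated bump of height \<open>R\<^sub>k\<^sup>n\<close> and width
  \<open>1 / R\<^sub>k\<close>. For \<open>p \<ge> 1\<close> its norm from \<open>L\<^sup>1\<close> to \<open>L\<^sup>p\<close> is therefore comparable to \<open>R\<^sub>k\<close> to the power \<open>n (1 - 1/p)\<close>, and the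
  embedding holds precisely if the weights times these norms, that is the powers of the bracket of \<open>k\<close>
  with exponent \<open>t = (s + n \<alpha> (1 - 1/p)) / (1 - \<alpha>)\<close>, form an \<open>\<ell>\<^sup>q\<close> sequence on the lattice. This means \<open>t q < - n\<close> for
  finite \<open>q\<close> and \<open>t \<le> 0\<close> for \<open>q = \<infinity>\<close>; as the index \<open>A(1, q)\<close> is \<open>- n/q\<close>, this is the stated condition.

  Sufficiency rests on \<open>kernel_bound\<close>, which turns the support and derivative conditions into pointwise decay
  of \<open>K\<^sub>k\<close>, on interpolation between \<open>L\<^sup>1\<close> and \<open>L\<^sup>\<infinity>\<close> in \<open>box_norm_upper\<close>, and on \<open>lattice_sum_bounded\<close>.

  For the necessity of the condition on \<open>s\<close>, the function runs through Gaussians of integral one that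
  concentrate at the origin; its image under the \<open>k\<close>-th box operator tends to \<open>K\<^sub>k\<close>. The lower bound for the
  norm of \<open>K\<^sub>k\<close> in \<open>box_norm_lower\<close> is obtained by pairing with a wave packet: this is an average of \<open>\<eta>\<^sub>k\<close> near
  the centre of its ball, where \<open>\<eta>\<^sub>k\<close> has modulus at least one and varies slowly. The sums of the
  \<open>q\<close>-th powers over finite sets of lattice points, or the single terms if \<open>q = \<infinity>\<close>, are then uniformly bounded, which \<open>lattice_sum_unbounded\<close> and \<open>bracket_unbounded\<close> exclude
  outside the stated range.

  For the necessity of \<open>p \<ge> 1\<close>, the Gaussians flatten out instead. A single box operator then produces
  functions of height tending to zero whose \<open>L\<^sup>1\<close> norm stays bounded below, and for \<open>p < 1\<close> their \<open>L\<^sup>p\<close> quasi-norm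
  tends to infinity (\<open>box_norm_unbounded\<close>). Duality says nothing about \<open>L\<^sup>p\<close> in this range, so here the representing
  function itself has to be identified, by \<open>AE_zero_if_schwartz_integrals_zero\<close>.

  The Fourier analysis is carried by two facts: the Schwartz class is invariant under the Fourier
  transform (\<open>schwartz_osc\<close>), and the transform of a Gaussian is a Gaussian (\<open>osc_gauss\<close>).
\<close>

section \<open>Schwartz functions\<close>

definition rapid :: "(real^'n::finite \<Rightarrow> complex) \<Rightarrow> bool" where
  "rapid f \<longleftrightarrow> (\<forall>m. \<exists>B. \<forall>x. (1 + norm x) ^ m * norm (f x) \<le> B)"

lemma partial_derivI: "(f has_derivative D) (at x) \<Longrightarrow> partial_deriv j f x = D (axis j 1)"
  unfolding partial_deriv_def using frechet_derivative_at by metis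

lemma has_derivative_frechet: "f differentiable at x \<Longrightarrow> (f has_derivative frechet_derivative f (at x)) (at x)"
  by (simp add: frechet_derivative_works)

lemma partial_deriv_add:
  "f differentiable at x \<Longrightarrow> g differentiable at x \<Longrightarrow>
    partial_deriv j (\<lambda>x. f x + g x) x = partial_deriv j f x + partial_deriv j g x"
  by (subst partial_derivI[OF has_derivative_add[OF has_derivative_frechet has_derivative_frechet]])
    (auto simp: partial_deriv_def)

lemma partial_deriv_mult:
  "f differentiable at x \<Longrightarrow> g differentiable at x \<Longrightarrow>
    partial_deriv j (\<lambda>x. f x * g x) x = f x * partial_deriv j g x + partial_deriv j f x * g x"
  by (subst partial_derivI[OF has_derivative_mult[OF has_derivative_frechet has_derivative_frechet]])
    (auto simp: partial_deriv_def)

lemma partial_deriv_const [simp]: "partial_deriv j (\<lambda>x. c) x = 0"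
  by (subst partial_derivI[OF has_derivative_const]) auto

lemma coord_has_derivative:
  "((\<lambda>x::real^'n. complex_of_real (x $ i)) has_derivative (\<lambda>h. complex_of_real (h $ i))) F"
  by (intro bounded_linear_imp_has_derivative bounded_linear_compose[OF bounded_linear_of_real]
      bounded_linear_vec_nth)

lemma coord_differentiable: "(\<lambda>x::real^'n. complex_of_real (x $ i)) differentiable F"
  using coord_has_derivative differentiable_def by blast

lemma partial_deriv_coord:
  "partial_deriv j (\<lambda>x::real^'n. complex_of_real (x $ i)) x = (if i = j then 1 else 0)"
  by (subst partial_derivI[OF coord_has_derivative]) (auto simp: axis_def)

text \<open>The functions generated from \<open>B\<close> with polynomial coefficients. Membership in the Schwartz class is
  proved below by exhibiting a set \<open>B\<close> of rapidly decreasing functions whose first partial derivatives lie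
  in this closure; the closure takes over the bookkeeping of an induction over multi-indices.\<close>

inductive_set coord_span :: "(real^'n::finite \<Rightarrow> complex) set \<Rightarrow> (real^'n \<Rightarrow> complex) set"
  for B where
  base: "f \<in> B \<Longrightarrow> f \<in> coord_span B"
| coord: "f \<in> coord_span B \<Longrightarrow> (\<lambda>x. of_real (x $ j) * f x) \<in> coord_span B"
| add: "f \<in> coord_span B \<Longrightarrow> g \<in> coord_span B \<Longrightarrow> (\<lambda>x. f x + g x) \<in> coord_span B"
| scale: "f \<in> coord_span B \<Longrightarrow> (\<lambda>x. c * f x) \<in> coord_span B"

lemma rapid_add: assumes "rapid f" "rapid g" shows "rapid (\<lambda>x. f x + g x)"
  unfolding rapid_def
proof
  fix m
  from assms obtain B C where "\<And>x. (1 + norm x) ^ m * norm (f x) \<le> B" "\<And>x. (1 + norm x) ^ m * norm (g x) \<le> C"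
    unfolding rapid_def by metis
  then have "(1 + norm x) ^ m * norm (f x + g x) \<le> B + C" for x
    by (smt (verit, ccfv_SIG) distrib_left mult_left_mono norm_ge_zero norm_triangle_ineq zero_le_power)
  then show "\<exists>B. \<forall>x. (1 + norm x) ^ m * norm (f x + g x) \<le> B" by blast
qed

lemma rapid_bounded_mult:
  assumes "rapid g" "\<And>x. norm (f x) \<le> C * norm (g x)" "0 \<le> C" shows "rapid f"
  unfolding rapid_def
proof
  fix m
  from assms(1) obtain B where "\<And>x. (1 + norm x) ^ m * norm (g x) \<le> B"
    unfolding rapid_def by metis
  then have "C * ((1 + norm x) ^ m * norm (g x)) \<le> C * B" for x
    using assms(3) mult_left_mono by blast
  moreover have "(1 + norm x) ^ m * norm (f x) \<le> C * ((1 + norm x) ^ m * norm (g x))" for x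
    using mult_left_mono[OF assms(2)[of x], of "(1 + norm x) ^ m"] by (simp add: algebra_simps)
  ultimately show "\<exists>B. \<forall>x. (1 + norm x) ^ m * norm (f x) \<le> B" by (meson order_trans)
qed

lemma rapid_scale: "rapid f \<Longrightarrow> rapid (\<lambda>x. c * f x)"
  by (erule rapid_bounded_mult[of _ _ "norm c"]) (auto simp: norm_mult)

lemma rapid_coord: assumes "rapid f" shows "rapid (\<lambda>x. of_real (x $ j) * f x)"
  unfolding rapid_def
proof
  fix m
  from assms obtain B where B: "\<And>x. (1 + norm x) ^ Suc m * norm (f x) \<le> B"
    unfolding rapid_def by metis
  have "(1 + norm x) ^ m * norm (complex_of_real (x $ j) * f x) \<le> B" for x
  proof -
    have "\<bar>x $ j\<bar> \<le> 1 + norm x" using component_le_norm_cart[of x j] by simp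
    then have "(1 + norm x) ^ m * norm (complex_of_real (x $ j) * f x) \<le> (1 + norm x) ^ m * ((1 + norm x) * norm (f x))"
      by (intro mult_left_mono) (auto simp: norm_mult intro!: mult_right_mono)
    also have "\<dots> = (1 + norm x) ^ Suc m * norm (f x)" by simp
    finally show ?thesis using B[of x] by linarith
  qed
  then show "\<exists>B. \<forall>x. (1 + norm x) ^ m * norm (complex_of_real (x $ j) * f x) \<le> B" by blast
qed

text \<open>Differentiability, rapid decrease and stability under partial derivatives pass from the
  generators to the whole closure, because \<open>\<partial>\<^sub>j (x\<^sub>i f) = \<delta>\<^sub>i\<^sub>j f + x\<^sub>i \<partial>\<^sub>j f\<close> is again in the closure. Hence all iterated
  partial derivatives are rapidly decreasing.\<close>

lemma coord_span_schwartz: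
  assumes diff: "\<And>f x. f \<in> B \<Longrightarrow> f differentiable at x" and rap: "\<And>f. f \<in> B \<Longrightarrow> rapid f"
    and pd: "\<And>f j. f \<in> B \<Longrightarrow> partial_deriv j f \<in> coord_span B"
  shows "coord_span B \<subseteq> schwartz"
proof
  have step: "(\<forall>x. f differentiable at x) \<and> rapid f \<and> (\<forall>j. partial_deriv j f \<in> coord_span B)"
    if "f \<in> coord_span B" for f
    using that
  proof induction
    case (base f)
    then show ?case using assms by blast
  next
    case (coord f i)
    have "partial_deriv j (\<lambda>x. of_real (x $ i) * f x) =
        (\<lambda>x. of_real (x $ i) * partial_deriv j f x + (if i = j then 1 else 0) * f x)" for j
      using coord by (auto simp: fun_eq_iff partial_deriv_mult coord_differentiable partial_deriv_coord)
    moreover have "\<dots> j \<in> coord_span B" for j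
      using coord by (intro coord_span.add coord_span.coord coord_span.scale) auto
    ultimately show ?case using coord
      by (auto intro!: differentiable_mult coord_differentiable rapid_coord)
  next
    case (add f g)
    have "partial_deriv j (\<lambda>x. f x + g x) = (\<lambda>x. partial_deriv j f x + partial_deriv j g x)" for j
      using add by (auto simp: fun_eq_iff partial_deriv_add)
    then show ?case using add by (auto intro!: rapid_add coord_span.add)
  next
    case (scale f c)
    have "partial_deriv j (\<lambda>x. c * f x) = (\<lambda>x. c * partial_deriv j f x)" for j
      using scale by (auto simp: fun_eq_iff partial_deriv_mult)
    then show ?case using scale by (auto intro!: rapid_scale coord_span.scale differentiable_mult)
  qed
  fix f assume f: "f \<in> coord_span B"
  have "partial_derivs \<gamma> f \<in> coord_span B" for \<gamma>
    by (induction \<gamma>) (use f step in \<open>auto simp: partial_derivs_def\<close>)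
  then show "f \<in> schwartz"
    using step unfolding schwartz_def smooth_def rapid_def by blast
qed

lemma schwartz_rapid: "f \<in> schwartz \<Longrightarrow> rapid f"
  unfolding schwartz_def rapid_def by (auto dest!: spec[of _ "[]"] simp: partial_derivs_def)

lemma schwartz_differentiable: "f \<in> schwartz \<Longrightarrow> f differentiable at x"
  unfolding schwartz_def smooth_def by (auto dest!: spec[of _ "[]"] simp: partial_derivs_def)

lemma schwartz_partial_deriv: assumes "f \<in> schwartz" shows "partial_deriv j f \<in> schwartz"
proof -
  have "partial_derivs \<gamma> (partial_deriv j f) = partial_derivs (\<gamma> @ [j]) f" for \<gamma>
    by (simp add: partial_derivs_def)
  with assms show ?thesis unfolding schwartz_def smooth_def by auto
qed

lemma schwartz_coord_span: "coord_span (schwartz :: (real^'n::finite \<Rightarrow> complex) set) = schwartz"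
proof
  show "coord_span (schwartz :: (real^'n \<Rightarrow> complex) set) \<subseteq> schwartz"
    by (rule coord_span_schwartz)
      (auto intro: schwartz_rapid schwartz_differentiable coord_span.base schwartz_partial_deriv)
qed (auto intro: coord_span.base)

lemma schwartz_add: "f \<in> schwartz \<Longrightarrow> g \<in> schwartz \<Longrightarrow> (\<lambda>x. f x + g x) \<in> schwartz"
  and schwartz_scale: "f \<in> schwartz \<Longrightarrow> (\<lambda>x. c * f x) \<in> schwartz"
  and schwartz_coord: "f \<in> schwartz \<Longrightarrow> (\<lambda>x. of_real (x $ j) * f x) \<in> schwartz"
  by (metis schwartz_coord_span coord_span.intros)+

lemma schwartz_bounded: assumes "f \<in> schwartz" obtains B where "B > 0" "\<And>x. norm (f x) \<le> B"
proof -
  from schwartz_rapid[OF assms] obtain B where "\<And>x. (1 + norm x) ^ 0 * norm (f x) \<le> B"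
    unfolding rapid_def by metis
  then show ?thesis by (intro that[of "max B 1"]) (auto simp: le_max_iff_disj)
qed

text \<open>The set of all products of two Schwartz functions is closed under partial derivatives up to sums
  by the product rule, which is what the closure argument asks for.\<close>

lemma schwartz_mult:
  fixes f g :: "real^'n::finite \<Rightarrow> complex"
  assumes "f \<in> schwartz" "g \<in> schwartz" shows "(\<lambda>x. f x * g x) \<in> schwartz"
proof -
  let ?B = "{\<lambda>x. f x * g x | f g :: real^'n \<Rightarrow> complex. f \<in> schwartz \<and> g \<in> schwartz}"
  have "coord_span ?B \<subseteq> schwartz"
  proof (rule coord_span_schwartz)
    fix h assume "h \<in> ?B"
    then obtain f g :: "real^'n \<Rightarrow> complex" where h: "h = (\<lambda>x. f x * g x)" and fg: "f \<in> schwartz" "g \<in> schwartz"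
      by blast
    show "h differentiable at x" for x
      unfolding h by (intro differentiable_mult schwartz_differentiable fg)
    obtain B where "B > 0" "\<And>x. norm (f x) \<le> B" using schwartz_bounded fg by blast
    then show "rapid h" unfolding h
      by (intro rapid_bounded_mult[OF schwartz_rapid[OF fg(2)], of _ B])
        (auto simp: norm_mult mult_right_mono)
    fix j
    have "partial_deriv j h = (\<lambda>x. f x * partial_deriv j g x + partial_deriv j f x * g x)"
      unfolding h using fg by (auto simp: fun_eq_iff partial_deriv_mult schwartz_differentiable)
    also have "\<dots> \<in> coord_span ?B"
      by (rule coord_span.add; rule coord_span.base) (use fg schwartz_partial_deriv in blast)+
    finally show "partial_deriv j h \<in> coord_span ?B" .
  qed
  then show ?thesis using assms coord_span.base[of _ ?B] by blast
qed

lemma schwartz_continuous: "f \<in> schwartz \<Longrightarrow> continuous_on UNIV f"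
  by (simp add: continuous_at_imp_continuous_on differentiable_imp_continuous_within schwartz_differentiable)

lemma schwartz_borel [measurable_dest]: "f \<in> schwartz \<Longrightarrow> f \<in> borel_measurable borel"
  by (intro borel_measurable_continuous_onI schwartz_continuous)

section \<open>Integration on Euclidean space\<close>

lemma prod_Basis_vec:
  fixes x :: "real^'n::finite"
  shows "(\<Prod>b\<in>Basis. f (x \<bullet> b)) = (\<Prod>i\<in>UNIV. f (x $ i))"
proof -
  have "(\<Prod>b\<in>(Basis :: (real^'n) set). f (x \<bullet> b)) = (\<Prod>b\<in>range (\<lambda>i. axis i 1). f (x \<bullet> b))"
    by (rule prod.cong) (auto simp: Basis_vec_def)
  also have "\<dots> = (\<Prod>i\<in>UNIV. f (x \<bullet> axis i 1))"
    by (subst prod.reindex) (auto simp: inj_on_def axis_eq_axis)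
  finally show ?thesis by (simp add: cart_eq_inner_axis)
qed

text \<open>A product of one-dimensional integrable profiles, so that its integral factorises. It serves as the
  common integrable majorant: it decays slowly enough to dominate \<open>(1 + |x|)\<^sup>-\<^sup>2\<^sup>n\<close>, hence any Schwartz
  function.\<close>

definition weight :: "real^'n::finite \<Rightarrow> real" where
  "weight x = (\<Prod>i\<in>UNIV. inverse (1 + (x $ i)\<^sup>2))"

lemma weight_pos [simp]: "0 < weight x" "0 \<le> weight x"
proof -
  show "0 < weight x" unfolding weight_def by (intro prod_pos) (auto intro: add_pos_nonneg)
  then show "0 \<le> weight x" by simp
qed

lemma weight_borel [measurable]: "weight \<in> borel_measurable borel"
  unfolding weight_def by measurable

lemma weight_integrable: "integrable lborel (weight :: real^'n::finite \<Rightarrow> real)"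
proof (rule integrableI_bounded)
  have "integrable lborel (\<lambda>x::real. inverse (1 + x\<^sup>2))"
    using integrable_inverse_1_plus_square by (simp add: set_integrable_def)
  then have fin: "(\<integral>\<^sup>+x. ennreal (inverse (1 + x\<^sup>2)) \<partial>(lborel::real measure)) < \<infinity>"
    by (subst nn_integral_eq_integral) auto
  have "(\<integral>\<^sup>+x. ennreal (norm (weight (x :: real^'n))) \<partial>lborel) =
      (\<integral>\<^sup>+x. (\<Prod>b\<in>Basis. ennreal (inverse (1 + (x \<bullet> b)\<^sup>2))) \<partial>(lborel::(real^'n) measure))"
    by (intro nn_integral_cong)
      (simp only: prod_Basis_vec[of "\<lambda>t. ennreal (inverse (1 + t\<^sup>2))"],
        simp add: weight_def prod_ennreal prod_nonneg)
  also have "\<dots> = (\<Prod>b\<in>(Basis::(real^'n) set). (\<integral>\<^sup>+x. ennreal (inverse (1 + x\<^sup>2)) \<partial>lborel))"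
    by (subst nn_integral_lborel_prod[where f = "\<lambda>_ t. ennreal (inverse (1 + t\<^sup>2))"]) auto
  also have "\<dots> < \<infinity>" using fin by (simp add: ennreal_prod_eq_top power_less_top_ennreal)
  finally show "(\<integral>\<^sup>+x. ennreal (norm (weight (x::real^'n))) \<partial>lborel) < \<infinity>" .
qed simp

lemma weight_lower: 
  fixes x :: "real^'n::finite" shows "1 \<le> (1 + norm x) ^ (2 * CARD('n)) * weight x"
proof -
  have "(\<Prod>i\<in>UNIV. 1 + (x $ i)\<^sup>2) \<le> (\<Prod>i\<in>(UNIV::'n set). (1 + norm x)\<^sup>2)"
  proof (rule prod_mono)
    fix i
    have "(x $ i)\<^sup>2 \<le> (norm x)\<^sup>2" using component_le_norm_cart[of x i]
      by (metis abs_ge_zero power2_abs power_mono)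
    then show "0 \<le> 1 + (x $ i)\<^sup>2 \<and> 1 + (x $ i)\<^sup>2 \<le> (1 + norm x)\<^sup>2"
      by (auto simp: power2_sum intro: add_nonneg_nonneg) (smt (verit) norm_ge_zero)
  qed
  then have "(\<Prod>i\<in>UNIV. 1 + (x $ i)\<^sup>2) \<le> (1 + norm x) ^ (2 * CARD('n))"
    by (simp add: power_mult)
  moreover have "weight x = inverse (\<Prod>i\<in>UNIV. 1 + (x $ i)\<^sup>2)" "(\<Prod>i\<in>UNIV. 1 + (x $ i)\<^sup>2) > 0"
    by (auto simp: weight_def prod_inversef[symmetric] comp_def intro!: prod_pos add_pos_nonneg)
  ultimately show ?thesis by (simp add: field_simps)
qed

text \<open>The bound is uniform under shifts of length at most one, as needed to dominate difference quotients.
  It holds because \<open>1 + |x| \<le> 2 (1 + |x + y|)\<close> for \<open>|y| \<le> 1\<close>, at the price of a power of two.\<close>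

lemma schwartz_weight:
  fixes f :: "real^'n::finite \<Rightarrow> complex"
  assumes "f \<in> schwartz"
  obtains B where "B > 0" "\<And>x y. norm y \<le> 1 \<Longrightarrow> (1 + norm x) ^ m * norm (f (x + y)) \<le> B * weight x"
proof -
  let ?N = "m + 2 * CARD('n)"
  obtain B where B: "\<And>x. (1 + norm x) ^ ?N * norm (f x) \<le> B"
    using schwartz_rapid[OF assms] unfolding rapid_def by metis
  have "(1 + norm x) ^ m * norm (f (x + y)) \<le> 2 ^ ?N * max B 1 * weight x" if y: "norm y \<le> 1" for x y
  proof -
    have "1 + norm x \<le> 2 * (1 + norm (x + y))"
      using norm_triangle_ineq4[of "x + y" y] norm_ge_zero[of "x + y"] y by (simp del: norm_ge_zero)
    then have "(1 + norm x) ^ ?N \<le> (2 * (1 + norm (x + y))) ^ ?N" by (intro power_mono) auto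
    then have "(1 + norm x) ^ ?N * norm (f (x + y)) \<le> (2 * (1 + norm (x + y))) ^ ?N * norm (f (x + y))"
      by (intro mult_right_mono) auto
    also have "\<dots> = 2 ^ ?N * ((1 + norm (x + y)) ^ ?N * norm (f (x + y)))"
      by (simp only: power_mult_distrib mult.assoc)
    also have "\<dots> \<le> 2 ^ ?N * max B 1" by (intro mult_left_mono) (use B[of "x+y"] in auto)
    finally have 1: "(1 + norm x) ^ ?N * norm (f (x + y)) \<le> 2 ^ ?N * max B 1" .
    have "(1 + norm x) ^ m * norm (f (x + y)) * 1 
        \<le> (1 + norm x) ^ m * norm (f (x + y)) * ((1 + norm x) ^ (2 * CARD('n)) * weight x)"
      by (intro mult_left_mono weight_lower) auto
    also have "\<dots> = (1 + norm x) ^ ?N * norm (f (x + y)) * weight x"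
      by (simp add: power_add algebra_simps)
    also have "\<dots> \<le> 2 ^ ?N * max B 1 * weight x"
      by (intro mult_right_mono 1) auto
    finally show ?thesis by simp
  qed
  then show ?thesis by (intro that[of "2 ^ ?N * max B 1"]) auto
qed

lemma schwartz_weight0:
  fixes f :: "real^'n::finite \<Rightarrow> complex"
  assumes "f \<in> schwartz"
  obtains B where "B > 0" "\<And>x. (1 + norm x) ^ m * norm (f x) \<le> B * weight x"
  using schwartz_weight[OF assms, of m] by (metis add.right_neutral norm_zero zero_le_one)

lemma schwartz_integrable_power:
  assumes "f \<in> schwartz" shows "integrable lborel (\<lambda>x. (1 + norm x) ^ m * norm (f x))"
proof -
  obtain B where "B > 0" "\<And>x. (1 + norm x) ^ m * norm (f x) \<le> B * weight x"
    using schwartz_weight0[OF assms] by blast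
  then show ?thesis
    by (intro Bochner_Integration.integrable_bound[OF integrable_mult_right[OF weight_integrable, of B]])
      (use assms in \<open>auto intro!: AE_I2\<close>)
qed

lemma schwartz_integrable: assumes "f \<in> schwartz" shows "integrable lborel f"
  using schwartz_integrable_power[OF assms, of 0] assms 
  by (auto intro: integrable_norm_cancel)

lemma integrable_affine_iff:
  fixes f :: "'a::euclidean_space \<Rightarrow> 'b::{banach, second_countable_topology}"
  assumes [measurable]: "f \<in> borel_measurable borel" and c: "c \<noteq> 0"
  shows "integrable lborel (\<lambda>x. f (t + c *\<^sub>R x)) \<longleftrightarrow> integrable lborel f"
proof -
  have "integrable lborel f \<longleftrightarrow> 
      integrable (density (distr lborel borel (\<lambda>x. t + c *\<^sub>R x)) (\<lambda>_. \<bar>c\<bar>^DIM('a))) f"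
    by (subst lborel_affine[OF c, of t]) simp
  also have "\<dots> \<longleftrightarrow> integrable lborel (\<lambda>x. f (t + c *\<^sub>R x))"
    using c integrable_scaleR_right[of "inverse (\<bar>c\<bar>^DIM('a))" lborel "\<lambda>x. \<bar>c\<bar>^DIM('a) *\<^sub>R f (t + c *\<^sub>R x)"]
    by (subst integrable_density) (auto simp: integrable_distr_eq)
  finally show ?thesis ..
qed

lemma integral_affine:
  fixes f :: "'a::euclidean_space \<Rightarrow> 'b::{banach, second_countable_topology}"
  assumes [measurable]: "f \<in> borel_measurable borel" and c: "c \<noteq> 0"
  shows "integral\<^sup>L lborel f = \<bar>c\<bar>^DIM('a) *\<^sub>R integral\<^sup>L lborel (\<lambda>x. f (t + c *\<^sub>R x))"
proof -
  have "integral\<^sup>L lborel f = integral\<^sup>L (density (distr lborel borel (\<lambda>x. t + c *\<^sub>R x)) (\<lambda>_. \<bar>c\<bar>^DIM('a))) f"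
    by (subst lborel_affine[OF c, of t]) simp
  also have "\<dots> = \<bar>c\<bar>^DIM('a) *\<^sub>R integral\<^sup>L lborel (\<lambda>x. f (t + c *\<^sub>R x))"
    using c by (subst integral_density) (auto simp: integral_distr)
  finally show ?thesis .
qed

lemma frechet_derivative_eq_sum:
  fixes f :: "real^'n::finite \<Rightarrow> complex"
  assumes "f differentiable at x"
  shows "frechet_derivative f (at x) h = (\<Sum>j\<in>UNIV. h $ j *\<^sub>R partial_deriv j f x)"
proof -
  interpret bounded_linear "frechet_derivative f (at x)"
    using assms frechet_derivative_works has_derivative_bounded_linear by blast
  have "h = (\<Sum>j\<in>UNIV. h $ j *\<^sub>R axis j 1)"
    using basis_expansion[of h] by (simp add: scalar_mult_eq_scaleR)
  then have "frechet_derivative f (at x) h = frechet_derivative f (at x) (\<Sum>j\<in>UNIV. h $ j *\<^sub>R axis j 1)"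
    by simp
  then show ?thesis by (simp only: sum scaleR partial_deriv_def)
qed

lemma lipschitz_of_partial_deriv_bound:
  fixes f :: "real^'n::finite \<Rightarrow> complex"
  assumes f: "f \<in> schwartz" and D: "\<And>j x. norm (partial_deriv j f x) \<le> D j"
  shows "norm (f x - f y) \<le> (\<Sum>j\<in>UNIV. D j) * norm (x - y)"
proof (rule differentiable_bound[where S = UNIV and f' = "\<lambda>x. frechet_derivative f (at x)"])
  show "(f has_derivative frechet_derivative f (at x)) (at x within UNIV)" for x
    using has_derivative_frechet[OF schwartz_differentiable[OF f]] .
  show "onorm (frechet_derivative f (at x)) \<le> (\<Sum>j\<in>UNIV. D j)" for x
  proof (rule onorm_bound)
    show "0 \<le> (\<Sum>j\<in>UNIV. D j)" by (intro sum_nonneg order_trans[OF norm_ge_zero D])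
    fix h :: "real^'n"
    have "norm (frechet_derivative f (at x) h) \<le> (\<Sum>j\<in>UNIV. norm (h $ j *\<^sub>R partial_deriv j f x))"
      unfolding frechet_derivative_eq_sum[OF schwartz_differentiable[OF f]] by (rule norm_sum)
    also have "\<dots> \<le> (\<Sum>j\<in>UNIV. D j * norm h)"
    proof (rule sum_mono)
      fix j
      have "norm (h $ j *\<^sub>R partial_deriv j f x) \<le> norm h * D j"
        unfolding norm_scaleR by (intro mult_mono D component_le_norm_cart) (auto simp: component_le_norm_cart)
      then show "norm (h $ j *\<^sub>R partial_deriv j f x) \<le> D j * norm h" by (simp add: mult.commute)
    qed
    finally show "norm (frechet_derivative f (at x) h) \<le> (\<Sum>j\<in>UNIV. D j) * norm h"
      by (simp add: sum_distrib_right)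
  qed
qed auto

lemma schwartz_lipschitz:
  fixes f :: "real^'n::finite \<Rightarrow> complex"
  assumes f: "f \<in> schwartz" obtains L where "L \<ge> 0" "\<And>x y. norm (f x - f y) \<le> L * norm (x - y)"
proof -
  have "\<exists>B. \<forall>x. norm (partial_deriv j f x) \<le> B" for j
    using schwartz_bounded[OF schwartz_partial_deriv[OF f]] by metis
  then obtain D where D: "\<And>j x. norm (partial_deriv j f x) \<le> D j" by metis
  show thesis
    by (rule that[OF _ lipschitz_of_partial_deriv_bound[OF f D]]) (intro sum_nonneg order_trans[OF norm_ge_zero D])
qed

text \<open>The integral of \<open>f (x + t e\<^sub>j)\<close> does not depend on \<open>t\<close>, so every difference quotient integrates to zero;
  by the mean value inequality the quotients are dominated by a multiple of the weight, and dominated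
  convergence passes to the derivative.\<close>

lemma integral_partial_deriv:
  fixes f :: "real^'n::finite \<Rightarrow> complex"
  assumes f: "f \<in> schwartz"
  shows "integral\<^sup>L lborel (partial_deriv j f) = 0"
proof -
  define e :: "real^'n" where "e = axis j 1"
  have [simp]: "norm e = 1" by (simp add: e_def)
  obtain B where B: "B > 0" "\<And>x y. norm y \<le> 1 \<Longrightarrow> norm (partial_deriv j f (x + y)) \<le> B * weight x"
    using schwartz_weight[OF schwartz_partial_deriv[OF f], of 0 j] by auto
  have der: "((\<lambda>t. f (x + t *\<^sub>R e)) has_derivative (\<lambda>h. h *\<^sub>R partial_deriv j f (x + t *\<^sub>R e))) (at t within S)"
    for x t S
  proof -
    have "((\<lambda>t. f (x + t *\<^sub>R e)) has_derivative (\<lambda>h. frechet_derivative f (at (x + t *\<^sub>R e)) (h *\<^sub>R e))) (at t within S)"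
      by (rule has_derivative_compose[OF _ has_derivative_frechet[OF schwartz_differentiable[OF f]]])
        (auto intro!: derivative_eq_intros)
    moreover have "frechet_derivative f (at (x + t *\<^sub>R e)) (h *\<^sub>R e) = h *\<^sub>R partial_deriv j f (x + t *\<^sub>R e)" for h
      unfolding partial_deriv_def e_def
      using frechet_derivative_works has_derivative_bounded_linear linear_simps(5) schwartz_differentiable[OF f] by blast
    ultimately show ?thesis by simp
  qed
  define t :: "nat \<Rightarrow> real" where "t m = inverse (real (Suc m))" for m
  have t: "0 < t m" "t m \<le> 1" for m by (auto simp: t_def field_simps)
  have t0: "t \<longlonglongrightarrow> 0" unfolding t_def by (rule LIMSEQ_inverse_real_of_nat)
  define q where "q m x = (f (x + t m *\<^sub>R e) - f x) /\<^sub>R t m" for m x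
  have fb: "f \<in> borel_measurable borel" using f by (rule schwartz_borel)
  have int: "integrable lborel (\<lambda>x. f (x + c *\<^sub>R e))" "integral\<^sup>L lborel (\<lambda>x. f (x + c *\<^sub>R e)) = integral\<^sup>L lborel f" for c
    using integrable_affine_iff[OF fb, of 1 "c *\<^sub>R e"] integral_affine[OF fb, of 1 "c *\<^sub>R e"] schwartz_integrable[OF f]
    by (auto simp: add.commute)
  have "(\<lambda>m. integral\<^sup>L lborel (q m)) \<longlonglongrightarrow> integral\<^sup>L lborel (partial_deriv j f)"
  proof (rule integral_dominated_convergence)
    show "partial_deriv j f \<in> borel_measurable lborel"
      using schwartz_borel[OF schwartz_partial_deriv[OF f]] by simp
    show "q m \<in> borel_measurable lborel" for m unfolding q_def using fb by measurable
    show "integrable lborel (\<lambda>x. B * weight x)" using weight_integrable by auto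
    show "AE x in lborel. (\<lambda>m. q m x) \<longlonglongrightarrow> partial_deriv j f x"
    proof (rule AE_I2)
      fix x
      have "((\<lambda>h. norm (f (x + h *\<^sub>R e) - f x - h *\<^sub>R partial_deriv j f x) / norm h) \<longlongrightarrow> 0) (at 0)"
        using der[of x 0 UNIV] by (simp add: has_derivative_at)
      moreover have "norm (f (x + h *\<^sub>R e) - f x - h *\<^sub>R partial_deriv j f x) / norm h =
          norm ((f (x + h *\<^sub>R e) - f x) /\<^sub>R h - partial_deriv j f x)" if "h \<noteq> 0" for h
      proof -
        have "(f (x + h *\<^sub>R e) - f x) /\<^sub>R h - partial_deriv j f x =
            (f (x + h *\<^sub>R e) - f x - h *\<^sub>R partial_deriv j f x) /\<^sub>R h"
          using that by (simp add: scaleR_diff_right)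
        then show ?thesis by (simp add: divide_inverse mult.commute)
      qed
      ultimately have "((\<lambda>h. norm ((f (x + h *\<^sub>R e) - f x) /\<^sub>R h - partial_deriv j f x)) \<longlongrightarrow> 0) (at 0)"
        by (auto cong: Lim_cong_within)
      then have "((\<lambda>h. (f (x + h *\<^sub>R e) - f x) /\<^sub>R h) \<longlongrightarrow> partial_deriv j f x) (at 0)"
        by (simp add: tendsto_norm_zero_iff LIM_zero_iff)
      moreover have "filterlim t (at 0) sequentially"
        using t0 t(1) by (auto simp: filterlim_at intro!: always_eventually) (metis less_irrefl)
      ultimately show "(\<lambda>m. q m x) \<longlonglongrightarrow> partial_deriv j f x"
        unfolding q_def by (rule filterlim_compose)
    qed
    show "AE x in lborel. norm (q m x) \<le> B * weight x" for m
    proof (rule AE_I2)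
      fix x
      have "norm (f (x + t m *\<^sub>R e) - f (x + 0 *\<^sub>R e)) \<le> (B * weight x) * norm (t m - 0)"
      proof (rule differentiable_bound[where S = "{0..1}", OF _ der])
        fix s :: real assume "s \<in> {0..1}"
        then show "onorm (\<lambda>h. h *\<^sub>R partial_deriv j f (x + s *\<^sub>R e)) \<le> B * weight x"
          using B(2)[of "s *\<^sub>R e" x] B(1)
          by (intro onorm_bound) (auto intro: mult_left_mono simp: mult.commute)
      qed (use t[of m] in auto)
      moreover have "norm (q m x) = norm (f (x + t m *\<^sub>R e) - f x) / t m"
        using t[of m] by (simp add: q_def divide_inverse mult.commute)
      ultimately show "norm (q m x) \<le> B * weight x"
        using t[of m] by (simp add: pos_divide_le_eq)
    qed
  qed
  moreover have "integral\<^sup>L lborel (q m) = 0" for m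
    unfolding q_def using int[of "t m"] schwartz_integrable[OF f] by simp
  ultimately show ?thesis by (simp add: LIMSEQ_const_iff)
qed

section \<open>Fourier integrals of Schwartz functions\<close>

text \<open>With \<open>\<sigma> = - 2 \<pi>\<close> this is the Fourier transform and with \<open>\<sigma> = 2 \<pi>\<close> the inverse Fourier transform; keeping
  \<open>\<sigma>\<close> free treats both at once.\<close>

definition osc :: "real \<Rightarrow> (real^'n::finite \<Rightarrow> complex) \<Rightarrow> real^'n \<Rightarrow> complex" where
  "osc \<sigma> f \<xi> = (\<integral>x. f x * cis (\<sigma> * (x \<bullet> \<xi>)) \<partial>lborel)"

lemma cis_borel [measurable]: "cis \<in> borel_measurable borel"
  by (intro borel_measurable_continuous_onI continuous_intros)

lemma fourier_eq_osc: "f \<in> borel_measurable borel \<Longrightarrow> fourier f = osc (- 2 * pi) f"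
  unfolding fourier_def osc_def
  by (subst integral_completion) (auto simp: fun_eq_iff cis_conv_exp mult_ac)

lemma inv_fourier_eq_osc: "f \<in> borel_measurable borel \<Longrightarrow> inv_fourier f = osc (2 * pi) f"
  unfolding inv_fourier_def osc_def
  by (subst integral_completion) (auto simp: fun_eq_iff cis_conv_exp mult_ac inner_commute)

lemma osc_integrable:
  assumes "integrable lborel f" shows "integrable lborel (\<lambda>x. f x * cis (\<sigma> * (x \<bullet> \<xi>)))"
  by (rule Bochner_Integration.integrable_bound[OF assms]) (use assms in \<open>auto simp: norm_mult\<close>)

lemma osc_norm_le: "norm (osc \<sigma> f \<xi>) \<le> (\<integral>x. norm (f x) \<partial>lborel)"
  unfolding osc_def using integral_norm_bound[of lborel "\<lambda>x. f x * cis (\<sigma> * (x \<bullet> \<xi>))"]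
  by (simp add: norm_mult)

lemma norm_cis_diff1: "norm (cis t - 1 - \<i> * of_real t) \<le> t\<^sup>2"
proof -
  have "norm (cis t - 1 - \<i> * of_real t) \<le> t\<^sup>2 / 2"
    using iexp_approx1[of t 1] by (simp add: cis_conv_exp power2_eq_square diff_diff_eq numeral_2_eq_2)
  also have "\<dots> \<le> t\<^sup>2" by simp
  finally show ?thesis .
qed

text \<open>Differentiation under the integral sign. The second-order Taylor estimate for the character bounds the
  remainder by \<open>|h|\<^sup>2\<close> times the integral of \<open>\<sigma>\<^sup>2 (1 + |x|)\<^sup>2 |f x|\<close>, which is finite for Schwartz \<open>f\<close>.\<close>

lemma osc_has_derivative:
  fixes f :: "real^'n::finite \<Rightarrow> complex"
  assumes f: "f \<in> schwartz"
  shows "(osc \<sigma> f has_derivative (\<lambda>h. \<Sum>j\<in>UNIV. of_real (h $ j) * osc \<sigma> (\<lambda>x. \<i> * of_real \<sigma> * (of_real (x $ j) * f x)) \<xi>)) (at \<xi>)"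
    (is "(_ has_derivative ?D) _")
  unfolding has_derivative_at
proof
  show "bounded_linear ?D"
    by (intro bounded_linear_sum bounded_linear_mult_const bounded_linear_compose[OF bounded_linear_of_real] bounded_linear_vec_nth)
  define M where "M = (\<integral>x. \<sigma>\<^sup>2 * ((1 + norm x)\<^sup>2 * norm (f x)) \<partial>lborel)"
  have fj: "(\<lambda>x. \<i> * of_real \<sigma> * (of_real (x $ j) * f x)) \<in> schwartz" for j
    by (intro schwartz_scale schwartz_coord f)
  have bound: "norm (osc \<sigma> f (\<xi> + h) - osc \<sigma> f \<xi> - ?D h) \<le> M * (norm h)\<^sup>2" for h
  proof -
    let ?r = "\<lambda>x. f x * cis (\<sigma> * (x \<bullet> \<xi>)) * (cis (\<sigma> * (x \<bullet> h)) - 1 - \<i> * of_real (\<sigma> * (x \<bullet> h)))"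
    have i1: "integrable lborel (\<lambda>x. f x * cis (\<sigma> * (x \<bullet> \<xi>)))" for \<xi>
      by (rule osc_integrable[OF schwartz_integrable[OF f]])
    have i2: "integrable lborel (\<lambda>x. \<i> * of_real \<sigma> * (of_real (x $ j) * f x) * cis (\<sigma> * (x \<bullet> \<xi>)))" for j
      by (rule osc_integrable[OF schwartz_integrable[OF fj]])
    have "osc \<sigma> f (\<xi> + h) - osc \<sigma> f \<xi> - ?D h = 
      (\<integral>x. f x * cis (\<sigma> * (x \<bullet> (\<xi> + h))) - f x * cis (\<sigma> * (x \<bullet> \<xi>)) - (\<Sum>j\<in>UNIV. of_real (h $ j) * (\<i> * of_real \<sigma> * (of_real (x $ j) * f x) * cis (\<sigma> * (x \<bullet> \<xi>)))) \<partial>lborel)"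
      unfolding osc_def using i1 i2
      by (subst Bochner_Integration.integral_diff Bochner_Integration.integral_sum integral_mult_right_zero;
          (intro Bochner_Integration.integrable_diff Bochner_Integration.integrable_sum integrable_mult_right)?; simp)+
    also have "\<dots> = integral\<^sup>L lborel ?r"
    proof (rule Bochner_Integration.integral_cong[OF refl])
      fix x
      have "(\<Sum>j\<in>UNIV. of_real (h $ j) * (\<i> * of_real \<sigma> * (of_real (x $ j) * f x) * cis (\<sigma> * (x \<bullet> \<xi>)))) =
          f x * cis (\<sigma> * (x \<bullet> \<xi>)) * (\<i> * of_real (\<sigma> * (x \<bullet> h)))"
        by (simp add: inner_vec_def sum_distrib_left sum_distrib_right mult_ac)
      then show "f x * cis (\<sigma> * (x \<bullet> (\<xi> + h))) - f x * cis (\<sigma> * (x \<bullet> \<xi>)) - (\<Sum>j\<in>UNIV. of_real (h $ j) * (\<i> * of_real \<sigma> * (of_real (x $ j) * f x) * cis (\<sigma> * (x \<bullet> \<xi>)))) = ?r x"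
        by (simp add: inner_add_right distrib_left cis_mult[symmetric] algebra_simps)
    qed
    also have "norm \<dots> \<le> (\<integral>x. (norm h)\<^sup>2 * (\<sigma>\<^sup>2 * ((1 + norm x)\<^sup>2 * norm (f x))) \<partial>lborel)"
    proof (rule Bochner_Integration.integral_norm_bound_integral)
      have r: "norm (?r x) \<le> (norm h)\<^sup>2 * (\<sigma>\<^sup>2 * ((1 + norm x)\<^sup>2 * norm (f x)))" for x
      proof -
        have "\<bar>x \<bullet> h\<bar> \<le> (1 + norm x) * norm h"
          using Cauchy_Schwarz_ineq2[of x h] mult_right_mono[of "norm x" "1 + norm x" "norm h"] by simp
        then have "(x \<bullet> h)\<^sup>2 \<le> ((1 + norm x) * norm h)\<^sup>2"
          by (metis abs_ge_zero power2_abs power_mono)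
        then have "(\<sigma> * (x \<bullet> h))\<^sup>2 \<le> \<sigma>\<^sup>2 * ((1 + norm x)\<^sup>2 * (norm h)\<^sup>2)"
          by (simp add: power_mult_distrib mult_left_mono)
        then have "norm (cis (\<sigma> * (x \<bullet> h)) - 1 - \<i> * of_real (\<sigma> * (x \<bullet> h))) \<le> \<sigma>\<^sup>2 * ((1 + norm x)\<^sup>2 * (norm h)\<^sup>2)"
          using norm_cis_diff1 order_trans by blast
        from mult_left_mono[OF this norm_ge_zero[of "f x"]] show ?thesis
          by (simp add: norm_mult mult_ac)
      qed
      then show "norm (?r x) \<le> (norm h)\<^sup>2 * (\<sigma>\<^sup>2 * ((1 + norm x)\<^sup>2 * norm (f x)))" for x .
      show i: "integrable lborel (\<lambda>x. (norm h)\<^sup>2 * (\<sigma>\<^sup>2 * ((1 + norm x)\<^sup>2 * norm (f x))))"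
        by (intro integrable_mult_right schwartz_integrable_power f)
      show "integrable lborel ?r"
        by (rule Bochner_Integration.integrable_bound[OF i]) 
          (use schwartz_borel[OF f] r in \<open>auto intro!: AE_I2 order_trans[OF r]\<close>)
    qed
    also have "\<dots> = M * (norm h)\<^sup>2" by (simp add: M_def)
    finally show ?thesis .
  qed
  show "((\<lambda>h. norm (osc \<sigma> f (\<xi> + h) - osc \<sigma> f \<xi> - ?D h) / norm h) \<longlongrightarrow> 0) (at 0)"
  proof (rule Lim_null_comparison)
    show "\<forall>\<^sub>F h in at 0. norm (norm (osc \<sigma> f (\<xi> + h) - osc \<sigma> f \<xi> - ?D h) / norm h) \<le> M * norm h"
      using bound by (auto simp: eventually_at_filter divide_le_eq power2_eq_square mult_ac intro!: always_eventually)
    show "((\<lambda>h. M * norm h) \<longlongrightarrow> 0) (at 0)"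
      by (auto intro!: tendsto_eq_intros)
  qed
qed

lemma partial_deriv_osc:
  assumes "f \<in> schwartz"
  shows "partial_deriv j (osc \<sigma> f) = osc \<sigma> (\<lambda>x. \<i> * of_real \<sigma> * (of_real (x $ j) * f x))"
  by (rule ext, subst partial_derivI[OF osc_has_derivative[OF assms]])
    (simp add: axis_def if_distrib if_distribR cong: if_cong)

lemma cis_inner_has_derivative:
  "((\<lambda>x::real^'n::finite. cis (\<sigma> * (x \<bullet> \<xi>))) has_derivative (\<lambda>h. (\<sigma> * (h \<bullet> \<xi>)) *\<^sub>R (\<i> * cis (\<sigma> * (x \<bullet> \<xi>))))) (at x)"
  by (auto intro!: derivative_eq_intros)

text \<open>Modulations of Schwartz functions are closed under partial derivatives: the character reproduces
  itself up to a constant factor.\<close>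

lemma schwartz_character:
  fixes f :: "real^'n::finite \<Rightarrow> complex"
  assumes f: "f \<in> schwartz"
  shows "(\<lambda>x. f x * cis (\<sigma> * (x \<bullet> \<xi>))) \<in> schwartz"
    and "partial_deriv j (\<lambda>x. f x * cis (\<sigma> * (x \<bullet> \<xi>))) x =
      partial_deriv j f x * cis (\<sigma> * (x \<bullet> \<xi>)) + \<i> * of_real (\<sigma> * \<xi> $ j) * (f x * cis (\<sigma> * (x \<bullet> \<xi>)))"
proof -
  let ?e = "\<lambda>x. cis (\<sigma> * (x \<bullet> \<xi>))"
  have ed: "?e differentiable at x" for x using cis_inner_has_derivative differentiable_def by blast
  have pd: "partial_deriv j (\<lambda>x. f x * ?e x) x = partial_deriv j f x * ?e x + \<i> * of_real (\<sigma> * \<xi> $ j) * (f x * ?e x)"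
    if "f \<in> schwartz" for f j x
    using that by (simp add: partial_deriv_mult schwartz_differentiable ed partial_derivI[OF cis_inner_has_derivative]
        inner_axis' scaleR_conv_of_real mult_ac)
  show "partial_deriv j (\<lambda>x. f x * ?e x) x = partial_deriv j f x * ?e x + \<i> * of_real (\<sigma> * \<xi> $ j) * (f x * ?e x)"
    by (rule pd[OF f])
  let ?B = "{\<lambda>x. f x * ?e x | f. f \<in> schwartz}"
  have "coord_span ?B \<subseteq> schwartz"
  proof (rule coord_span_schwartz)
    fix h assume "h \<in> ?B"
    then obtain f where h: "h = (\<lambda>x. f x * ?e x)" and f: "f \<in> schwartz" by blast
    show "h differentiable at x" for x
      unfolding h by (intro differentiable_mult schwartz_differentiable f ed)
    show "rapid h" unfolding h
      by (intro rapid_bounded_mult[OF schwartz_rapid[OF f], of _ 1]) (auto simp: norm_mult)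
    fix j
    have "partial_deriv j h = (\<lambda>x. partial_deriv j f x * ?e x + \<i> * of_real (\<sigma> * \<xi> $ j) * (f x * ?e x))"
      unfolding h using pd[OF f] by (auto simp: fun_eq_iff)
    also have "\<dots> \<in> coord_span ?B"
      by (intro coord_span.add coord_span.scale; rule coord_span.base) (use f schwartz_partial_deriv in blast)+
    finally show "partial_deriv j h \<in> coord_span ?B" .
  qed
  then show "(\<lambda>x. f x * ?e x) \<in> schwartz" using coord_span.base[of _ ?B] f by blast
qed

text \<open>Integration by parts: the derivative of \<open>f\<close> times the character has integral zero.\<close>

lemma osc_partial_deriv:
  assumes f: "f \<in> schwartz"
  shows "osc \<sigma> (partial_deriv j f) \<xi> = - \<i> * of_real (\<sigma> * \<xi> $ j) * osc \<sigma> f \<xi>"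
proof -
  have "partial_deriv j (\<lambda>x. f x * cis (\<sigma> * (x \<bullet> \<xi>))) =
      (\<lambda>x. partial_deriv j f x * cis (\<sigma> * (x \<bullet> \<xi>)) + \<i> * of_real (\<sigma> * \<xi> $ j) * (f x * cis (\<sigma> * (x \<bullet> \<xi>))))"
    by (rule ext) (rule schwartz_character(2)[OF f])
  then have "0 = (\<integral>x. partial_deriv j f x * cis (\<sigma> * (x \<bullet> \<xi>)) + \<i> * of_real (\<sigma> * \<xi> $ j) * (f x * cis (\<sigma> * (x \<bullet> \<xi>))) \<partial>lborel)"
    using integral_partial_deriv[OF schwartz_character(1)[OF f], of j \<sigma> \<xi>]
    by (simp only:)
  also have "\<dots> = osc \<sigma> (partial_deriv j f) \<xi> + \<i> * of_real (\<sigma> * \<xi> $ j) * osc \<sigma> f \<xi>"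
    unfolding osc_def
    by (subst Bochner_Integration.integral_add;
        (intro schwartz_integrable schwartz_scale schwartz_character schwartz_partial_deriv f)?) simp
  finally show ?thesis by (simp add: eq_neg_iff_add_eq_0)
qed

text \<open>Boundedness improves to rapid decrease within a family that is stable under multiplication by
  coordinates, since \<open>|x| \<le> |x\<^sub>1| + \<dots> + |x\<^sub>n|\<close>.\<close>

lemma rapidI_coord:
  fixes S :: "(real^'n::finite \<Rightarrow> complex) set"
  assumes bd: "\<And>f. f \<in> S \<Longrightarrow> \<exists>B. \<forall>x. norm (f x) \<le> B"
    and co: "\<And>f j. f \<in> S \<Longrightarrow> (\<lambda>x. of_real (x $ j) * f x) \<in> S"
    and f: "f \<in> S"
  shows "rapid f"
proof -
  have "\<exists>B. \<forall>x. (1 + norm x) ^ m * norm (f x) \<le> B" if "f \<in> S" for m f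
    using that
  proof (induction m arbitrary: f)
    case 0
    then show ?case using bd by simp
  next
    case (Suc m)
    obtain B0 where B0: "\<And>x. (1 + norm x) ^ m * norm (f x) \<le> B0" using Suc by metis
    have "\<exists>B. \<forall>x. (1 + norm x) ^ m * norm (complex_of_real (x $ j) * f x) \<le> B" for j
      using Suc.IH[OF co[OF Suc.prems]] by simp
    then obtain B where B: "\<And>j x. (1 + norm x) ^ m * norm (complex_of_real (x $ j) * f x) \<le> B j" by metis
    have "(1 + norm x) ^ Suc m * norm (f x) \<le> B0 + (\<Sum>j\<in>UNIV. B j)" for x
    proof -
      have "(1 + norm x) ^ Suc m * norm (f x) = (1 + norm x) ^ m * norm (f x) + norm x * ((1 + norm x) ^ m * norm (f x))"
        by (simp add: algebra_simps)
      also have "norm x * ((1 + norm x) ^ m * norm (f x)) \<le> (\<Sum>j\<in>UNIV. \<bar>x $ j\<bar>) * ((1 + norm x) ^ m * norm (f x))"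
        by (intro mult_right_mono norm_le_l1_cart) auto
      also have "\<dots> = (\<Sum>j\<in>UNIV. (1 + norm x) ^ m * norm (complex_of_real (x $ j) * f x))"
        unfolding sum_distrib_right by (rule sum.cong) (auto simp: norm_mult)
      also have "\<dots> \<le> (\<Sum>j\<in>UNIV. B j)" by (intro sum_mono B)
      finally show ?thesis using B0[of x] by simp
    qed
    then show ?case by blast
  qed
  with f show ?thesis unfolding rapid_def by blast
qed

text \<open>The Fourier transforms of Schwartz functions are bounded, and the family of all of them is stable under
  multiplication by coordinates (which come from derivatives) and under partial derivatives (which
  come from multiplication by coordinates); this already forces rapid decrease of all derivatives.\<close>

lemma schwartz_osc:
  fixes f :: "real^'n::finite \<Rightarrow> complex"
  assumes f: "f \<in> schwartz" and \<sigma>: "\<sigma> \<noteq> 0"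
  shows "osc \<sigma> f \<in> schwartz"
proof -
  let ?S = "osc \<sigma> ` (schwartz :: (real^'n \<Rightarrow> complex) set)"
  have co: "(\<lambda>x. of_real (x $ j) * g x) \<in> ?S" if g: "g \<in> ?S" for g j
  proof -
    obtain f where f: "f \<in> schwartz" and g: "g = osc \<sigma> f" using g by blast
    have "osc \<sigma> (\<lambda>x. (\<i> / of_real \<sigma>) * partial_deriv j f x) = (\<lambda>x. of_real (x $ j) * g x)"
    proof
      fix \<xi>
      have "osc \<sigma> (\<lambda>x. (\<i> / of_real \<sigma>) * partial_deriv j f x) \<xi> = (\<i> / of_real \<sigma>) * osc \<sigma> (partial_deriv j f) \<xi>"
        unfolding osc_def by (subst integral_mult_right_zero[symmetric]) (simp add: mult.assoc)
      also have "\<dots> = of_real (\<xi> $ j) * g \<xi>"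
        using \<sigma> by (simp add: osc_partial_deriv[OF f] g field_simps)
      finally show "osc \<sigma> (\<lambda>x. (\<i> / of_real \<sigma>) * partial_deriv j f x) \<xi> = of_real (\<xi> $ j) * g \<xi>" .
    qed
    then show ?thesis using schwartz_scale[OF schwartz_partial_deriv[OF f]] by (metis imageI)
  qed
  have "coord_span ?S \<subseteq> schwartz"
  proof (rule coord_span_schwartz)
    fix g assume "g \<in> ?S"
    then obtain f where f: "f \<in> schwartz" and g: "g = osc \<sigma> f" by blast
    show "g differentiable at x" for x
      unfolding g using osc_has_derivative[OF f] differentiable_def by blast
    show "rapid g"
      by (rule rapidI_coord[OF _ co \<open>g \<in> ?S\<close>]) (use osc_norm_le in blast)
    show "partial_deriv j g \<in> coord_span ?S" for j
      unfolding g partial_deriv_osc[OF f]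
      by (intro coord_span.base imageI schwartz_scale schwartz_coord f)
  qed
  then show ?thesis using f coord_span.base[of _ ?S] by blast
qed

section \<open>Gaussians\<close>

definition gauss :: "real \<Rightarrow> real^'n::finite \<Rightarrow> complex" where
  "gauss b x = of_real (exp (- (b\<^sup>2 * (x \<bullet> x))))"

lemma gauss_borel [measurable]: "gauss b \<in> borel_measurable borel"
  unfolding gauss_def by measurable

lemma norm_gauss: "norm (gauss b x) = exp (- (b\<^sup>2 * (x \<bullet> x)))"
  by (simp add: gauss_def)

lemma gauss_has_derivative:
  fixes x :: "real^'n::finite"
  shows "(gauss b has_derivative (\<lambda>h. of_real (- (2 * b\<^sup>2 * (h \<bullet> x))) * gauss b x)) (at x)"
proof -
  have "((\<lambda>x::real^'n. exp (- (b\<^sup>2 * (x \<bullet> x)))) has_derivative (\<lambda>h. (- (2 * b\<^sup>2 * (h \<bullet> x))) * exp (- (b\<^sup>2 * (x \<bullet> x))))) (at x)"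
    by (auto intro!: derivative_eq_intros simp: inner_commute algebra_simps)
  from has_derivative_of_real[OF this] show ?thesis
    unfolding gauss_def[abs_def] by simp
qed

text \<open>From \<open>(1 + r)\<^sup>2 \<le> 2 + 2 r\<^sup>2\<close> the Gaussian is at most a constant times \<open>exp (- c (1 + r)\<^sup>2)\<close> with
  \<open>c = b\<^sup>2 / 2\<close>, and \<open>(1 + u / N)\<^sup>N \<le> exp u\<close> beats any given power.\<close>

lemma rapid_gauss: assumes "b > 0" shows "rapid (gauss b :: real^'n::finite \<Rightarrow> complex)"
  unfolding rapid_def
proof
  fix m
  define c where "c = b\<^sup>2 / 2"
  have c: "c > 0" using assms by (simp add: c_def)
  define K where "K = exp (b\<^sup>2) * (real (Suc m) / c) ^ Suc m"
  have "(1 + norm x) ^ m * norm (gauss b x) \<le> K" for x :: "real^'n"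
  proof -
    define y where "y = 1 + norm x"
    have y: "y \<ge> 1" by (simp add: y_def)
    have "y\<^sup>2 \<le> 2 + 2 * (norm x)\<^sup>2"
      unfolding y_def using sum_squares_ge_zero[of "norm x - 1" 0] by (simp add: power2_eq_square algebra_simps)
    then have "c * y\<^sup>2 \<le> c * (2 + 2 * (norm x)\<^sup>2)" using c by (intro mult_left_mono) auto
    also have "\<dots> = b\<^sup>2 + b\<^sup>2 * (x \<bullet> x)" by (simp add: c_def power2_norm_eq_inner algebra_simps)
    finally have 1: "norm (gauss b x) \<le> exp (b\<^sup>2) * exp (- (c * y\<^sup>2))"
      by (simp add: norm_gauss mult_exp_exp)
    have "(c * y / real (Suc m)) ^ Suc m \<le> (1 + (c * y\<^sup>2) / real (Suc m)) ^ Suc m"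
    proof (intro power_mono)
      have "c * y \<le> c * y\<^sup>2" using c y by (intro mult_left_mono) (auto simp: power2_eq_square)
      then have "c * y / real (Suc m) \<le> c * y\<^sup>2 / real (Suc m)" by (intro divide_right_mono) auto
      then show "c * y / real (Suc m) \<le> 1 + c * y\<^sup>2 / real (Suc m)" by linarith
    qed (use c y in auto)
    also have "\<dots> \<le> exp (c * y\<^sup>2)"
    proof (rule exp_ge_one_plus_x_over_n_power_n)
      have "0 \<le> c * y\<^sup>2" using c by simp
      then show "- real (Suc m) \<le> c * y\<^sup>2" by linarith
    qed simp
    finally have 2: "(c * y / real (Suc m)) ^ Suc m \<le> exp (c * y\<^sup>2)" .
    have "y ^ m \<le> y ^ Suc m" using y by (intro power_increasing) auto
    also have "\<dots> = (real (Suc m) / c) ^ Suc m * (c * y / real (Suc m)) ^ Suc m"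
    proof -
      have "real (Suc m) / c * (c * y / real (Suc m)) = y" using c by (simp del: of_nat_Suc)
      then show ?thesis by (simp only: power_mult_distrib[symmetric])
    qed
    also have "\<dots> \<le> (real (Suc m) / c) ^ Suc m * exp (c * y\<^sup>2)"
      using c by (intro mult_left_mono 2) auto
    finally have "y ^ m * norm (gauss b x) \<le> ((real (Suc m) / c) ^ Suc m * exp (c * y\<^sup>2)) * (exp (b\<^sup>2) * exp (- (c * y\<^sup>2)))"
      using c by (intro mult_mono 1) auto
    also have "\<dots> = K * (exp (c * y\<^sup>2) * exp (- (c * y\<^sup>2)))" by (simp only: K_def mult_ac)
    also have "\<dots> = K" by (simp add: exp_minus_inverse)
    finally show ?thesis by (simp add: y_def)
  qed
  then show "\<exists>B. \<forall>x::real^'n. (1 + norm x) ^ m * norm (gauss b x) \<le> B" by blast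
qed

lemma partial_deriv_gauss:
  "partial_deriv j (gauss b) = (\<lambda>x. of_real (- 2 * b\<^sup>2) * (of_real (x $ j) * gauss b x))"
  by (rule ext, subst partial_derivI[OF gauss_has_derivative]) (simp add: inner_axis')

lemma schwartz_gauss:
  assumes "b > 0" shows "(gauss b :: real^'n::finite \<Rightarrow> complex) \<in> schwartz"
proof -
  have "coord_span {gauss b :: real^'n \<Rightarrow> complex} \<subseteq> schwartz"
  proof (rule coord_span_schwartz)
    fix f :: "real^'n \<Rightarrow> complex" assume f: "f \<in> {gauss b}"
    show "f differentiable at x" for x using f gauss_has_derivative differentiable_def by blast
    show "rapid f" using f rapid_gauss assms by blast
    show "partial_deriv j f \<in> coord_span {gauss b}" for j
      unfolding singletonD[OF f] partial_deriv_gauss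
      by (intro coord_span.coord coord_span.scale coord_span.base) simp
  qed
  then show ?thesis using coord_span.base[of _ "{gauss b}"] by blast
qed

text \<open>The integral of a Gaussian, kept as an unevaluated positive constant; only its behaviour under
  scaling enters the estimates. The type argument records the dimension.\<close>

definition gauss_mass :: "'n::finite itself \<Rightarrow> real \<Rightarrow> real" where
  "gauss_mass _ b = (\<integral>x. exp (- (b\<^sup>2 * ((x::real^'n) \<bullet> x))) \<partial>lborel)"

lemma gauss_integrable:
  "b > 0 \<Longrightarrow> integrable lborel (\<lambda>x::real^'n::finite. exp (- (b\<^sup>2 * (x \<bullet> x))))"
  using integrable_norm[OF schwartz_integrable[OF schwartz_gauss]] by (simp add: norm_gauss)

lemma gauss_mass_pos: assumes "b > 0" shows "gauss_mass TYPE('n::finite) b > 0"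
proof -
  have "gauss_mass TYPE('n) b \<noteq> 0"
  proof
    assume "gauss_mass TYPE('n) b = 0"
    then have "AE x::real^'n in lborel. exp (- (b\<^sup>2 * (x \<bullet> x))) = 0"
      unfolding gauss_mass_def using gauss_integrable[OF assms]
      by (subst (asm) integral_nonneg_eq_0_iff_AE) auto
    then have "emeasure lborel (UNIV :: (real^'n) set) = 0"
      by (simp add: eventually_False ae_filter_eq_bot_iff)
    then show False by simp
  qed
  moreover have "gauss_mass TYPE('n) b \<ge> 0" unfolding gauss_mass_def by simp
  ultimately show ?thesis by simp
qed

lemma gauss_mass_scale:
  assumes "b > 0" shows "b ^ CARD('n) * gauss_mass TYPE('n::finite) b = gauss_mass TYPE('n) 1"
  unfolding gauss_mass_def
  using assms by (subst (2) integral_affine[where c=b and t=0]) (auto simp: power2_eq_square mult_ac)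

text \<open>Differentiation turns into multiplication by a coordinate and back, so the transform \<open>F\<close> of a Gaussian
  solves \<open>\<partial>\<^sub>j F = - (\<sigma>\<^sup>2 / (2 b\<^sup>2)) \<xi>\<^sub>j F\<close>. Thus \<open>F\<close> times the reciprocal of the claimed Gaussian has vanishing
  derivative and equals its value at the origin.\<close>

lemma osc_gauss:
  fixes \<xi> :: "real^'n::finite"
  assumes b: "b > 0"
  shows "osc \<sigma> (gauss b) \<xi> = of_real (gauss_mass TYPE('n) b * exp (- (\<sigma>\<^sup>2 / (4 * b\<^sup>2) * (\<xi> \<bullet> \<xi>))))"
proof -
  define \<kappa> where "\<kappa> = \<sigma>\<^sup>2 / (4 * b\<^sup>2)"
  let ?g = "gauss b :: real^'n \<Rightarrow> complex"
  let ?H = "\<lambda>\<xi>::real^'n. osc \<sigma> (gauss b) \<xi> * of_real (exp (\<kappa> * (\<xi> \<bullet> \<xi>)))"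
  note gs = schwartz_gauss[OF b, where 'n='n]
  have D: "(osc \<sigma> ?g has_derivative (\<lambda>h. - of_real (2 * \<kappa> * (h \<bullet> \<xi>)) * osc \<sigma> ?g \<xi>)) (at \<xi>)" for \<xi>
  proof -
    have "osc \<sigma> (\<lambda>x. \<i> * of_real \<sigma> * (of_real (x $ j) * ?g x)) \<xi> = - of_real (2 * \<kappa> * \<xi> $ j) * osc \<sigma> ?g \<xi>" for j
    proof -
      have "osc \<sigma> (\<lambda>x. \<i> * of_real \<sigma> * (of_real (x $ j) * ?g x)) \<xi> =
          osc \<sigma> (\<lambda>x. (\<i> * of_real \<sigma> / of_real (- 2 * b\<^sup>2)) * partial_deriv j ?g x) \<xi>"
        by (rule arg_cong[where f="\<lambda>f. osc \<sigma> f \<xi>"], rule ext) (use b in \<open>simp add: partial_deriv_gauss field_simps\<close>)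
      also have "\<dots> = (\<i> * of_real \<sigma> / of_real (- 2 * b\<^sup>2)) * osc \<sigma> (partial_deriv j ?g) \<xi>"
        unfolding osc_def by (subst integral_mult_right_zero[symmetric]) (simp add: mult.assoc)
      also have "\<dots> = - of_real (2 * \<kappa> * \<xi> $ j) * osc \<sigma> ?g \<xi>"
        using b by (simp add: osc_partial_deriv[OF gs] \<kappa>_def power2_eq_square field_simps)
      finally show ?thesis .
    qed
    then have "(\<Sum>j\<in>UNIV. of_real (h $ j) * osc \<sigma> (\<lambda>x. \<i> * of_real \<sigma> * (of_real (x $ j) * ?g x)) \<xi>)
        = - of_real (2 * \<kappa> * (h \<bullet> \<xi>)) * osc \<sigma> ?g \<xi>" for h
      by (simp add: inner_vec_def sum_distrib_left sum_distrib_right sum_negf mult_ac)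
    with osc_has_derivative[OF gs, of \<sigma> \<xi>] show ?thesis by simp
  qed
  have E: "((\<lambda>\<xi>::real^'n. complex_of_real (exp (\<kappa> * (\<xi> \<bullet> \<xi>)))) has_derivative 
      (\<lambda>h. of_real (2 * \<kappa> * (h \<bullet> \<xi>) * exp (\<kappa> * (\<xi> \<bullet> \<xi>))))) (at \<xi>)" for \<xi>
    by (rule has_derivative_of_real) (auto intro!: derivative_eq_intros simp: inner_commute algebra_simps)
  have "(?H has_derivative (\<lambda>h. 0)) (at \<xi> within UNIV)" for \<xi>
    using has_derivative_mult[OF D E] by (simp add: algebra_simps)
  then obtain c where c: "\<And>\<xi>. ?H \<xi> = c"
    using has_derivative_zero_constant[of UNIV ?H] by blast
  have "?H \<xi> = ?H 0" by (simp only: c)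
  also have "\<dots> = of_real (gauss_mass TYPE('n) b)"
    by (simp add: osc_def gauss_mass_def gauss_def)
  finally show ?thesis by (simp add: \<kappa>_def exp_minus field_simps)
qed

text \<open>A Gaussian of integral one; it tends to the point mass at the origin as \<open>a\<close> grows and flattens out as
  \<open>a\<close> tends to zero. Both regimes supply the functions that refute an embedding.\<close>

definition unit_gauss :: "real \<Rightarrow> real^'n::finite \<Rightarrow> complex" where
  "unit_gauss a x = of_real (a ^ CARD('n) / gauss_mass TYPE('n) 1) * gauss a x"

lemma schwartz_unit_gauss: "a > 0 \<Longrightarrow> (unit_gauss a :: real^'n::finite \<Rightarrow> complex) \<in> schwartz"
  unfolding unit_gauss_def[abs_def] by (intro schwartz_scale schwartz_gauss) simp

lemma unit_gauss_borel [measurable]: "unit_gauss a \<in> borel_measurable borel"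
  unfolding unit_gauss_def by measurable

lemma norm_unit_gauss:
  fixes x :: "real^'n::finite"
  assumes "a > 0"
  shows "norm (unit_gauss a x) = a ^ CARD('n) / gauss_mass TYPE('n) 1 * exp (- (a\<^sup>2 * (x \<bullet> x)))"
  using gauss_mass_pos[of 1, where 'n='n] assms
  by (simp only: unit_gauss_def norm_mult norm_gauss norm_of_real) simp

lemma integral_norm_unit_gauss:
  assumes "a > 0"
  shows "(\<integral>x. norm (unit_gauss a x) \<partial>(lborel :: (real^'n::finite) measure)) = 1"
proof -
  have "(\<integral>x. norm (unit_gauss a x) \<partial>(lborel :: (real^'n) measure)) = 
      a ^ CARD('n) / gauss_mass TYPE('n) 1 * gauss_mass TYPE('n) a"
    using assms by (simp add: norm_unit_gauss gauss_mass_def[of _ a])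
  also have "\<dots> = 1"
    using gauss_mass_scale[OF assms, where 'n='n] gauss_mass_pos[of 1, where 'n='n] 
    by (simp add: field_simps)
  finally show ?thesis .
qed

lemma integral_unit_gauss:
  assumes "a > 0" shows "(\<integral>x. unit_gauss a x \<partial>(lborel :: (real^'n::finite) measure)) = 1"
proof -
  have "unit_gauss a x = of_real (norm (unit_gauss a x))" for x :: "real^'n"
    unfolding norm_unit_gauss[OF assms] by (simp add: unit_gauss_def gauss_def)
  then have "(\<integral>x. unit_gauss a x \<partial>(lborel :: (real^'n) measure)) = (\<integral>x. complex_of_real (norm (unit_gauss a (x :: real^'n))) \<partial>lborel)"
    by (intro Bochner_Integration.integral_cong refl)
  then show ?thesis by (simp only: integral_complex_of_real integral_norm_unit_gauss[OF assms] of_real_1)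
qed

definition gauss_moment :: "'n::finite itself \<Rightarrow> real" where
  "gauss_moment _ = (\<integral>x. norm (x::real^'n) * norm (unit_gauss 1 x) \<partial>lborel)"

lemma gauss_moment_nonneg: "gauss_moment TYPE('n::finite) \<ge> 0"
  by (simp add: gauss_moment_def)

lemma unit_gauss_moment:
  assumes a: "a > 0"
  shows "integrable lborel (\<lambda>x::real^'n::finite. norm x * norm (unit_gauss a x))"
    and "(\<integral>x. norm (x::real^'n) * norm (unit_gauss a x) \<partial>lborel) = gauss_moment TYPE('n) / a"
proof -
  show "integrable lborel (\<lambda>x::real^'n. norm x * norm (unit_gauss a x))"
    by (rule Bochner_Integration.integrable_bound[OF schwartz_integrable_power[OF schwartz_unit_gauss[OF a], of 1]])
      (auto intro!: AE_I2 mult_right_mono)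
  have "norm (a *\<^sub>R x) * norm (unit_gauss 1 (a *\<^sub>R x)) = (a / a ^ CARD('n)) * (norm x * norm (unit_gauss a x))"
    for x :: "real^'n"
    using a by (simp add: norm_unit_gauss power2_eq_square mult_ac)
  then have "gauss_moment TYPE('n) = a * (\<integral>x. norm (x::real^'n) * norm (unit_gauss a x) \<partial>lborel)"
    unfolding gauss_moment_def using a by (subst integral_affine[where c = a and t = 0]) auto
  then show "(\<integral>x. norm (x::real^'n) * norm (unit_gauss a x) \<partial>lborel) = gauss_moment TYPE('n) / a"
    using a by (simp add: field_simps)
qed

text \<open>Averaging against a unit Gaussian moves the value at the origin by at most the Lipschitz
  constant there times the first moment, which is of order \<open>1 / a\<close>.\<close>

lemma unit_gauss_approx:
  fixes \<Phi> :: "real^'n::finite \<Rightarrow> complex"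
  assumes [measurable]: "\<Phi> \<in> borel_measurable borel" and L: "\<And>x. norm (\<Phi> x - \<Phi> 0) \<le> L * norm x" and a: "a > 0"
  shows "integrable lborel (\<lambda>x. unit_gauss a x * \<Phi> x)"
    and "norm ((\<integral>x. unit_gauss a x * \<Phi> x \<partial>lborel) - \<Phi> 0) \<le> L * (gauss_moment TYPE('n) / a)"
proof -
  let ?d = "\<lambda>x. unit_gauss a x * (\<Phi> x - \<Phi> 0)"
  have le: "norm (?d x) \<le> L * (norm x * norm (unit_gauss a x))" for x
    using mult_left_mono[OF L norm_ge_zero[of "unit_gauss a x"]] by (simp add: norm_mult mult_ac)
  have iL: "integrable lborel (\<lambda>x::real^'n. L * (norm x * norm (unit_gauss a x)))"
    by (intro integrable_mult_right unit_gauss_moment a)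
  have i1: "integrable lborel ?d"
    by (rule Bochner_Integration.integrable_bound[OF iL]) (measurable, use order_trans[OF le abs_ge_self] in auto)
  have i0: "integrable lborel (\<lambda>x. unit_gauss a x * \<Phi> 0)"
    by (intro integrable_mult_left schwartz_integrable schwartz_unit_gauss a)
  have eq: "(\<lambda>x. unit_gauss a x * \<Phi> x) = (\<lambda>x. ?d x + unit_gauss a x * \<Phi> 0)"
    by (simp add: algebra_simps)
  show "integrable lborel (\<lambda>x. unit_gauss a x * \<Phi> x)"
    unfolding eq using i1 i0 by (rule Bochner_Integration.integrable_add)
  have "(\<integral>x. unit_gauss a x * \<Phi> x \<partial>lborel) - \<Phi> 0 = integral\<^sup>L lborel ?d"
    unfolding eq Bochner_Integration.integral_add[OF i1 i0] by (simp add: integral_unit_gauss[OF a])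
  also have "norm \<dots> \<le> (\<integral>x. L * (norm x * norm (unit_gauss a (x::real^'n))) \<partial>lborel)"
    by (rule Bochner_Integration.integral_norm_bound_integral[OF i1 iL le])
  finally show "norm ((\<integral>x. unit_gauss a x * \<Phi> x \<partial>lborel) - \<Phi> 0) \<le> L * (gauss_moment TYPE('n) / a)"
    by (simp add: unit_gauss_moment[OF a])
qed

lemma unit_gauss_tendsto:
  assumes \<Phi>: "\<Phi> \<in> schwartz"
  shows "((\<lambda>a. \<integral>x. unit_gauss a x * \<Phi> x \<partial>lborel) \<longlongrightarrow> \<Phi> 0) at_top"
proof -
  obtain L where L: "\<And>x y. norm (\<Phi> x - \<Phi> y) \<le> L * norm (x - y)" using schwartz_lipschitz[OF \<Phi>] by blast
  have "\<forall>\<^sub>F a in at_top. norm ((\<integral>x. unit_gauss a x * \<Phi> x \<partial>lborel) - \<Phi> 0) \<le> L * gauss_moment TYPE('a) / a"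
    using eventually_gt_at_top[of 0]
    by eventually_elim (use unit_gauss_approx(2)[OF schwartz_borel[OF \<Phi>], of L] L[of _ 0] in simp)
  moreover have "((\<lambda>a. L * gauss_moment TYPE('a) / a) \<longlongrightarrow> 0) at_top"
    by (intro tendsto_divide_0[OF tendsto_const] filterlim_at_top_imp_at_infinity filterlim_ident)
  ultimately show ?thesis by (subst LIM_zero_iff[symmetric]) (rule Lim_null_comparison)
qed

section \<open>Wave packets\<close>

text \<open>A Gaussian at the spatial scale \<open>1 / b\<close> that oscillates with frequency \<open>- \<xi>0\<close>. Its inverse Fourier
  transform is, up to a constant independent of \<open>b\<close> and \<open>\<xi>0\<close>, the unit Gaussian of width comparable to \<open>b\<close> centred at \<open>\<xi>0\<close>,
  which makes it the test function that reads off the value of a multiplier at \<open>\<xi>0\<close>.\<close>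

definition wave_packet :: "real \<Rightarrow> real^'n::finite \<Rightarrow> real^'n \<Rightarrow> complex" where
  "wave_packet b \<xi>0 x = gauss b x * cis (- 2 * pi * (x \<bullet> \<xi>0))"

lemma schwartz_wave_packet: "b > 0 \<Longrightarrow> wave_packet b \<xi>0 \<in> schwartz"
  using schwartz_character(1)[OF schwartz_gauss, of b "- 2 * pi"] by (simp add: wave_packet_def[abs_def])

lemma norm_wave_packet: "norm (wave_packet b \<xi>0 x) = exp (- (b\<^sup>2 * (x \<bullet> x)))"
  by (simp add: wave_packet_def norm_mult norm_gauss)

text \<open>The factor between the inverse Fourier transform of a wave packet and a unit Gaussian; like the mass of
  a Gaussian it is kept unevaluated, the point being that it is the same for all wave packets.\<close>

definition packet_mass :: "'n::finite itself \<Rightarrow> real" where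
  "packet_mass _ = (gauss_mass TYPE('n) 1)\<^sup>2 / pi ^ CARD('n)"

lemma packet_mass_pos: "packet_mass TYPE('n::finite) > 0"
  using gauss_mass_pos[of 1, where 'n='n] by (simp add: packet_mass_def)

lemma osc_wave_packet:
  fixes \<xi> :: "real^'n::finite"
  assumes b: "b > 0"
  shows "osc (2 * pi) (wave_packet b \<xi>0) \<xi> = of_real (packet_mass TYPE('n)) * unit_gauss (pi / b) (\<xi> - \<xi>0)"
proof -
  let ?m = "gauss_mass TYPE('n)"
  have "osc (2 * pi) (wave_packet b \<xi>0) \<xi> = osc (2 * pi) (gauss b) (\<xi> - \<xi>0)"
    unfolding osc_def wave_packet_def by (simp add: inner_diff_right algebra_simps cis_mult)
  also have "\<dots> = of_real (?m b) * gauss (pi / b) (\<xi> - \<xi>0)"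
    using b by (simp add: osc_gauss gauss_def power_divide power2_eq_square)
  also have "?m b = packet_mass TYPE('n) * ((pi / b) ^ CARD('n) / ?m 1)"
    using b gauss_mass_pos[of 1, where 'n='n] gauss_mass_scale[OF b, where 'n='n]
    by (simp add: packet_mass_def power_divide power2_eq_square field_simps)
  finally show ?thesis by (simp add: unit_gauss_def)
qed

text \<open>A translated unit Gaussian is, up to a constant factor, the inverse Fourier transform of a wave packet.\<close>

lemma schwartz_unit_gauss_translate:
  assumes a: "a > 0" shows "(\<lambda>x::real^'n::finite. unit_gauss a (x - z)) \<in> schwartz"
proof -
  let ?m = "complex_of_real (packet_mass TYPE('n))"
  have "(\<lambda>x. unit_gauss a (x - z)) = (\<lambda>x. inverse ?m * osc (2 * pi) (wave_packet (pi / a) z) x)"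
    using a packet_mass_pos[where 'n='n] by (simp add: osc_wave_packet fun_eq_iff)
  then show ?thesis
    using a by (simp only:) (intro schwartz_scale schwartz_osc schwartz_wave_packet, auto)
qed

section \<open>The adjoint of a frequency multiplier\<close>

text \<open>The operator on test functions whose transpose is \<open>box_op \<eta>\<close> on distributions.\<close>

definition adj_multiplier :: "(real^'n::finite \<Rightarrow> complex) \<Rightarrow> (real^'n \<Rightarrow> complex) \<Rightarrow> real^'n \<Rightarrow> complex" where
  "adj_multiplier \<eta> \<phi> = osc (- 2 * pi) (\<lambda>\<xi>. \<eta> \<xi> * osc (2 * pi) \<phi> \<xi>)"

lemma schwartz_adj_multiplier:
  "\<eta> \<in> schwartz \<Longrightarrow> \<phi> \<in> schwartz \<Longrightarrow> adj_multiplier \<eta> \<phi> \<in> schwartz"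
  unfolding adj_multiplier_def by (intro schwartz_osc schwartz_mult) auto

lemma box_op_regular:
  assumes "\<eta> \<in> schwartz" "\<phi> \<in> schwartz"
  shows "box_op \<eta> (regular_distr f) \<phi> = (\<integral>x. f x * adj_multiplier \<eta> \<phi> x \<partial>lebesgue)"
proof -
  have 1: "inv_fourier \<phi> = osc (2 * pi) \<phi>" "osc (2 * pi) \<phi> \<in> schwartz"
    using assms by (auto intro!: inv_fourier_eq_osc schwartz_borel schwartz_osc)
  have 2: "(\<lambda>\<xi>. \<eta> \<xi> * osc (2 * pi) \<phi> \<xi>) \<in> schwartz" by (intro schwartz_mult assms 1)
  then have 3: "fourier (\<lambda>\<xi>. \<eta> \<xi> * osc (2 * pi) \<phi> \<xi>) = adj_multiplier \<eta> \<phi>"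
    unfolding adj_multiplier_def using fourier_eq_osc schwartz_borel by blast
  show ?thesis
    unfolding box_op_def inv_fourier_distr_def mult_distr_def fourier_distr_def regular_distr_def
    using assms 1 2 3 schwartz_adj_multiplier[OF assms] by simp
qed

text \<open>On the Fourier side the wave packet is a unit Gaussian around \<open>\<xi>0\<close>, so the value at \<open>x\<close> is an average of \<open>\<eta>\<close>
  times the character of \<open>x\<close>, and the Lipschitz constant of this product at \<open>\<xi>0\<close> is \<open>L + 2 \<pi> M |x|\<close>.\<close>

lemma adj_multiplier_wave_packet:
  fixes \<eta> :: "real^'n::finite \<Rightarrow> complex"
  assumes \<eta>: "\<eta> \<in> schwartz" and b: "b > 0"
    and L: "L \<ge> 0" "\<And>\<xi>. norm (\<eta> \<xi> - \<eta> \<xi>0) \<le> L * norm (\<xi> - \<xi>0)" and M: "\<And>\<xi>. norm (\<eta> \<xi>) \<le> M"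
  shows "norm (adj_multiplier \<eta> (wave_packet b \<xi>0) x - of_real (packet_mass TYPE('n)) * (\<eta> \<xi>0 * cis (- 2 * pi * (x \<bullet> \<xi>0))))
    \<le> packet_mass TYPE('n) * ((L + 2 * pi * M * norm x) * (gauss_moment TYPE('n) * b / pi))"
proof -
  let ?c = "packet_mass TYPE('n)"
  let ?\<Phi> = "\<lambda>y. \<eta> (\<xi>0 + y) * cis (- 2 * pi * (x \<bullet> (\<xi>0 + y)))"
  have [measurable]: "\<eta> \<in> borel_measurable borel" using schwartz_borel[OF \<eta>] .
  have "adj_multiplier \<eta> (wave_packet b \<xi>0) x =
      (\<integral>\<xi>. of_real ?c * (unit_gauss (pi / b) (\<xi> - \<xi>0) * (\<eta> \<xi> * cis (- 2 * pi * (x \<bullet> \<xi>)))) \<partial>lborel)"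
    unfolding adj_multiplier_def osc_wave_packet[OF b] osc_def[of "- 2 * pi"] by (simp add: inner_commute mult_ac)
  also have "\<dots> = of_real ?c * (\<integral>y. unit_gauss (pi / b) y * ?\<Phi> y \<partial>lborel)"
    by (subst integral_affine[where c = 1 and t = \<xi>0]) (auto simp: add.commute)
  finally have eq: "adj_multiplier \<eta> (wave_packet b \<xi>0) x = of_real ?c * (\<integral>y. unit_gauss (pi / b) y * ?\<Phi> y \<partial>lborel)" .
  have meas: "?\<Phi> \<in> borel_measurable borel" by measurable
  have "norm (?\<Phi> y - ?\<Phi> 0) \<le> (L + 2 * pi * M * norm x) * norm y" for y
  proof -
    let ?\<theta> = "- 2 * pi * (x \<bullet> y)"
    have "norm (cis ?\<theta> - 1) \<le> \<bar>?\<theta>\<bar>" using iexp_approx1[of ?\<theta> 0] by (simp add: cis_conv_exp)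
    also have "\<dots> \<le> 2 * pi * (norm x * norm y)"
      using Cauchy_Schwarz_ineq2[of x y] by (simp add: abs_mult)
    finally have 1: "norm (\<eta> (\<xi>0 + y) * (cis ?\<theta> - 1)) \<le> M * (2 * pi * (norm x * norm y))"
      unfolding norm_mult by (intro mult_mono M) (auto intro: order_trans[OF norm_ge_zero M])
    have eqy: "?\<Phi> y = \<eta> (\<xi>0 + y) * cis ?\<theta> * cis (- 2 * pi * (x \<bullet> \<xi>0))"
      by (simp add: cis_mult mult.assoc inner_add_right algebra_simps)
    have "norm (?\<Phi> y - ?\<Phi> 0) = norm (\<eta> (\<xi>0 + y) * cis ?\<theta> - \<eta> \<xi>0)"
      unfolding eqy by (simp only: add_0_right left_diff_distrib[symmetric] norm_mult norm_cis mult_1_right)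
    also have "\<dots> = norm (\<eta> (\<xi>0 + y) * (cis ?\<theta> - 1) + (\<eta> (\<xi>0 + y) - \<eta> \<xi>0))" by (simp add: algebra_simps)
    also have "\<dots> \<le> M * (2 * pi * (norm x * norm y)) + L * norm y"
      using L(2)[of "\<xi>0 + y"] by (intro norm_triangle_le add_mono 1) simp
    finally show ?thesis by (simp add: algebra_simps)
  qed
  then have "norm ((\<integral>y. unit_gauss (pi / b) y * ?\<Phi> y \<partial>lborel) - ?\<Phi> 0) \<le> (L + 2 * pi * M * norm x) * (gauss_moment TYPE('n) / (pi / b))"
    using b by (intro unit_gauss_approx(2)[OF meas]) auto
  from mult_left_mono[OF this, of ?c] packet_mass_pos[where 'n='n] show ?thesis
    unfolding eq right_diff_distrib[symmetric] norm_mult by (simp add: mult.assoc)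
qed

section \<open>Lower bounds for Lebesgue norms\<close>

lemma ennpow_ennreal: "0 \<le> x \<Longrightarrow> ennpow (ennreal x) r = ennreal (x powr r)"
  by (simp add: ennpow_def)

lemma recip_top [simp]: "recip top = 0"
  by (simp add: recip_def)

lemma recip_ennreal: "P > 0 \<Longrightarrow> recip (ennreal P) = inverse P"
  by (simp add: recip_def inverse_ennreal)

lemma recip_1 [simp]: "recip 1 = 1"
  by (simp add: recip_def)

lemma exponent_cases:
  fixes p :: ennreal
  assumes "p > 0"
  obtains "p = \<infinity>" | P where "P > 0" "p = ennreal P" "recip p = inverse P"
  using assms by (cases p) (auto simp: recip_ennreal)

lemma ennpow_mono: "x \<le> y \<Longrightarrow> 0 \<le> r \<Longrightarrow> ennpow x r \<le> ennpow y r"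
  by (cases x; cases y) (auto simp: ennpow_def top_unique powr_mono2)

text \<open>A duality bound: a function with a large pairing against \<open>\<phi>\<close> has a large norm. The bound
  is the one that the Hoelder inequality gives for \<open>|\<phi>| \<le> 1\<close>, up to the factor two.
  For a finite exponent \<open>P\<close> it follows from the elementary inequality \<open>u \<le> \<tau> + \<tau>\<^sup>1\<^sup>-\<^sup>P u\<^sup>P\<close>, integrated against \<open>|\<phi>|\<close> with the threshold
  \<open>\<tau>\<close> chosen so that the first term accounts for half of the pairing.\<close>

lemma Lp_norm_lower:
  fixes g :: "real^'n::finite \<Rightarrow> complex"
  assumes g [measurable]: "g \<in> borel_measurable lebesgue" and \<phi>: "\<phi> \<in> schwartz"
    and int: "integrable lebesgue (\<lambda>x. g x * \<phi> x)"
    and le1: "\<And>x. norm (\<phi> x) \<le> 1" and B: "B = (\<integral>x. norm (\<phi> x) \<partial>lborel)" "B > 0"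
    and \<kappa>: "\<kappa> > 0" "\<kappa> \<le> norm (\<integral>x. g x * \<phi> x \<partial>lebesgue)"
    and p: "p > 0" "recip p \<le> 1"
  shows "ennreal (\<kappa> / 2 * B powr (recip p - 1)) \<le> Lp_norm p g"
proof -
  have \<phi>b: "\<phi> \<in> borel_measurable borel" using schwartz_borel[OF \<phi>] .
  then have [measurable]: "\<phi> \<in> borel_measurable lebesgue"
    by (simp add: measurable_completion)
  have \<phi>int: "(\<integral>\<^sup>+x. ennreal (norm (\<phi> x)) \<partial>lebesgue) = ennreal B"
    unfolding B using schwartz_integrable[OF \<phi>]
    by (simp add: nn_integral_completion nn_integral_eq_integral)
  have "ennreal \<kappa> \<le> ennreal (\<integral>x. norm (g x * \<phi> x) \<partial>lebesgue)"
    using \<kappa> integral_norm_bound[of lebesgue "\<lambda>x. g x * \<phi> x"] by (intro ennreal_leI) linarith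
  also have "\<dots> = (\<integral>\<^sup>+x. ennreal (norm (g x) * norm (\<phi> x)) \<partial>lebesgue)"
    using int by (subst nn_integral_eq_integral) (auto simp: norm_mult[symmetric])
  finally have k: "ennreal \<kappa> \<le> (\<integral>\<^sup>+x. ennreal (norm (g x) * norm (\<phi> x)) \<partial>lebesgue)" .
  from p(1) show ?thesis
  proof (cases rule: exponent_cases)
    case 1
    show ?thesis
    proof (cases "Lp_norm p g")
      case (real e)
      then have es: "esssup lebesgue (\<lambda>x. ennreal (norm (g x))) = ennreal e" using 1 by (simp add: Lp_norm_def)
      have "AE x in lebesgue. ennreal (norm (g x)) \<le> ennreal e"
        using esssup_AE[where M = lebesgue and f = "\<lambda>x. ennreal (norm (g x))"] es by simp
      then have ae: "AE x in lebesgue. norm (g x) \<le> e" using real by simp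
      have "(\<integral>\<^sup>+x. ennreal (norm (g x) * norm (\<phi> x)) \<partial>lebesgue) \<le> (\<integral>\<^sup>+x. ennreal e * ennreal (norm (\<phi> x)) \<partial>lebesgue)"
        using ae real by (intro nn_integral_mono_AE) (auto simp: ennreal_mult[symmetric] mult_right_mono)
      also have "\<dots> = ennreal (e * B)"
        using real B(2) by (subst nn_integral_cmult) (auto simp: \<phi>int ennreal_mult)
      finally have "\<kappa> \<le> e * B" using k real B(2) order_trans by (fastforce simp: ennreal_le_iff)
      then have "\<kappa> / 2 * B powr (- 1) \<le> e"
        using B \<kappa> by (simp add: powr_minus field_simps)
      then show ?thesis using 1 real by (simp add: ennreal_leI)
    qed auto
  next
    case (2 P)
    have "inverse P \<le> 1" using 2 p(2) by simp
    then have P: "P \<ge> 1" using 2 by (simp add: field_simps)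
    let ?I = "\<integral>\<^sup>+x. ennpow (ennreal (norm (g x))) P \<partial>lebesgue"
    have L: "Lp_norm p g = ennpow ?I (inverse P)"
      using 2 by (simp add: Lp_norm_def)
    show ?thesis
    proof (cases ?I)
      case (real J)
      \<comment> \<open>with this threshold the term \<open>\<tau> * B\<close> below is exactly half of \<open>\<kappa>\<close>\<close>
      define \<tau> where "\<tau> = \<kappa> / (2 * B)"
      have \<tau>: "\<tau> > 0" using \<kappa> B by (simp add: \<tau>_def)
      have pt: "t * a \<le> \<tau> * a + \<tau> powr (1 - P) * t powr P" if "0 \<le> t" "0 \<le> a" "a \<le> 1" for t a :: real
      proof (cases "t \<le> \<tau>")
        case True
        then have "t * a \<le> \<tau> * a" using that by (intro mult_right_mono) auto
        moreover have "0 \<le> \<tau> powr (1 - P) * t powr P" by simp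
        ultimately show ?thesis by linarith
      next
        case False
        then have "\<tau> powr (P - 1) \<le> t powr (P - 1)" using \<tau> P by (intro powr_mono2) auto
        then have "\<tau> powr (1 - P) * \<tau> powr (P - 1) * t \<le> \<tau> powr (1 - P) * t powr (P - 1) * t"
          using that by (intro mult_right_mono mult_left_mono) auto
        moreover have "\<tau> powr (1 - P) * \<tau> powr (P - 1) = 1" using \<tau> by (simp add: powr_add[symmetric])
        moreover have "t powr (P - 1) * t = t powr P" using False \<tau> by (simp add: powr_diff)
        ultimately have "t \<le> \<tau> powr (1 - P) * t powr P" by (simp add: mult.assoc)
        moreover have "t * a \<le> t" using that mult_left_mono[of a 1 t] by simp
        moreover have "0 \<le> \<tau> * a" using \<tau> that by simp
        ultimately show ?thesis by linarith
      qed
      have "(\<integral>\<^sup>+x. ennreal (norm (g x) * norm (\<phi> x)) \<partial>lebesgue) \<le>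
          (\<integral>\<^sup>+x. ennreal \<tau> * ennreal (norm (\<phi> x)) + ennreal (\<tau> powr (1 - P)) * ennpow (ennreal (norm (g x))) P \<partial>lebesgue)"
        using \<tau> pt le1 by (intro nn_integral_mono)
          (auto simp: ennpow_ennreal ennreal_mult[symmetric] ennreal_plus[symmetric] simp del: ennreal_plus intro!: ennreal_leI)
      also have "\<dots> = ennreal (\<tau> * B) + ennreal (\<tau> powr (1 - P)) * ?I"
        using \<tau> B by (subst nn_integral_add) (auto simp: nn_integral_cmult \<phi>int ennreal_mult ennpow_ennreal)
      also have "\<dots> = ennreal (\<tau> * B + \<tau> powr (1 - P) * J)"
        using real \<tau> B by (simp add: ennreal_mult[symmetric] ennreal_plus[symmetric] del: ennreal_plus)
      finally have "ennreal \<kappa> \<le> ennreal (\<tau> * B + \<tau> powr (1 - P) * J)" using k order_trans by blast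
      then have "\<kappa> \<le> \<tau> * B + \<tau> powr (1 - P) * J"
        using \<tau> B real by (subst (asm) ennreal_le_iff) auto
      moreover have \<tau>B: "\<tau> * B = \<kappa> / 2" using B by (simp add: \<tau>_def)
      ultimately have "\<tau> * B * \<tau> powr (P - 1) \<le> \<tau> powr (1 - P) * J * \<tau> powr (P - 1)"
        by (intro mult_right_mono) auto
      moreover have "\<tau> powr (1 - P) * \<tau> powr (P - 1) = 1" using \<tau> by (simp add: powr_add[symmetric])
      ultimately have "\<tau> powr P * B \<le> J" using \<tau> by (simp add: powr_diff mult_ac)
      then have "(\<tau> powr P * B) powr inverse P \<le> J powr inverse P"
        using P B by (intro powr_mono2) auto
      moreover have "(\<tau> powr P * B) powr inverse P = \<kappa> / 2 * B powr (inverse P - 1)"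
        using \<tau> P B \<tau>B[symmetric] by (simp add: powr_mult powr_powr powr_diff)
      ultimately show ?thesis
        using real 2 L by (simp add: ennpow_ennreal ennreal_leI)
    qed (simp add: L ennpow_def)
  qed
qed

lemma Lp_norm_distr_lower:
  fixes T :: "('n::finite) functional"
  assumes "\<phi> \<in> schwartz" "\<And>x. norm (\<phi> x) \<le> 1" "B = (\<integral>x. norm (\<phi> x) \<partial>lborel)" "B > 0"
    and "\<kappa> > 0" "\<kappa> \<le> norm (T \<phi>)" "p > 0" "recip p \<le> 1"
  shows "ennreal (\<kappa> / 2 * B powr (recip p - 1)) \<le> Lp_norm_distr p T"
  unfolding Lp_norm_distr_def
proof (rule Inf_greatest, safe)
  fix g :: "real^'n \<Rightarrow> complex"
  assume g: "g \<in> borel_measurable lebesgue" "\<forall>\<phi>\<in>schwartz. integrable lebesgue (\<lambda>x. g x * \<phi> x)"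
    and T: "T = regular_distr g"
  show "ennreal (\<kappa> / 2 * B powr (recip p - 1)) \<le> Lp_norm p g"
    by (rule Lp_norm_lower[of _ \<phi>]) (use assms g T in \<open>auto simp: regular_distr_def\<close>)
qed

section \<open>Testing with approximate point masses\<close>

abbreviation L1_norm :: "(real^'n::finite \<Rightarrow> complex) \<Rightarrow> real" where
  "L1_norm f \<equiv> (\<integral>x. norm (f x) \<partial>lborel)"

abbreviation box_norm :: "ennreal \<Rightarrow> (real^'n::finite \<Rightarrow> complex) \<Rightarrow> (real^'n \<Rightarrow> complex) \<Rightarrow> ennreal" where
  "box_norm p \<eta> f \<equiv> Lp_norm_distr p (box_op \<eta> (regular_distr f))"

lemma wave_packet_mass:
  assumes "b > 0"
  shows "L1_norm (wave_packet b \<xi>0 :: real^'n::finite \<Rightarrow> complex) = gauss_mass TYPE('n) 1 / b ^ CARD('n)"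
proof -
  have "L1_norm (wave_packet b \<xi>0 :: real^'n \<Rightarrow> complex) = gauss_mass TYPE('n) b"
    by (simp add: norm_wave_packet gauss_mass_def)
  then show ?thesis
    using gauss_mass_scale[OF assms, where 'n='n] assms by (simp add: field_simps)
qed

text \<open>Applied to approximate point masses, the \<open>k\<close>-th box operator approaches its own convolution kernel, whose
  \<open>L\<^sup>p\<close> norm is at least of the order \<open>R\<^sub>k powr (n (1 - 1/p))\<close>. To see this, test against a wave packet whose frequency
  width is a small multiple \<open>\<delta>\<close> of the size \<open>R\<^sub>k\<close> of the frequency box: there \<open>\<eta>\<^sub>k\<close> stays close to its value at the
  centre, which has modulus at least one. Only finitely many \<open>k\<close> are treated at once, so a single
  sufficiently concentrated mass serves all of them.\<close>

lemma box_norm_lower: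
  fixes \<eta> :: "'k \<Rightarrow> real^'n::finite \<Rightarrow> complex" and \<xi>0 :: "'k \<Rightarrow> real^'n" and R :: "'k \<Rightarrow> real"
  assumes \<eta>: "\<And>k. \<eta> k \<in> schwartz" and R: "\<And>k. R k > 0"
    and one: "\<And>k. 1 \<le> norm (\<eta> k (\<xi>0 k))"
    and L: "L \<ge> 0" "\<And>k \<xi>. norm (\<eta> k \<xi> - \<eta> k (\<xi>0 k)) \<le> L / R k * norm (\<xi> - \<xi>0 k)"
    and p: "p > 0" "recip p \<le> 1"
  obtains c where "c > 0"
    "\<And>K. finite K \<Longrightarrow> \<exists>a>0. \<forall>k\<in>K. ennreal (c * R k powr (CARD('n) * (1 - recip p))) \<le> box_norm p (\<eta> k) (unit_gauss a)"
proof -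
  let ?n = "CARD('n)" and ?C = "gauss_mass TYPE('n) 1" and ?J = "gauss_moment TYPE('n)"
  have C: "?C > 0" by (rule gauss_mass_pos) simp
  define c where "c = packet_mass TYPE('n)"
  have c: "c > 0" unfolding c_def by (rule packet_mass_pos)
  \<comment> \<open>small enough for the variation of the multiplier over the packet to cost at most half of the main term\<close>
  define \<delta> where "\<delta> = pi / (2 * (L * ?J + 1))"
  have LJ: "L * ?J \<ge> 0" using L(1) gauss_moment_nonneg[where 'n='n] by simp
  then have \<delta>: "\<delta> > 0" "L * ?J * \<delta> / pi = L * ?J / (L * ?J + 1) / 2" by (auto simp: \<delta>_def)
  define b where "b k = \<delta> * R k" for k
  have b: "b k > 0" for k using \<delta> R by (simp add: b_def)
  define \<phi> where "\<phi> k = wave_packet (b k) (\<xi>0 k)" for k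
  define \<Phi> where "\<Phi> k = adj_multiplier (\<eta> k) (\<phi> k)" for k
  have \<phi>s: "\<phi> k \<in> schwartz" for k unfolding \<phi>_def by (rule schwartz_wave_packet[OF b])
  have \<Phi>s: "\<Phi> k \<in> schwartz" for k unfolding \<Phi>_def by (rule schwartz_adj_multiplier[OF \<eta> \<phi>s])
  have \<Phi>0: "c / 2 \<le> norm (\<Phi> k 0)" for k
  proof -
    obtain M where M: "\<And>x. norm (\<eta> k x) \<le> M" using schwartz_bounded[OF \<eta>] by blast
    have "norm (\<Phi> k 0 - of_real c * \<eta> k (\<xi>0 k)) \<le> c * (L / R k * (?J * b k / pi))"
      using adj_multiplier_wave_packet[OF \<eta> b _ L(2) M, of k 0] L(1) R[of k] by (simp add: \<Phi>_def \<phi>_def c_def)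
    also have "L / R k * (?J * b k / pi) = L * ?J * \<delta> / pi" using R[of k] by (simp add: b_def)
    also have "c * \<dots> \<le> c * (1 / 2)" unfolding \<delta>(2) using c LJ by (intro mult_left_mono) auto
    finally have "norm (\<Phi> k 0 - of_real c * \<eta> k (\<xi>0 k)) \<le> c / 2" by simp
    moreover have "c \<le> norm (of_real c * \<eta> k (\<xi>0 k))" using one[of k] c by (simp add: norm_mult)
    ultimately show ?thesis
      using norm_triangle_ineq3[of "\<Phi> k 0" "of_real c * \<eta> k (\<xi>0 k)"] by linarith
  qed
  define d where "d = c / 8 * ?C powr (recip p - 1) * \<delta> powr (?n * (1 - recip p))"
  show thesis
  proof
    show "d > 0" using c C \<delta> by (simp add: d_def)
    fix K :: "'k set" assume K: "finite K"
    have "\<forall>k\<in>K. \<forall>\<^sub>F a in at_top. c / 4 < norm (\<integral>x. unit_gauss a x * \<Phi> k x \<partial>lborel)"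
    proof
      fix k
      have "c / 4 < norm (\<Phi> k 0)" using \<Phi>0[of k] c by simp
      then show "\<forall>\<^sub>F a in at_top. c / 4 < norm (\<integral>x. unit_gauss a x * \<Phi> k x \<partial>lborel)"
        using order_tendstoD(1)[OF tendsto_norm[OF unit_gauss_tendsto[OF \<Phi>s[of k]]]] by blast
    qed
    then have "\<forall>\<^sub>F a in at_top. 0 < a \<and> (\<forall>k\<in>K. c / 4 < norm (\<integral>x. unit_gauss a x * \<Phi> k x \<partial>lborel))"
      using K by (intro eventually_conj eventually_gt_at_top) (simp add: eventually_ball_finite)
    then obtain a where a: "0 < a" "\<And>k. k \<in> K \<Longrightarrow> c / 4 < norm (\<integral>x. unit_gauss a x * \<Phi> k x \<partial>lborel)"
      using eventually_happens'[OF trivial_limit_at_top_linorder] by blast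
    have "ennreal (d * R k powr (?n * (1 - recip p))) \<le> box_norm p (\<eta> k) (unit_gauss a)" if k: "k \<in> K" for k
    proof -
      have "box_op (\<eta> k) (regular_distr (unit_gauss a)) (\<phi> k) = (\<integral>x. unit_gauss a x * \<Phi> k x \<partial>lborel)"
        unfolding box_op_regular[OF \<eta> \<phi>s] \<Phi>_def[symmetric]
        using schwartz_borel[OF schwartz_mult[OF schwartz_unit_gauss[OF a(1)] \<Phi>s]] by (intro integral_completion) simp
      then have "ennreal (c / 4 / 2 * (?C / b k ^ ?n) powr (recip p - 1)) \<le> box_norm p (\<eta> k) (unit_gauss a)"
        using a(2)[OF k] b[of k] C c \<phi>s p wave_packet_mass[OF b, of k "\<xi>0 k"]
        by (intro Lp_norm_distr_lower[where \<phi> = "\<phi> k"]) (auto simp: \<phi>_def norm_wave_packet less_imp_le)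
      moreover have "c / 4 / 2 * (?C / b k ^ ?n) powr (recip p - 1) = d * R k powr (?n * (1 - recip p))"
      proof -
        have "(b k ^ ?n) powr (recip p - 1) = b k powr (- (?n * (1 - recip p)))"
          using b[of k] by (simp add: powr_realpow[symmetric] powr_powr algebra_simps)
        then have "(?C / b k ^ ?n) powr (recip p - 1) = ?C powr (recip p - 1) * b k powr (?n * (1 - recip p))"
          by (simp only: powr_divide) (simp only: powr_minus divide_inverse inverse_inverse_eq)
        then show ?thesis by (simp add: d_def b_def powr_mult)
      qed
      ultimately show ?thesis by simp
    qed
    then show "\<exists>a>0. \<forall>k\<in>K. ennreal (d * R k powr (?n * (1 - recip p))) \<le> box_norm p (\<eta> k) (unit_gauss a)"
      using a(1) by blast
  qed
qed

section \<open>The box operators as convolutions\<close>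

lemma nn_integral_translate:
  fixes f :: "'a::euclidean_space \<Rightarrow> ennreal"
  assumes [measurable]: "f \<in> borel_measurable borel"
  shows "(\<integral>\<^sup>+x. f (x - t) \<partial>lborel) = (\<integral>\<^sup>+x. f x \<partial>lborel)"
proof -
  have "(\<integral>\<^sup>+x. f x \<partial>lborel) = (\<integral>\<^sup>+x. f x \<partial>distr lborel borel ((+) (- t)))"
    by (simp only: lborel_distr_plus)
  also have "\<dots> = (\<integral>\<^sup>+x. f (- t + x) \<partial>lborel)"
    by (rule nn_integral_distr) auto
  finally show ?thesis by simp
qed

lemma integrable_pair_majorised:
  fixes f :: "'a::euclidean_space \<Rightarrow> complex" and g :: "'b::euclidean_space \<Rightarrow> complex" and F :: "'a \<Rightarrow> 'b \<Rightarrow> complex"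
  assumes f: "integrable lborel f" and g: "integrable lborel g"
    and F: "(\<lambda>(x, y). F x y) \<in> borel_measurable (lborel \<Otimes>\<^sub>M lborel)"
    and le: "\<And>x y. norm (F x y) \<le> norm (f x) * norm (g y)"
  shows "integrable (lborel \<Otimes>\<^sub>M lborel) (\<lambda>(x, y). F x y)"
proof (rule Bochner_Integration.integrable_bound[OF _ F])
  have [measurable]: "f \<in> borel_measurable borel" "g \<in> borel_measurable borel" using f g by auto
  show "integrable (lborel \<Otimes>\<^sub>M lborel) (\<lambda>(x, y). f x * g y)"
  proof (rule lborel_pair.Fubini_integrable)
    show "(\<lambda>(x, y). f x * g y) \<in> borel_measurable (lborel \<Otimes>\<^sub>M lborel)" by measurable
    show "integrable lborel (\<lambda>x. LINT y|lborel. norm (case (x, y) of (x, y) \<Rightarrow> f x * g y))"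
      using f by (simp add: norm_mult)
    show "AE x in lborel. integrable lborel (\<lambda>y. case (x, y) of (x, y) \<Rightarrow> f x * g y)"
      using g by simp
  qed
qed (use le in \<open>auto simp: norm_mult\<close>)

text \<open>Fubini, with the inner frequency integral recognised as the kernel of the convolution.\<close>

lemma adj_multiplier_convolution:
  fixes \<eta> \<phi> :: "real^'n::finite \<Rightarrow> complex"
  assumes \<eta>: "\<eta> \<in> schwartz" and \<phi>: "\<phi> \<in> schwartz"
  shows "adj_multiplier \<eta> \<phi> x = (\<integral>y. \<phi> y * osc (2 * pi) \<eta> (y - x) \<partial>lborel)"
proof -
  have [measurable]: "\<eta> \<in> borel_measurable borel" "\<phi> \<in> borel_measurable borel"
    using schwartz_borel \<eta> \<phi> by auto
  let ?F = "\<lambda>\<xi> y. \<eta> \<xi> * (\<phi> y * cis (2 * pi * (y \<bullet> \<xi>))) * cis (- 2 * pi * (\<xi> \<bullet> x))"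
  have int: "integrable (lborel \<Otimes>\<^sub>M lborel) (\<lambda>(\<xi>, y). ?F \<xi> y)"
    by (rule integrable_pair_majorised[OF schwartz_integrable[OF \<eta>] schwartz_integrable[OF \<phi>]])
      (measurable, simp add: norm_mult)
  have "adj_multiplier \<eta> \<phi> x = (\<integral>\<xi>. (\<integral>y. ?F \<xi> y \<partial>lborel) \<partial>lborel)"
    by (simp only: adj_multiplier_def osc_def integral_mult_left_zero integral_mult_right_zero)
  also have "\<dots> = (\<integral>y. (\<integral>\<xi>. ?F \<xi> y \<partial>lborel) \<partial>lborel)"
    using lborel_pair.Fubini_integral[OF int] by simp
  also have "\<dots> = (\<integral>y. \<phi> y * osc (2 * pi) \<eta> (y - x) \<partial>lborel)"
  proof (rule Bochner_Integration.integral_cong[OF refl])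
    fix y
    have "?F \<xi> y = \<phi> y * (\<eta> \<xi> * cis (2 * pi * (\<xi> \<bullet> (y - x))))" for \<xi>
    proof -
      have "cis (2 * pi * (y \<bullet> \<xi>)) * cis (- 2 * pi * (\<xi> \<bullet> x)) = cis (2 * pi * (\<xi> \<bullet> (y - x)))"
        unfolding cis_mult by (simp add: inner_diff_right inner_commute algebra_simps)
      then show ?thesis by (simp only: mult_ac)
    qed
    then show "(\<integral>\<xi>. ?F \<xi> y \<partial>lborel) = \<phi> y * osc (2 * pi) \<eta> (y - x)"
      by (simp only: osc_def integral_mult_right_zero)
  qed
  finally show ?thesis .
qed

text \<open>The convolution of \<open>f\<close> with the inverse Fourier transform of \<open>\<eta>\<close>, which represents the distribution
  \<open>box_op \<eta> f\<close>.\<close>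

definition box_fun :: "(real^'n::finite \<Rightarrow> complex) \<Rightarrow> (real^'n \<Rightarrow> complex) \<Rightarrow> real^'n \<Rightarrow> complex" where
  "box_fun \<eta> f y = (\<integral>x. f x * osc (2 * pi) \<eta> (y - x) \<partial>lborel)"

lemma box_fun_borel [measurable]:
  assumes "\<eta> \<in> schwartz" and [measurable]: "f \<in> borel_measurable borel"
  shows "box_fun \<eta> f \<in> borel_measurable borel"
proof -
  have [measurable]: "osc (2 * pi) \<eta> \<in> borel_measurable borel"
    using schwartz_borel[OF schwartz_osc[OF assms(1)]] by simp
  have "(\<lambda>y. \<integral>x. f x * osc (2 * pi) \<eta> (y - x) \<partial>lborel) \<in> borel_measurable lborel"
    by measurable
  then show ?thesis by (simp add: box_fun_def[abs_def])
qed

lemma box_fun_norm_le: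
  "ennreal (norm (box_fun \<eta> f y)) \<le> (\<integral>\<^sup>+x. ennreal (norm (f x)) * ennreal (norm (osc (2 * pi) \<eta> (y - x))) \<partial>lborel)"
  unfolding box_fun_def
  using integral_norm_bound_ennreal[of lborel "\<lambda>x. f x * osc (2 * pi) \<eta> (y - x)"]
  by (cases "integrable lborel (\<lambda>x. f x * osc (2 * pi) \<eta> (y - x))")
    (auto simp: norm_mult ennreal_mult not_integrable_integral_eq)

lemma box_fun_L1:
  fixes \<eta> f :: "real^'n::finite \<Rightarrow> complex"
  assumes \<eta>: "\<eta> \<in> schwartz" and [measurable]: "f \<in> borel_measurable borel"
  shows "(\<integral>\<^sup>+y. ennreal (norm (box_fun \<eta> f y)) \<partial>lborel) \<le>
    (\<integral>\<^sup>+x. ennreal (norm (f x)) \<partial>lborel) * (\<integral>\<^sup>+x. ennreal (norm (osc (2 * pi) \<eta> x)) \<partial>lborel)"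
proof -
  have [measurable]: "osc (2 * pi) \<eta> \<in> borel_measurable borel"
    using schwartz_borel[OF schwartz_osc[OF assms(1)]] by simp
  have "(\<integral>\<^sup>+y. ennreal (norm (box_fun \<eta> f y)) \<partial>lborel) \<le>
      (\<integral>\<^sup>+y. (\<integral>\<^sup>+x. ennreal (norm (f x)) * ennreal (norm (osc (2 * pi) \<eta> (y - x))) \<partial>lborel) \<partial>lborel)"
    by (intro nn_integral_mono box_fun_norm_le)
  also have "\<dots> = (\<integral>\<^sup>+x. (\<integral>\<^sup>+y. ennreal (norm (f x)) * ennreal (norm (osc (2 * pi) \<eta> (y - x))) \<partial>lborel) \<partial>lborel)"
    by (rule lborel_pair.Fubini') measurable
  also have "\<dots> = (\<integral>\<^sup>+x. ennreal (norm (f x)) * (\<integral>\<^sup>+y. ennreal (norm (osc (2 * pi) \<eta> y)) \<partial>lborel) \<partial>lborel)"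
    using nn_integral_translate[of "\<lambda>y. ennreal (norm (osc (2 * pi) \<eta> y))"]
    by (simp add: nn_integral_cmult)
  also have "\<dots> = (\<integral>\<^sup>+x. ennreal (norm (f x)) \<partial>lborel) * (\<integral>\<^sup>+x. ennreal (norm (osc (2 * pi) \<eta> x)) \<partial>lborel)"
    by (rule nn_integral_multc) measurable
  finally show ?thesis .
qed

lemma box_fun_schwartz_integrable:
  fixes \<eta> f \<phi> :: "real^'n::finite \<Rightarrow> complex"
  assumes \<eta>: "\<eta> \<in> schwartz" and f: "integrable lborel f" and \<phi>: "\<phi> \<in> schwartz"
  shows "integrable lborel (\<lambda>y. box_fun \<eta> f y * \<phi> y)"
    and "(\<integral>y. box_fun \<eta> f y * \<phi> y \<partial>lborel) = (\<integral>x. f x * adj_multiplier \<eta> \<phi> x \<partial>lborel)"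
proof -
  have K: "osc (2 * pi) \<eta> \<in> schwartz" using \<eta> by (intro schwartz_osc) auto
  have [measurable]: "osc (2 * pi) \<eta> \<in> borel_measurable borel" "\<phi> \<in> borel_measurable borel" "f \<in> borel_measurable borel"
    using schwartz_borel K \<phi> f by auto
  obtain M where M: "M > 0" "\<And>x. norm (osc (2 * pi) \<eta> x) \<le> M" using schwartz_bounded[OF K] by blast
  let ?F = "\<lambda>x y. f x * osc (2 * pi) \<eta> (y - x) * \<phi> y"
  have int: "integrable (lborel \<Otimes>\<^sub>M lborel) (\<lambda>(x, y). ?F x y)"
  proof (rule integrable_pair_majorised)
    show "integrable lborel (\<lambda>x. of_real M * f x)" using f by simp
    show "(\<lambda>(x, y). ?F x y) \<in> borel_measurable (lborel \<Otimes>\<^sub>M lborel)" by measurable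
    fix x y
    have "norm (osc (2 * pi) \<eta> (y - x)) * (norm (f x) * norm (\<phi> y)) \<le> M * (norm (f x) * norm (\<phi> y))"
      by (intro mult_right_mono M) auto
    then show "norm (?F x y) \<le> norm (of_real M * f x) * norm (\<phi> y)"
      using M(1) by (simp add: norm_mult mult_ac)
  qed (rule schwartz_integrable[OF \<phi>])
  have bf: "(\<integral>x. ?F x y \<partial>lborel) = box_fun \<eta> f y * \<phi> y" for y
    by (simp only: box_fun_def integral_mult_left_zero)
  show "integrable lborel (\<lambda>y. box_fun \<eta> f y * \<phi> y)"
    using lborel_pair.integrable_snd[OF int] by (simp only: bf)
  have "(\<integral>y. box_fun \<eta> f y * \<phi> y \<partial>lborel) = (\<integral>y. (\<integral>x. ?F x y \<partial>lborel) \<partial>lborel)" by (simp only: bf)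
  also have "\<dots> = (\<integral>x. (\<integral>y. ?F x y \<partial>lborel) \<partial>lborel)"
    by (rule lborel_pair.Fubini_integral[OF int])
  also have "\<dots> = (\<integral>x. f x * adj_multiplier \<eta> \<phi> x \<partial>lborel)"
  proof (rule Bochner_Integration.integral_cong[OF refl])
    fix x
    have "?F x y = f x * (\<phi> y * osc (2 * pi) \<eta> (y - x))" for y by (simp only: mult_ac)
    then show "(\<integral>y. ?F x y \<partial>lborel) = f x * adj_multiplier \<eta> \<phi> x"
      by (simp only: adj_multiplier_convolution[OF \<eta> \<phi>] integral_mult_right_zero)
  qed
  finally show "(\<integral>y. box_fun \<eta> f y * \<phi> y \<partial>lborel) = (\<integral>x. f x * adj_multiplier \<eta> \<phi> x \<partial>lborel)" .
qed

lemma box_op_eq_regular: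
  assumes \<eta>: "\<eta> \<in> schwartz" and f: "integrable lborel f"
  shows "box_op \<eta> (regular_distr f) = regular_distr (box_fun \<eta> f)"
proof
  fix \<phi> show "box_op \<eta> (regular_distr f) \<phi> = regular_distr (box_fun \<eta> f) \<phi>"
  proof (cases "\<phi> \<in> schwartz")
    case True
    have [measurable]: "f \<in> borel_measurable borel" "\<phi> \<in> borel_measurable borel" "adj_multiplier \<eta> \<phi> \<in> borel_measurable borel"
      "box_fun \<eta> f \<in> borel_measurable borel"
      using f True \<eta> by (auto intro!: schwartz_borel schwartz_adj_multiplier box_fun_borel)
    have "box_op \<eta> (regular_distr f) \<phi> = (\<integral>x. f x * adj_multiplier \<eta> \<phi> x \<partial>lborel)"
      unfolding box_op_regular[OF \<eta> True] by (rule integral_completion) measurable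
    also have "\<dots> = (\<integral>y. box_fun \<eta> f y * \<phi> y \<partial>lborel)"
      by (rule box_fun_schwartz_integrable(2)[OF \<eta> f True, symmetric])
    also have "\<dots> = regular_distr (box_fun \<eta> f) \<phi>"
      unfolding regular_distr_def using True by (simp add: integral_completion)
    finally show ?thesis .
  next
    case False
    then show ?thesis by (simp add: box_op_def inv_fourier_distr_def regular_distr_def)
  qed
qed

lemma box_fun_representation:
  assumes \<eta>: "\<eta> \<in> schwartz" and f: "integrable lborel f"
  shows "box_fun \<eta> f \<in> borel_measurable lebesgue"
    and "\<forall>\<phi>\<in>schwartz. integrable lebesgue (\<lambda>x. box_fun \<eta> f x * \<phi> x)"
proof -
  have b[measurable]: "box_fun \<eta> f \<in> borel_measurable borel" using f \<eta> by (intro box_fun_borel) auto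
  then show "box_fun \<eta> f \<in> borel_measurable lebesgue" by (simp add: measurable_completion)
  show "\<forall>\<phi>\<in>schwartz. integrable lebesgue (\<lambda>x. box_fun \<eta> f x * \<phi> x)"
  proof
    fix \<phi> :: "real^'a \<Rightarrow> complex" assume \<phi>: "\<phi> \<in> schwartz"
    then have [measurable]: "\<phi> \<in> borel_measurable borel" by (rule schwartz_borel)
    show "integrable lebesgue (\<lambda>x. box_fun \<eta> f x * \<phi> x)"
      by (subst integrable_completion) (auto intro: box_fun_schwartz_integrable[OF \<eta> f \<phi>])
  qed
qed

text \<open>Interpolation between \<open>L\<^sup>1\<close> and \<open>L\<^sup>\<infinity>\<close>: integrate \<open>|h|\<^sup>P \<le> (A F)\<^sup>P\<^sup>-\<^sup>1 |h|\<close>. The common factor \<open>F\<close>, later the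
  \<open>L\<^sup>1\<close> norm of the convolved function, may vanish and is therefore kept apart from the positive
  constants \<open>A\<close> and \<open>D\<close>.\<close>

lemma Lp_norm_upper:
  fixes h :: "real^'n::finite \<Rightarrow> complex"
  assumes h[measurable]: "h \<in> borel_measurable lebesgue"
    and sup: "\<And>x. norm (h x) \<le> A * F" and L1: "(\<integral>\<^sup>+x. ennreal (norm (h x)) \<partial>lebesgue) \<le> ennreal (D * F)"
    and AD: "A > 0" "D > 0" "F \<ge> 0" and p: "p > 0" "recip p \<le> 1"
  shows "Lp_norm p h \<le> ennreal (A powr (1 - recip p) * D powr recip p * F)"
  using p(1)
proof (cases rule: exponent_cases)
  case 1
  have "esssup lebesgue (\<lambda>x. ennreal (norm (h x))) \<le> ennreal (A * F)"
    by (intro esssup_I) (auto intro!: AE_I2 ennreal_leI sup)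
  then show ?thesis using 1 AD by (simp add: Lp_norm_def)
next
  case (2 P)
  have "inverse P \<le> 1" using 2 p(2) by simp
  then have P: "P \<ge> 1" using 2 by (simp add: field_simps)
  have pt: "norm (h x) powr P \<le> (A * F) powr (P - 1) * norm (h x)" for x
  proof (cases "norm (h x) = 0")
    case False
    then have "norm (h x) powr P = norm (h x) powr (P - 1) * norm (h x)" by (simp add: powr_diff)
    also have "\<dots> \<le> (A * F) powr (P - 1) * norm (h x)"
      using P sup by (intro mult_right_mono powr_mono2) auto
    finally show ?thesis .
  qed simp
  let ?I = "\<integral>\<^sup>+x. ennpow (ennreal (norm (h x))) P \<partial>lebesgue"
  have "?I \<le> (\<integral>\<^sup>+x. ennreal ((A * F) powr (P - 1)) * ennreal (norm (h x)) \<partial>lebesgue)"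
    by (intro nn_integral_mono) (auto simp: ennpow_ennreal ennreal_mult[symmetric] intro!: ennreal_leI pt)
  also have "\<dots> = ennreal ((A * F) powr (P - 1)) * (\<integral>\<^sup>+x. ennreal (norm (h x)) \<partial>lebesgue)"
    by (rule nn_integral_cmult) measurable
  also have "\<dots> \<le> ennreal ((A * F) powr (P - 1)) * ennreal (D * F)"
    by (intro mult_left_mono L1) auto
  also have "\<dots> = ennreal ((A * F) powr (P - 1) * (D * F))" by (simp add: ennreal_mult')
  finally have "?I \<le> ennreal ((A * F) powr (P - 1) * (D * F))" .
  then have "ennpow ?I (inverse P) \<le> ennpow (ennreal ((A * F) powr (P - 1) * (D * F))) (inverse P)"
    using P by (intro ennpow_mono) auto
  also have "\<dots> = ennreal (((A * F) powr (P - 1) * (D * F)) powr inverse P)"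
    using AD by (intro ennpow_ennreal) auto
  also have "((A * F) powr (P - 1) * (D * F)) powr inverse P = A powr (1 - inverse P) * D powr inverse P * F"
  proof (cases "F = 0")
    case False
    have e: "(P - 1) * inverse P = 1 - inverse P" using P by (simp add: field_simps)
    have "((A * F) powr (P - 1) * (D * F)) powr inverse P = (A * F) powr (1 - inverse P) * (D * F) powr inverse P"
      by (simp only: powr_mult powr_powr e)
    also have "\<dots> = A powr (1 - inverse P) * D powr inverse P * (F powr (1 - inverse P) * F powr inverse P)"
      by (simp add: powr_mult)
    also have "F powr (1 - inverse P) * F powr inverse P = F"
      using False AD by (simp add: powr_add[symmetric])
    finally show ?thesis .
  qed simp
  finally show ?thesis using 2 by (simp add: Lp_norm_def)
qed

section \<open>Uniform estimates for the convolution kernels\<close>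

lemma partial_deriv_outside_support:
  assumes "x \<notin> closure {\<xi>. f \<xi> \<noteq> 0}" shows "partial_deriv j f x = 0"
proof -
  have "(f has_derivative (\<lambda>h. 0)) (at x)"
    by (rule has_derivative_transform_within_open[where f = "\<lambda>_. 0" and s = "- closure {\<xi>. f \<xi> \<noteq> 0}"])
      (use assms closure_subset[of "{\<xi>. f \<xi> \<noteq> 0}"] in auto)
  then show ?thesis by (rule partial_derivI)
qed

lemma partial_derivs_outside_support:
  assumes "x \<notin> closure {\<xi>. f \<xi> \<noteq> 0}" shows "partial_derivs \<gamma> f x = 0"
proof -
  have "closure {\<xi>. partial_derivs \<gamma> f \<xi> \<noteq> 0} \<subseteq> closure {\<xi>. f \<xi> \<noteq> 0}"
  proof (induction \<gamma>)
    case (Cons j \<gamma>)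
    have "{\<xi>. partial_derivs (j # \<gamma>) f \<xi> \<noteq> 0} \<subseteq> closure {\<xi>. partial_derivs \<gamma> f \<xi> \<noteq> 0}"
      using partial_deriv_outside_support[of _ "partial_derivs \<gamma> f"] by (auto simp: partial_derivs_def)
    then show ?case using Cons closure_minimal[of _ "closure {\<xi>. partial_derivs \<gamma> f \<xi> \<noteq> 0}"] by auto
  qed (simp add: partial_derivs_def)
  then show ?thesis using assms closure_subset[of "{\<xi>. partial_derivs \<gamma> f \<xi> \<noteq> 0}"] by auto
qed

lemma schwartz_partial_derivs: "f \<in> schwartz \<Longrightarrow> partial_derivs \<gamma> f \<in> schwartz"
  by (induction \<gamma>) (auto simp: partial_derivs_def schwartz_partial_deriv)

lemma osc_partial_derivs_replicate:
  assumes "f \<in> schwartz"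
  shows "osc \<sigma> (partial_derivs (replicate m j) f) \<xi> = (- \<i> * of_real (\<sigma> * \<xi> $ j)) ^ m * osc \<sigma> f \<xi>"
proof (induction m)
  case (Suc m)
  have "partial_derivs (replicate (Suc m) j) f = partial_deriv j (partial_derivs (replicate m j) f)"
    by (simp add: partial_derivs_def)
  then have "osc \<sigma> (partial_derivs (replicate (Suc m) j) f) \<xi> =
      - \<i> * of_real (\<sigma> * \<xi> $ j) * osc \<sigma> (partial_derivs (replicate m j) f) \<xi>"
    using osc_partial_deriv[OF schwartz_partial_derivs[OF assms]] by simp
  then show ?case using Suc by (simp only: power_Suc mult.assoc)
qed (simp add: partial_derivs_def)

lemma weight_le_1: "weight x \<le> 1"
  unfolding weight_def by (intro prod_le_1) (auto simp: inverse_le_1_iff)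

lemma inverse_weight_le:
  fixes y :: "real^'n::finite"
  shows "inverse (weight y) \<le> 2 ^ CARD('n) * (1 + (\<Sum>j\<in>UNIV. \<bar>y $ j\<bar> ^ (2 * CARD('n))))"
proof -
  let ?n = "CARD('n)"
  define m where "m = Max (range (\<lambda>j. \<bar>y $ j\<bar>))"
  have m: "\<bar>y $ j\<bar> \<le> m" for j unfolding m_def by (intro Max_ge) auto
  have "m \<in> range (\<lambda>j. \<bar>y $ j\<bar>)" unfolding m_def by (intro Max_in) auto
  then obtain j0 where j0: "m = \<bar>y $ j0\<bar>" by blast
  then have m0: "m \<ge> 0" by simp
  have "inverse (weight y) = (\<Prod>j\<in>UNIV. 1 + (y $ j)\<^sup>2)"
    by (simp add: weight_def prod_inversef[symmetric] comp_def)
  also have "\<dots> \<le> (\<Prod>j\<in>(UNIV::'n set). 1 + m\<^sup>2)"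
  proof (rule prod_mono)
    fix j
    have "(y $ j)\<^sup>2 \<le> m\<^sup>2" using m[of j] by (metis abs_ge_zero power2_abs power_mono)
    then show "0 \<le> 1 + (y $ j)\<^sup>2 \<and> 1 + (y $ j)\<^sup>2 \<le> 1 + m\<^sup>2" by (simp add: add_nonneg_nonneg)
  qed
  also have "\<dots> = (1 + m\<^sup>2) ^ ?n" by simp
  also have "\<dots> \<le> (2 * max 1 (m\<^sup>2)) ^ ?n" by (intro power_mono) auto
  also have "\<dots> = 2 ^ ?n * max 1 (m\<^sup>2) ^ ?n" by (rule power_mult_distrib)
  also have "\<dots> \<le> 2 ^ ?n * (1 + (\<Sum>j\<in>UNIV. \<bar>y $ j\<bar> ^ (2 * ?n)))"
  proof (rule mult_left_mono)
    have "m ^ (2 * ?n) \<le> (\<Sum>j\<in>UNIV. \<bar>y $ j\<bar> ^ (2 * ?n))"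
      unfolding j0 by (rule member_le_sum) auto
    moreover have "max 1 (m\<^sup>2) ^ ?n \<le> 1 + m ^ (2 * ?n)"
      by (cases "m\<^sup>2 \<le> 1") (auto simp: max_def power_mult m0)
    ultimately show "max 1 (m\<^sup>2) ^ ?n \<le> 1 + (\<Sum>j\<in>UNIV. \<bar>y $ j\<bar> ^ (2 * ?n))" by linarith
  qed simp
  finally show ?thesis .
qed

text \<open>The inverse Fourier transform of \<open>\<eta>\<close> is at most the \<open>L\<^sup>1\<close> norm of \<open>\<eta>\<close>, hence of the order \<open>R\<^sup>n\<close>, the volume of
  a ball containing the support. Multiplication by \<open>(2 \<pi> x\<^sub>j)\<^sup>2\<^sup>n\<close> replaces \<open>\<eta>\<close> by its derivative of order \<open>2 n\<close> in direction \<open>j\<close>, which vanishes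
  outside the same ball and is smaller by \<open>R\<^sup>-\<^sup>2\<^sup>n\<close>; adding these bounds over \<open>j\<close> gives integrable decay in \<open>R x\<close>.\<close>

lemma kernel_bound:
  fixes \<eta> :: "real^'n::finite \<Rightarrow> complex"
  assumes \<eta>: "\<eta> \<in> schwartz" and R: "R > 0" and c: "c > 0"
    and supp: "closure {\<xi>. \<eta> \<xi> \<noteq> 0} \<subseteq> ball \<xi>0 (c * R)"
    and D: "D \<ge> 0" "\<And>\<xi>. norm (\<eta> \<xi>) \<le> D"
      "\<And>j \<xi>. norm (partial_derivs (replicate (2 * CARD('n)) j) \<eta> \<xi>) \<le> D / R ^ (2 * CARD('n))"
  shows "norm (osc (2 * pi) \<eta> x) \<le>
    2 ^ CARD('n) * (1 + real CARD('n)) * D * measure lborel (ball (0::real^'n) c) * R ^ CARD('n) * weight (R *\<^sub>R x)"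
proof -
  let ?n = "CARD('n)" and ?K = "norm (osc (2 * pi) \<eta> x)"
  define V where "V = measure lborel (ball (0::real^'n) c)"
  have V: "measure lborel (ball \<xi>0 (c * R)) = V * R ^ ?n"
    using R c by (simp add: V_def content_ball power_mult_distrib mult_ac)
  have L1: "norm (osc (2 * pi) g x) \<le> E * (V * R ^ ?n)"
    if g: "g \<in> schwartz" and E: "E \<ge> 0" "\<And>\<xi>. norm (g \<xi>) \<le> E" and out: "\<And>\<xi>. \<xi> \<notin> closure {\<xi>. \<eta> \<xi> \<noteq> 0} \<Longrightarrow> g \<xi> = 0" for g E
  proof -
    have "norm (osc (2 * pi) g x) \<le> (\<integral>\<xi>. norm (g \<xi>) \<partial>lborel)" by (rule osc_norm_le)
    also have "\<dots> \<le> (\<integral>\<xi>. E * indicator (ball \<xi>0 (c * R)) \<xi> \<partial>lborel)"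
    proof (rule integral_mono)
      show "integrable lborel (\<lambda>\<xi>. norm (g \<xi>))" by (intro integrable_norm schwartz_integrable g)
      show "integrable lborel (\<lambda>\<xi>. E * indicator (ball \<xi>0 (c * R)) \<xi> :: real)"
        using emeasure_bounded_finite[of "ball \<xi>0 (c * R)"]
        by (intro integrable_mult_right integrable_real_indicator) auto
      fix \<xi>
      show "norm (g \<xi>) \<le> E * indicator (ball \<xi>0 (c * R)) \<xi>"
      proof (cases "\<xi> \<in> ball \<xi>0 (c * R)")
        case False
        then have "\<xi> \<notin> closure {\<xi>. \<eta> \<xi> \<noteq> 0}" using supp by blast
        then show ?thesis using out[of \<xi>] E(1) by simp
      qed (use E in simp)
    qed
    also have "\<dots> = E * (V * R ^ ?n)" by (simp add: V)
    finally show ?thesis .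
  qed
  have b0: "?K \<le> D * (V * R ^ ?n)"
    by (rule L1[OF \<eta> D(1,2)]) (use closure_subset[of "{\<xi>. \<eta> \<xi> \<noteq> 0}"] in auto)
  have bj: "\<bar>R * x $ j\<bar> ^ (2 * ?n) * ?K \<le> D * (V * R ^ ?n)" for j
  proof -
    have "norm (osc (2 * pi) (partial_derivs (replicate (2 * ?n) j) \<eta>) x) \<le> D / R ^ (2 * ?n) * (V * R ^ ?n)"
      using D R by (intro L1 schwartz_partial_derivs \<eta> partial_derivs_outside_support) auto
    then have "\<bar>2 * pi * x $ j\<bar> ^ (2 * ?n) * ?K \<le> D / R ^ (2 * ?n) * (V * R ^ ?n)"
      by (simp add: osc_partial_derivs_replicate[OF \<eta>] norm_mult norm_power abs_mult)
    moreover have "\<bar>x $ j\<bar> ^ (2 * ?n) * ?K \<le> \<bar>2 * pi * x $ j\<bar> ^ (2 * ?n) * ?K"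
    proof (intro mult_right_mono power_mono)
      have "1 * \<bar>x $ j\<bar> \<le> 2 * pi * \<bar>x $ j\<bar>" using pi_gt3 by (intro mult_right_mono) auto
      then show "\<bar>x $ j\<bar> \<le> \<bar>2 * pi * x $ j\<bar>" by (simp add: abs_mult)
    qed auto
    ultimately have "\<bar>x $ j\<bar> ^ (2 * ?n) * ?K \<le> D / R ^ (2 * ?n) * (V * R ^ ?n)" by linarith
    from mult_left_mono[OF this, of "R ^ (2 * ?n)"] R show ?thesis
      by (simp add: abs_mult power_mult_distrib mult_ac)
  qed
  have "inverse (weight (R *\<^sub>R x)) * ?K \<le> 2 ^ ?n * (1 + (\<Sum>j\<in>UNIV. \<bar>(R *\<^sub>R x) $ j\<bar> ^ (2 * ?n))) * ?K"
    by (intro mult_right_mono inverse_weight_le) auto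
  also have "\<dots> = 2 ^ ?n * (?K + (\<Sum>j\<in>UNIV. \<bar>R * x $ j\<bar> ^ (2 * ?n) * ?K))"
    by (simp add: sum_distrib_right distrib_right)
  also have "\<dots> \<le> 2 ^ ?n * (D * (V * R ^ ?n) + (\<Sum>j\<in>(UNIV::'n set). D * (V * R ^ ?n)))"
    by (intro mult_left_mono add_mono sum_mono b0 bj) auto
  also have "\<dots> = 2 ^ ?n * (1 + real ?n) * D * V * R ^ ?n" by (simp add: algebra_simps)
  finally show ?thesis
    using weight_pos(1)[of "R *\<^sub>R x"] by (simp add: V_def field_simps)
qed

lemma weight_scale_integral:
  assumes "R > 0"
  shows "integrable lborel (\<lambda>x::real^'n::finite. weight (R *\<^sub>R x))"
    and "R ^ CARD('n) * (\<integral>x. weight (R *\<^sub>R (x::real^'n)) \<partial>lborel) = (\<integral>x. weight (x::real^'n) \<partial>lborel)"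
  using integrable_affine_iff[of "weight :: real^'n \<Rightarrow> real" R 0] weight_integrable assms
    integral_affine[of "weight :: real^'n \<Rightarrow> real" R 0]
  by auto

text \<open>By the kernel bound the convolution kernels have supremum of order \<open>R\<^sub>k\<^sup>n\<close> and uniformly bounded
  \<open>L\<^sup>1\<close> norms, so the box operators are bounded from \<open>L\<^sup>1\<close> into \<open>L\<^sup>\<infinity>\<close> and into \<open>L\<^sup>1\<close> with these norms;
  interpolation yields the exponent \<open>n (1 - 1/p)\<close>.\<close>

lemma box_norm_upper:
  fixes \<eta> :: "'k \<Rightarrow> real^'n::finite \<Rightarrow> complex" and \<xi>0 :: "'k \<Rightarrow> real^'n" and R :: "'k \<Rightarrow> real"
  assumes \<eta>: "\<And>k. \<eta> k \<in> schwartz" and R: "\<And>k. R k > 0" and c: "c > 0"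
    and supp: "\<And>k. closure {\<xi>. \<eta> k \<xi> \<noteq> 0} \<subseteq> ball (\<xi>0 k) (c * R k)"
    and D: "D \<ge> 0" "\<And>k \<xi>. norm (\<eta> k \<xi>) \<le> D"
      "\<And>k j \<xi>. norm (partial_derivs (replicate (2 * CARD('n)) j) (\<eta> k) \<xi>) \<le> D / R k ^ (2 * CARD('n))"
    and p: "p > 0" "recip p \<le> 1"
  obtains C where "C > 0" "\<And>k f. integrable lborel f \<Longrightarrow>
    box_norm p (\<eta> k) f \<le>
      ennreal (C * R k powr (CARD('n) * (1 - recip p)) * L1_norm f)"
proof -
  let ?n = "CARD('n)"
  \<comment> \<open>the summand 1 makes the constant positive also if \<open>D = 0\<close>\<close>
  define A where "A = 2 ^ ?n * (1 + real ?n) * D * measure lborel (ball (0::real^'n) c) + 1"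
  have A: "A > 0" unfolding A_def using D by (intro add_nonneg_pos mult_nonneg_nonneg) auto
  define W where "W = (\<integral>x. weight (x::real^'n) \<partial>lborel) + 1"
  have W: "W > 0" unfolding W_def by (intro add_nonneg_pos integral_nonneg_AE) auto
  have K: "norm (osc (2 * pi) (\<eta> k) x) \<le> A * R k ^ ?n * weight (R k *\<^sub>R x)" for k x
  proof -
    have "norm (osc (2 * pi) (\<eta> k) x) \<le>
        2 ^ ?n * (1 + real ?n) * D * measure lborel (ball (0::real^'n) c) * R k ^ ?n * weight (R k *\<^sub>R x)"
      by (rule kernel_bound[OF \<eta> R c supp D])
    also have "\<dots> \<le> A * R k ^ ?n * weight (R k *\<^sub>R x)"
      using R[of k] by (intro mult_right_mono) (auto simp: A_def)
    finally show ?thesis .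
  qed
  have K1: "norm (osc (2 * pi) (\<eta> k) x) \<le> A * R k ^ ?n" for k x
  proof -
    have "A * R k ^ ?n * weight (R k *\<^sub>R x) \<le> A * R k ^ ?n * 1"
      using A R[of k] by (intro mult_left_mono weight_le_1) auto
    with K[of k x] show ?thesis by simp
  qed
  have KL1: "(\<integral>\<^sup>+x. ennreal (norm (osc (2 * pi) (\<eta> k) x)) \<partial>lborel) \<le> ennreal (A * W)" for k
  proof -
    have "(\<integral>\<^sup>+x. ennreal (norm (osc (2 * pi) (\<eta> k) x)) \<partial>lborel) \<le> (\<integral>\<^sup>+x. ennreal (A * R k ^ ?n * weight (R k *\<^sub>R (x::real^'n))) \<partial>lborel)"
      by (intro nn_integral_mono ennreal_leI K)
    also have "\<dots> = ennreal (\<integral>x. A * R k ^ ?n * weight (R k *\<^sub>R (x::real^'n)) \<partial>lborel)"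
      using A R[of k] weight_scale_integral(1)[OF R[of k], where 'n='n]
      by (intro nn_integral_eq_integral integrable_mult_right) (auto simp: less_imp_le)
    also have "(\<integral>x. A * R k ^ ?n * weight (R k *\<^sub>R (x::real^'n)) \<partial>lborel) = A * (W - 1)"
      using weight_scale_integral(2)[OF R[of k], where 'n='n] by (simp add: W_def mult.assoc)
    also have "ennreal (A * (W - 1)) \<le> ennreal (A * W)" using A by (intro ennreal_leI mult_left_mono) auto
    finally show ?thesis .
  qed
  define C where "C = A powr (1 - recip p) * (A * W) powr recip p"
  show thesis
  proof
    show "C > 0" using A W by (simp add: C_def)
    fix k f assume f: "integrable lborel (f :: real^'n \<Rightarrow> complex)"
    then have [measurable]: "f \<in> borel_measurable borel" by auto
    define F where "F = L1_norm f"
    have F: "F \<ge> 0" by (simp add: F_def)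
    have nF: "(\<integral>\<^sup>+x. ennreal (norm (f x)) \<partial>lborel) = ennreal F"
      unfolding F_def using f by (intro nn_integral_eq_integral) auto
    let ?h = "box_fun (\<eta> k) f"
    have "Lp_norm p ?h \<le> ennreal ((A * R k ^ ?n) powr (1 - recip p) * (A * W) powr recip p * F)"
    proof (rule Lp_norm_upper)
      show "?h \<in> borel_measurable lebesgue" by (rule box_fun_representation(1)[OF \<eta> f])
      fix x
      have "ennreal (norm (?h x)) \<le> (\<integral>\<^sup>+y. ennreal (norm (f y)) * ennreal (norm (osc (2 * pi) (\<eta> k) (x - y))) \<partial>lborel)"
        by (rule box_fun_norm_le)
      also have "\<dots> \<le> (\<integral>\<^sup>+y. ennreal (norm (f y)) * ennreal (A * R k ^ ?n) \<partial>lborel)"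
        by (intro nn_integral_mono mult_left_mono ennreal_leI K1) auto
      also have "\<dots> = ennreal F * ennreal (A * R k ^ ?n)"
        by (subst nn_integral_multc) (auto simp: nF)
      also have "\<dots> = ennreal (A * R k ^ ?n * F)" using F by (simp add: ennreal_mult'[symmetric] mult.commute)
      finally show "norm (?h x) \<le> A * R k ^ ?n * F"
        using A R[of k] F by (subst (asm) ennreal_le_iff) auto
    next
      have "(\<integral>\<^sup>+x. ennreal (norm (?h x)) \<partial>lebesgue) = (\<integral>\<^sup>+x. ennreal (norm (?h x)) \<partial>lborel)"
        by (rule nn_integral_completion)
      also have "\<dots> \<le> ennreal F * (\<integral>\<^sup>+x. ennreal (norm (osc (2 * pi) (\<eta> k) x)) \<partial>lborel)"
        using box_fun_L1[OF \<eta>, of f k] by (simp add: nF)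
      also have "\<dots> \<le> ennreal F * ennreal (A * W)" by (intro mult_left_mono KL1) auto
      also have "\<dots> = ennreal (A * W * F)" using F by (simp add: ennreal_mult'[symmetric] mult.commute)
      finally show "(\<integral>\<^sup>+x. ennreal (norm (?h x)) \<partial>lebesgue) \<le> ennreal (A * W * F)" .
    qed (use A W R[of k] F p in auto)
    also have "(A * R k ^ ?n) powr (1 - recip p) * (A * W) powr recip p * F = C * R k powr (?n * (1 - recip p)) * F"
      using R[of k] by (simp add: C_def powr_mult powr_powr powr_realpow[symmetric] mult_ac)
    finally have "Lp_norm p ?h \<le> ennreal (C * R k powr (?n * (1 - recip p)) * F)" .
    moreover have "box_norm p (\<eta> k) f \<le> Lp_norm p ?h"
      unfolding Lp_norm_distr_def box_op_eq_regular[OF \<eta> f]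
      using box_fun_representation[OF \<eta> f] by (intro Inf_lower) blast
    ultimately show "box_norm p (\<eta> k) f \<le>
        ennreal (C * R k powr (?n * (1 - recip p)) * L1_norm f)"
      by (simp add: F_def)
  qed
qed

section \<open>Uniqueness of the representing function\<close>

lemma borel_version:
  fixes g :: "'a::euclidean_space \<Rightarrow> complex"
  assumes "g \<in> borel_measurable lebesgue"
  obtains g' where "g' \<in> borel_measurable borel" "AE x in lborel. g x = g' x"
proof -
  have "(\<lambda>x. Re (g x)) \<in> borel_measurable lebesgue" "(\<lambda>x. Im (g x)) \<in> borel_measurable lebesgue"
    using assms by measurable
  then obtain r i where ri: "r \<in> borel_measurable lborel" "AE x in lborel. Re (g x) = r x"
    "i \<in> borel_measurable lborel" "AE x in lborel. Im (g x) = i x"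
    by (blast dest: completion_ex_borel_measurable_real)
  have [measurable]: "r \<in> borel_measurable borel" "i \<in> borel_measurable borel" using ri by simp_all
  have "(\<lambda>x. of_real (r x) + \<i> * of_real (i x)) \<in> borel_measurable borel" by measurable
  moreover have "AE x in lborel. g x = of_real (r x) + \<i> * of_real (i x)"
    using ri(2,4) by eventually_elim (simp add: complex_eq_iff)
  ultimately show thesis using that by blast
qed

text \<open>Average \<open>v\<close> against a concentrated unit Gaussian. By Fubini the integral of \<open>u\<close> against the average \<open>w\<close> is a
  superposition of integrals of \<open>u\<close> against translated Gaussians, hence zero, while \<open>w\<close> is uniformly close to
  \<open>v\<close>.\<close>

lemma integral_lipschitz_eq_0:
  fixes u :: "real^'n::finite \<Rightarrow> complex" and v :: "real^'n \<Rightarrow> real"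
  assumes u: "integrable lborel u" and zero: "\<And>\<phi>. \<phi> \<in> schwartz \<Longrightarrow> (\<integral>x. u x * \<phi> x \<partial>lborel) = 0"
    and lip: "\<And>x y. \<bar>v x - v y\<bar> \<le> L * norm (x - y)" and v: "\<And>x. 0 \<le> v x" "\<And>x. v x \<le> 1"
    and [measurable]: "v \<in> borel_measurable borel"
  shows "(\<integral>x. u x * of_real (v x) \<partial>lborel) = 0"
proof -
  have [measurable]: "u \<in> borel_measurable borel" using u by auto
  let ?J = "L * gauss_moment TYPE('n)"
  have uv: "integrable lborel (\<lambda>x. u x * of_real (v x))"
    by (rule Bochner_Integration.integrable_bound[OF u]) (use v in \<open>auto simp: norm_mult mult_left_le\<close>)
  have bound: "norm (\<integral>x. u x * of_real (v x) \<partial>lborel) \<le> (\<integral>x. norm (u x) \<partial>lborel) * ?J / a" if a: "a > 0" for a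
  proof -
    let ?F = "\<lambda>x z. u x * (unit_gauss a (z - x) * of_real (v z))"
    define w where "w x = (\<integral>z. unit_gauss a (z - x) * of_real (v z) \<partial>lborel)" for x
    have Gt: "(\<lambda>z. unit_gauss a (z - x)) \<in> schwartz" for x :: "real^'n" by (rule schwartz_unit_gauss_translate[OF a])
    have G1: "(LINT z|lborel. norm (unit_gauss a (z - x))) = 1" for x :: "real^'n"
      using integral_norm_unit_gauss[OF a, where 'n='n] by (subst integral_affine[where c = 1 and t = x]) auto
    have iv: "integrable lborel (\<lambda>z. unit_gauss a (z - x) * complex_of_real (v z))" for x
      by (rule Bochner_Integration.integrable_bound[OF schwartz_integrable[OF Gt[of x]]])
        (use v in \<open>auto simp: norm_mult mult_left_le\<close>)
    have int: "integrable (lborel \<Otimes>\<^sub>M lborel) (\<lambda>(x, z). ?F x z)"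
    proof (rule lborel_pair.Fubini_integrable)
      show "(\<lambda>(x, z). ?F x z) \<in> borel_measurable (lborel \<Otimes>\<^sub>M lborel)" by measurable
      show "AE x in lborel. integrable lborel (\<lambda>z. case (x, z) of (x, z) \<Rightarrow> ?F x z)"
        unfolding prod.case by (intro AE_I2 integrable_mult_right iv)
      have meas: "(\<lambda>x. LINT z|lborel. norm (?F x z)) \<in> borel_measurable lborel" by measurable
      have "norm (LINT z|lborel. norm (?F x z)) \<le> norm (u x)" for x
      proof -
        have "(LINT z|lborel. norm (?F x z)) = norm (u x) * (LINT z|lborel. norm (unit_gauss a (z - x) * complex_of_real (v z)))"
          by (simp only: norm_mult integral_mult_right_zero)
        also have "\<dots> \<le> norm (u x) * (LINT z|lborel. norm (unit_gauss a (z - x)))"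
          using v by (intro mult_left_mono integral_mono integrable_norm iv schwartz_integrable Gt)
            (auto simp: norm_mult mult_left_le)
        finally show ?thesis by (simp add: G1 integral_nonneg_AE)
      qed
      then show "integrable lborel (\<lambda>x. LINT z|lborel. norm (case (x, z) of (x, z) \<Rightarrow> ?F x z))"
        unfolding prod.case by (intro Bochner_Integration.integrable_bound[OF u meas] AE_I2) auto
    qed
    have uw_eq: "u x * w x = (\<integral>z. ?F x z \<partial>lborel)" for x unfolding w_def by (simp only: integral_mult_right_zero)
    have uw: "integrable lborel (\<lambda>x. u x * w x)" unfolding uw_eq using lborel_pair.integrable_fst'[OF int] by simp
    have "(\<integral>x. u x * w x \<partial>lborel) = (\<integral>z. (\<integral>x. ?F x z \<partial>lborel) \<partial>lborel)"
      unfolding uw_eq by (rule lborel_pair.Fubini_integral[OF int, symmetric])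
    also have "\<dots> = (\<integral>z. 0 \<partial>(lborel :: (real^'n) measure))"
    proof (rule Bochner_Integration.integral_cong[OF refl])
      fix z
      have "?F x z = u x * unit_gauss a (x - z) * of_real (v z)" for x
        by (simp add: unit_gauss_def gauss_def inner_diff_left inner_diff_right inner_commute algebra_simps)
      then show "(\<integral>x. ?F x z \<partial>lborel) = 0" using zero[OF Gt[of z]] by (simp only: integral_mult_left_zero) simp
    qed
    finally have 0: "(\<integral>x. u x * w x \<partial>lborel) = 0" by simp
    have wv: "norm (w x - of_real (v x)) \<le> ?J / a" for x
    proof -
      have "w x = (\<integral>y. unit_gauss a y * of_real (v (x + y)) \<partial>lborel)"
        unfolding w_def by (subst integral_affine[where c = 1 and t = x]) auto
      moreover have "norm (complex_of_real (v (x + y)) - of_real (v (x + 0))) \<le> L * norm y" for y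
        using lip[of "x + y" x] by (simp add: of_real_diff[symmetric] del: of_real_diff)
      ultimately show ?thesis
        using unit_gauss_approx(2)[of "\<lambda>y. complex_of_real (v (x + y))" L a] a by simp
    qed
    have "norm (\<integral>x. u x * of_real (v x) \<partial>lborel) = norm (\<integral>x. u x * w x - u x * of_real (v x) \<partial>lborel)"
      by (simp add: Bochner_Integration.integral_diff[OF uw uv] 0)
    also have "\<dots> \<le> (\<integral>x. norm (u x) * (?J / a) \<partial>lborel)"
    proof (rule Bochner_Integration.integral_norm_bound_integral)
      show "norm (u x * w x - u x * of_real (v x)) \<le> norm (u x) * (?J / a)" for x
        unfolding right_diff_distrib[symmetric] norm_mult by (intro mult_left_mono wv) simp
    qed (use u uw uv in auto)
    finally show ?thesis by simp
  qed
  have "((\<lambda>a. (\<integral>x. norm (u x) \<partial>lborel) * ?J / a) \<longlongrightarrow> 0) at_top"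
    by (intro tendsto_divide_0[OF tendsto_const] filterlim_at_top_imp_at_infinity filterlim_ident)
  moreover have "\<forall>\<^sub>F a in at_top. norm (\<integral>x. u x * of_real (v x) \<partial>lborel) \<le> (\<integral>x. norm (u x) \<partial>lborel) * ?J / a"
    using eventually_gt_at_top[of 0] by eventually_elim (rule bound)
  ultimately have "norm (\<integral>x. u x * of_real (v x) \<partial>lborel) \<le> 0"
    by (intro tendsto_lowerbound[OF _ _ trivial_limit_at_top_linorder])
  then show ?thesis by simp
qed

text \<open>The indicator of a closed set is the limit of the Lipschitz functions \<open>max 0 (1 - m dist(x, K))\<close>.\<close>

lemma integral_closed_eq_0:
  fixes u :: "real^'n::finite \<Rightarrow> complex"
  assumes u: "integrable lborel u" and zero: "\<And>\<phi>. \<phi> \<in> schwartz \<Longrightarrow> (\<integral>x. u x * \<phi> x \<partial>lborel) = 0"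
    and K: "closed K"
  shows "(\<integral>x. u x * indicator K x \<partial>lborel) = 0"
proof (cases "K = {}")
  case False
  have [measurable]: "u \<in> borel_measurable borel" using u by auto
  have [measurable]: "K \<in> sets borel" using K by simp
  define v where "v m x = max 0 (1 - real m * infdist x K)" for m :: nat and x
  have lip: "\<bar>v m x - v m y\<bar> \<le> real m * norm (x - y)" for m x y
  proof -
    have "\<bar>v m x - v m y\<bar> \<le> \<bar>real m * infdist x K - real m * infdist y K\<bar>"
      unfolding v_def by linarith
    also have "\<dots> = real m * \<bar>infdist x K - infdist y K\<bar>" by (simp add: right_diff_distrib[symmetric] abs_mult)
    also have "\<dots> \<le> real m * norm (x - y)"
      using infdist_triangle_abs[of x K y] by (intro mult_left_mono) (auto simp: dist_norm)
    finally show ?thesis .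
  qed
  have v01: "0 \<le> v m x" "v m x \<le> 1" for m x by (auto simp: v_def infdist_nonneg)
  have [measurable]: "v m \<in> borel_measurable borel" for m
    unfolding v_def by (intro borel_measurable_continuous_onI continuous_intros)
  have vlim: "(\<lambda>m. v m x) \<longlonglongrightarrow> indicator K x" for x
  proof (cases "x \<in> K")
    case True
    then show ?thesis by (simp add: v_def)
  next
    case False
    then have d: "infdist x K > 0" using K \<open>K \<noteq> {}\<close> by (simp add: infdist_pos_not_in_closed)
    obtain N :: nat where N: "1 < real N * infdist x K" using reals_Archimedean3[OF d] by blast
    have "v m x = 0" if "m \<ge> N" for m
    proof -
      have "real N * infdist x K \<le> real m * infdist x K" using that d by (intro mult_right_mono) auto
      then show ?thesis using N by (simp add: v_def)
    qed
    then have "\<forall>\<^sub>F m in sequentially. v m x = indicator K x"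
      using False by (auto simp: eventually_sequentially)
    then show ?thesis by (rule tendsto_eventually)
  qed
  define s where "s m x = u x * of_real (v m x)" for m x
  define s0 where "s0 x = u x * indicator K x" for x
  have "(\<lambda>m. integral\<^sup>L lborel (s m)) \<longlonglongrightarrow> integral\<^sup>L lborel s0"
  proof (rule integral_dominated_convergence)
    show "s0 \<in> borel_measurable lborel" "s m \<in> borel_measurable lborel" for m
      unfolding s_def s0_def by measurable
    show "integrable lborel (\<lambda>x. norm (u x))" using u by (rule integrable_norm)
    show "AE x in lborel. norm (s m x) \<le> norm (u x)" for m
      using v01 by (auto simp: s_def norm_mult mult_left_le intro!: AE_I2)
    have "(\<lambda>m. s m x) \<longlonglongrightarrow> u x * of_real (indicator K x)" for x
      unfolding s_def by (intro tendsto_mult tendsto_const tendsto_of_real vlim)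
    moreover have "s0 x = u x * of_real (indicator K x)" for x
      by (simp add: s0_def split: split_indicator)
    ultimately show "AE x in lborel. (\<lambda>m. s m x) \<longlonglongrightarrow> s0 x" by simp
  qed
  moreover have "integral\<^sup>L lborel (s m) = 0" for m
    unfolding s_def by (rule integral_lipschitz_eq_0[OF u zero lip v01]) measurable
  ultimately show ?thesis by (simp add: LIMSEQ_const_iff s0_def[abs_def])
qed simp

text \<open>The positive and the negative part of \<open>r\<close> are densities of finite measures that agree on closed sets,
  an intersection-stable generator of the Borel sets; so the measures and then the densities agree.\<close>

lemma AE_zero_if_closed_integrals_zero:
  fixes r :: "'a::euclidean_space \<Rightarrow> real"
  assumes r: "integrable lborel r" and zero: "\<And>K. closed K \<Longrightarrow> (\<integral>x. r x * indicator K x \<partial>lborel) = 0"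
  shows "AE x in lborel. r x = 0"
proof -
  have [measurable]: "r \<in> borel_measurable borel" using r by auto
  let ?p = "\<lambda>x. max 0 (r x)" and ?n = "\<lambda>x. max 0 (- r x)"
  have ip: "integrable lborel ?p" and inn: "integrable lborel ?n" using r by (auto intro: integrable_max)
  have em: "emeasure (density lborel (\<lambda>x. ennreal (f x))) K = ennreal (\<integral>x. f x * indicator K x \<partial>lborel)"
    if "integrable lborel f" "\<And>x. 0 \<le> f x" "closed K" for f :: "'a \<Rightarrow> real" and K
  proof -
    have [measurable]: "K \<in> sets borel" "f \<in> borel_measurable borel" using that by auto
    have "emeasure (density lborel (\<lambda>x. ennreal (f x))) K = (\<integral>\<^sup>+x. ennreal (f x * indicator K x) \<partial>lborel)"
      by (subst emeasure_density) (auto simp: ennreal_mult' ennreal_indicator that intro!: nn_integral_cong split: split_indicator)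
    also have "\<dots> = ennreal (\<integral>x. f x * indicator K x \<partial>lborel)"
      using that by (intro nn_integral_eq_integral integrable_mult_indicator[where 'b=real, simplified mult.commute] AE_I2) (auto simp: integrable_real_mult_indicator)
    finally show ?thesis .
  qed
  have "density lborel (\<lambda>x. ennreal (?p x)) = density lborel (\<lambda>x. ennreal (?n x))"
  proof (rule measure_eqI_generator_eq[where \<Omega> = UNIV and E = "Collect closed" and A = "\<lambda>_. UNIV"])
    show "Int_stable (Collect closed :: 'a set set)" by (auto simp: Int_stable_def)
    show "sets (density lborel (\<lambda>x. ennreal (?p x))) = sigma_sets UNIV (Collect closed)"
      "sets (density lborel (\<lambda>x. ennreal (?n x))) = sigma_sets UNIV (Collect closed)"
      by (simp_all add: borel_eq_closed)
    show "emeasure (density lborel (\<lambda>x. ennreal (?p x))) UNIV \<noteq> \<infinity>" for i :: nat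
      by (subst em[OF ip]) auto
    fix K :: "'a set" assume "K \<in> Collect closed"
    then have K: "closed K" by simp
    then have [measurable]: "K \<in> sets borel" by simp
    have "(\<integral>x. ?p x * indicator K x \<partial>lborel) - (\<integral>x. ?n x * indicator K x \<partial>lborel)
        = (\<integral>x. ?p x * indicator K x - ?n x * indicator K x \<partial>lborel)"
      using ip inn by (intro Bochner_Integration.integral_diff[symmetric] integrable_real_mult_indicator) auto
    also have "\<dots> = (\<integral>x. r x * indicator K x \<partial>lborel)"
      by (intro Bochner_Integration.integral_cong refl) (auto simp: max_def split: split_indicator)
    finally show "emeasure (density lborel (\<lambda>x. ennreal (?p x))) K = emeasure (density lborel (\<lambda>x. ennreal (?n x))) K"
      using zero[OF K] em[OF ip _ K] em[OF inn _ K] by simp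
  qed auto
  then have "AE x in lborel. ennreal (?p x) = ennreal (?n x)"
    using ip by (subst (asm) finite_density_unique) (auto simp: nn_integral_eq_integral)
  then show ?thesis
    by eventually_elim (auto simp: max_def split: if_splits)
qed

text \<open>A distribution is represented by at most one function up to null sets. Multiplication by a Gaussian makes \<open>h\<close>
  integrable without disturbing the hypothesis, since Gaussian times Schwartz is Schwartz.\<close>

lemma AE_zero_if_schwartz_integrals_zero:
  fixes h :: "real^'n::finite \<Rightarrow> complex"
  assumes h: "h \<in> borel_measurable lebesgue"
    and int: "\<And>\<phi>. \<phi> \<in> schwartz \<Longrightarrow> integrable lebesgue (\<lambda>x. h x * \<phi> x)"
    and zero: "\<And>\<phi>. \<phi> \<in> schwartz \<Longrightarrow> (\<integral>x. h x * \<phi> x \<partial>lebesgue) = 0"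
  shows "AE x in lebesgue. h x = 0"
proof -
  obtain h' where h'[measurable]: "h' \<in> borel_measurable borel" and ae: "AE x in lborel. h x = h' x"
    using borel_version[OF h] .
  have ae': "AE x in lebesgue. h x = h' x" using ae by (rule AE_completion)
  have \<phi>: "integrable lborel (\<lambda>x. h' x * \<phi> x)" "(\<integral>x. h' x * \<phi> x \<partial>lborel) = 0" if "\<phi> \<in> schwartz" for \<phi>
  proof -
    have [measurable]: "\<phi> \<in> borel_measurable borel" using schwartz_borel[OF that] .
    have [measurable]: "\<phi> \<in> borel_measurable lebesgue" "h' \<in> borel_measurable lebesgue" by (auto simp: measurable_completion)
    have b: "(\<lambda>x. h' x * \<phi> x) \<in> borel_measurable lborel" by measurable
    have ae2: "AE x in lebesgue. h x * \<phi> x = h' x * \<phi> x" using ae' by eventually_elim simp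
    have "integrable lebesgue (\<lambda>x. h' x * \<phi> x)"
      by (rule integrable_cong_AE_imp[OF int[OF that]]) (use ae2 in \<open>auto elim: eventually_mono\<close>)
    then show "integrable lborel (\<lambda>x. h' x * \<phi> x)" using integrable_completion[OF b] by blast
    have "(\<integral>x. h' x * \<phi> x \<partial>lebesgue) = (\<integral>x. h x * \<phi> x \<partial>lebesgue)"
      by (rule integral_cong_AE) (use h ae2 in \<open>auto elim: eventually_mono\<close>)
    then show "(\<integral>x. h' x * \<phi> x \<partial>lborel) = 0" using integral_completion[OF b] zero[OF that] by simp
  qed
  let ?g = "gauss 1 :: real^'n \<Rightarrow> complex"
  define u where "u x = h' x * ?g x" for x
  have g: "?g \<in> schwartz" by (rule schwartz_gauss) simp
  have ui: "integrable lborel u" unfolding u_def by (rule \<phi>(1)[OF g])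
  have u0: "(\<integral>x. u x * \<phi> x \<partial>lborel) = 0" if "\<phi> \<in> schwartz" for \<phi>
    using \<phi>(2)[OF schwartz_mult[OF g that]] by (simp add: u_def mult.assoc)
  have cl: "(\<integral>x. u x * indicator K x \<partial>lborel) = 0" if "closed K" for K
    by (rule integral_closed_eq_0[OF ui u0 that])
  have iK: "integrable lborel (\<lambda>x. u x * indicator K x)" if "closed K" for K :: "(real^'n) set"
  proof -
    have [measurable]: "K \<in> sets borel" "u \<in> borel_measurable borel" using that ui by auto
    show ?thesis
      by (rule Bochner_Integration.integrable_bound[OF ui]) (auto split: split_indicator)
  qed
  have ind: "(indicator K x :: complex) = of_real (indicator K x)" for K and x :: "real^'n"
    by (simp split: split_indicator)
  have "AE x in lborel. Re (u x) = 0"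
  proof (rule AE_zero_if_closed_integrals_zero)
    show "integrable lborel (\<lambda>x. Re (u x))" using ui by (rule integrable_Re)
    fix K :: "(real^'n) set" assume K: "closed K"
    show "(\<integral>x. Re (u x) * indicator K x \<partial>lborel) = 0"
      using integral_Re[OF iK[OF K]] cl[OF K] by (simp add: ind)
  qed
  moreover have "AE x in lborel. Im (u x) = 0"
  proof (rule AE_zero_if_closed_integrals_zero)
    show "integrable lborel (\<lambda>x. Im (u x))" using ui by (rule integrable_Im)
    fix K :: "(real^'n) set" assume K: "closed K"
    show "(\<integral>x. Im (u x) * indicator K x \<partial>lborel) = 0"
      using integral_Im[OF iK[OF K]] cl[OF K] by (simp add: ind)
  qed
  ultimately have "AE x in lborel. h x = 0"
    using ae by eventually_elim (auto simp: u_def gauss_def complex_eq_iff)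
  then show ?thesis by (rule AE_completion)
qed

section \<open>Exponents below one\<close>

text \<open>Test functions \<open>wave_packet b 0\<close> of modulus at most one, spreading out as \<open>b\<close> tends to zero, pick up \<open>\<eta> 0\<close>
  times the total mass of the Gaussian, up to a constant and an error \<open>E * b\<close>. The resulting lower bound does
  not depend on \<open>a\<close>.\<close>

lemma box_fun_unit_gauss_L1:
  fixes \<eta> :: "real^'n::finite \<Rightarrow> complex"
  assumes \<eta>: "\<eta> \<in> schwartz" and a: "a > 0"
  shows "ennreal (packet_mass TYPE('n) * norm (\<eta> 0)) \<le> (\<integral>\<^sup>+y. ennreal (norm (box_fun \<eta> (unit_gauss a) y)) \<partial>lborel)"
    (is "_ \<le> ?I")
proof -
  let ?h = "box_fun \<eta> (unit_gauss a)" and ?c = "packet_mass TYPE('n)" and ?J = "gauss_moment TYPE('n)"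
  have fi: "integrable lborel (unit_gauss a :: real^'n \<Rightarrow> complex)" by (intro schwartz_integrable schwartz_unit_gauss a)
  obtain L where L: "L \<ge> 0" "\<And>x y. norm (\<eta> x - \<eta> y) \<le> L * norm (x - y)" using schwartz_lipschitz[OF \<eta>] by blast
  obtain M where M: "M > 0" "\<And>x. norm (\<eta> x) \<le> M" using schwartz_bounded[OF \<eta>] by blast
  define E where "E = ?c * (?J / pi) * (L + 2 * pi * M * (?J / a))"
  have E: "ennreal (?c * norm (\<eta> 0) - E * b) \<le> ?I" if b: "b > 0" for b
  proof -
    let ?\<phi> = "wave_packet b 0 :: real^'n \<Rightarrow> complex"
    let ?\<Phi> = "adj_multiplier \<eta> ?\<phi>"
    let ?B = "\<lambda>x::real^'n. ?c * (?J * b / pi) * (L * norm (unit_gauss a x) + 2 * pi * M * (norm x * norm (unit_gauss a x)))"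
    have \<phi>s: "?\<phi> \<in> schwartz" using b by (rule schwartz_wave_packet)
    have i1: "integrable lborel (\<lambda>x. unit_gauss a x * ?\<Phi> x)"
      by (intro schwartz_integrable schwartz_mult schwartz_unit_gauss schwartz_adj_multiplier a \<eta> \<phi>s)
    have i2: "integrable lborel (\<lambda>x::real^'n. unit_gauss a x * (of_real ?c * \<eta> 0))" by (intro integrable_mult_left fi)
    have iL: "integrable lborel (\<lambda>x::real^'n. L * norm (unit_gauss a x))"
      and iM: "integrable lborel (\<lambda>x::real^'n. 2 * pi * M * (norm x * norm (unit_gauss a x)))"
      by (intro integrable_mult_right integrable_norm fi unit_gauss_moment a)+
    have "(\<integral>x. unit_gauss a x * ?\<Phi> x \<partial>lborel) - of_real ?c * \<eta> 0 = (\<integral>x. unit_gauss a x * ?\<Phi> x - unit_gauss a x * (of_real ?c * \<eta> 0) \<partial>lborel)"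
      unfolding Bochner_Integration.integral_diff[OF i1 i2] by (simp add: integral_unit_gauss[OF a])
    also have "norm \<dots> \<le> integral\<^sup>L lborel ?B"
    proof (rule Bochner_Integration.integral_norm_bound_integral)
      show "integrable lborel (\<lambda>x. unit_gauss a x * ?\<Phi> x - unit_gauss a x * (of_real ?c * \<eta> 0))"
        using i1 i2 by (rule Bochner_Integration.integrable_diff)
      show "integrable lborel ?B"
        by (intro integrable_mult_right Bochner_Integration.integrable_add[OF iL iM])
      fix x :: "real^'n"
      have "norm (?\<Phi> x - of_real ?c * \<eta> 0) \<le> ?c * ((L + 2 * pi * M * norm x) * (?J * b / pi))"
        using adj_multiplier_wave_packet[OF \<eta> b L(1) L(2)[of _ 0] M(2), of x] by simp
      from mult_left_mono[OF this norm_ge_zero[of "unit_gauss a x"]]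
      show "norm (unit_gauss a x * ?\<Phi> x - unit_gauss a x * (of_real ?c * \<eta> 0)) \<le> ?B x"
        unfolding right_diff_distrib[symmetric] norm_mult by (simp add: algebra_simps)
    qed
    also have "\<dots> = ?c * (?J * b / pi) * (L + 2 * pi * M * (?J / a))"
      by (simp only: integral_mult_right_zero Bochner_Integration.integral_add[OF iL iM]
          integral_norm_unit_gauss[OF a] unit_gauss_moment(2)[OF a] mult_1_right)
    also have "\<dots> = E * b" by (simp add: E_def)
    also have "(\<integral>x. unit_gauss a x * ?\<Phi> x \<partial>lborel) = (\<integral>y. ?h y * ?\<phi> y \<partial>lborel)"
      by (rule box_fun_schwartz_integrable(2)[OF \<eta> fi \<phi>s, symmetric])
    finally have "norm (of_real ?c * \<eta> 0) - E * b \<le> norm (\<integral>y. ?h y * ?\<phi> y \<partial>lborel)"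
      using norm_triangle_ineq3[of "\<integral>y. ?h y * ?\<phi> y \<partial>lborel" "of_real ?c * \<eta> 0"] by linarith
    then have "ennreal (?c * norm (\<eta> 0) - E * b) \<le> ennreal (norm (\<integral>y. ?h y * ?\<phi> y \<partial>lborel))"
      using packet_mass_pos[where 'n='n] by (intro ennreal_leI) (simp add: norm_mult)
    also have "\<dots> \<le> (\<integral>\<^sup>+y. ennreal (norm (?h y * ?\<phi> y)) \<partial>lborel)"
      by (rule integral_norm_bound_ennreal[OF box_fun_schwartz_integrable(1)[OF \<eta> fi \<phi>s]])
    also have "\<dots> \<le> ?I"
      by (intro nn_integral_mono ennreal_leI) (simp add: norm_mult norm_wave_packet mult_left_le)
    finally show ?thesis .
  qed
  have "((\<lambda>b. ennreal (?c * norm (\<eta> 0) - E * b)) \<longlongrightarrow> ennreal (?c * norm (\<eta> 0) - E * 0)) (at_right 0)"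
    by (intro tendsto_ennrealI tendsto_intros)
  then have "ennreal (?c * norm (\<eta> 0) - E * 0) \<le> ?I"
    by (rule tendsto_upperbound) (use E in \<open>auto simp: eventually_at_filter\<close>)
  then show ?thesis by simp
qed

lemma box_fun_unit_gauss_sup:
  fixes \<eta> :: "real^'n::finite \<Rightarrow> complex"
  assumes \<eta>: "\<eta> \<in> schwartz" and a: "a > 0"
  shows "norm (box_fun \<eta> (unit_gauss a) y) \<le>
    a ^ CARD('n) / gauss_mass TYPE('n) 1 * (\<integral>x. norm (osc (2 * pi) \<eta> x) \<partial>lborel)"
proof -
  let ?K = "osc (2 * pi) \<eta>" and ?A = "a ^ CARD('n) / gauss_mass TYPE('n) 1"
  have A: "?A > 0" using a by (intro divide_pos_pos gauss_mass_pos) auto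
  have fA: "norm (unit_gauss a x) \<le> ?A" for x :: "real^'n"
    unfolding norm_unit_gauss[OF a] using A by (intro mult_left_le) auto
  have Ks: "?K \<in> schwartz" using \<eta> by (intro schwartz_osc) auto
  have Kb[measurable]: "?K \<in> borel_measurable borel" using schwartz_borel[OF Ks] .
  have Ki: "integrable lborel (\<lambda>x. ?K (y - x))"
    using integrable_affine_iff[OF Kb, of "-1" y] schwartz_integrable[OF Ks] by simp
  have "norm (box_fun \<eta> (unit_gauss a) y) \<le> (\<integral>x. ?A * norm (?K (y - x)) \<partial>lborel)"
    unfolding box_fun_def
  proof (rule Bochner_Integration.integral_norm_bound_integral)
    show i: "integrable lborel (\<lambda>x. ?A * norm (?K (y - x)))"
      by (intro integrable_mult_right integrable_norm Ki)
    show le: "norm (unit_gauss a x * ?K (y - x)) \<le> ?A * norm (?K (y - x))" for x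
      unfolding norm_mult by (intro mult_right_mono fA) auto
    show "integrable lborel (\<lambda>x. unit_gauss a x * ?K (y - x))"
    proof (rule Bochner_Integration.integrable_bound[OF i])
      show "AE x in lborel. norm (unit_gauss a x * ?K (y - x)) \<le> norm (?A * norm (?K (y - x)))"
        unfolding real_norm_def by (intro AE_I2 order_trans[OF le abs_ge_self])
    qed measurable
  qed
  also have "\<dots> = ?A * (\<integral>x. norm (?K x) \<partial>lborel)"
    using integral_affine[of "\<lambda>x. norm (?K x)" "-1" y] by simp
  finally show ?thesis .
qed

text \<open>The infimum in the definition ranges over one value only, by uniqueness of the representing function.\<close>

lemma Lp_norm_distr_regular:
  fixes h :: "real^'n::finite \<Rightarrow> complex"
  assumes "h \<in> borel_measurable lebesgue" "\<forall>\<phi>\<in>schwartz. integrable lebesgue (\<lambda>x. h x * \<phi> x)"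
  shows "Lp_norm_distr p (regular_distr h) = Lp_norm p h"
proof -
  have "Lp_norm p g = Lp_norm p h"
    if g: "g \<in> borel_measurable lebesgue" "\<forall>\<phi>\<in>schwartz. integrable lebesgue (\<lambda>x. g x * \<phi> x)"
      and eq: "regular_distr h = regular_distr g" for g
  proof -
    have "AE x in lebesgue. g x - h x = 0"
    proof (rule AE_zero_if_schwartz_integrals_zero)
      show "(\<lambda>x. g x - h x) \<in> borel_measurable lebesgue" using assms g by measurable
      fix \<phi> :: "real^'n \<Rightarrow> complex" assume \<phi>: "\<phi> \<in> schwartz"
      show "integrable lebesgue (\<lambda>x. (g x - h x) * \<phi> x)"
        using assms g \<phi> by (simp add: left_diff_distrib)
      have "(\<integral>x. g x * \<phi> x \<partial>lebesgue) = (\<integral>x. h x * \<phi> x \<partial>lebesgue)"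
        using fun_cong[OF eq, of \<phi>] \<phi> by (simp add: regular_distr_def)
      then show "(\<integral>x. (g x - h x) * \<phi> x \<partial>lebesgue) = 0"
        using assms g \<phi> by (simp add: left_diff_distrib)
    qed
    then have ae: "AE x in lebesgue. g x = h x" by simp
    have "esssup lebesgue (\<lambda>x. ennreal (norm (g x))) = esssup lebesgue (\<lambda>x. ennreal (norm (h x)))"
      by (rule esssup_AE_cong) (use assms g ae in \<open>auto elim: eventually_mono\<close>)
    moreover have "(\<integral>\<^sup>+x. ennpow (ennreal (norm (g x))) r \<partial>lebesgue) = (\<integral>\<^sup>+x. ennpow (ennreal (norm (h x))) r \<partial>lebesgue)" for r
      by (rule nn_integral_cong_AE) (use ae in \<open>auto elim: eventually_mono\<close>)
    ultimately show ?thesis by (simp add: Lp_norm_def)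
  qed
  then have "{Lp_norm p g | g. g \<in> borel_measurable lebesgue \<and>
      (\<forall>\<phi>\<in>schwartz. integrable lebesgue (\<lambda>x. g x * \<phi> x)) \<and> regular_distr h = regular_distr g} = {Lp_norm p h}"
    using assms by blast
  then show ?thesis unfolding Lp_norm_distr_def by simp
qed

text \<open>A flat Gaussian has integral one but height of order \<open>a\<^sup>n\<close>. Its image \<open>h\<close> under the box operator satisfies
  \<open>|h| \<le> M\<close> with \<open>M\<close> of order \<open>a\<^sup>n\<close>, while its \<open>L\<^sup>1\<close> norm stays away from zero because of \<open>\<eta> 0 \<noteq> 0\<close>. For \<open>P < 1\<close> the inequality
  \<open>|h|\<^sup>P \<ge> M\<^sup>P\<^sup>-\<^sup>1 |h|\<close> then makes the \<open>L\<^sup>P\<close> quasi-norm arbitrarily large as \<open>a\<close> tends to zero.\<close>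

lemma box_norm_unbounded:
  fixes \<eta> :: "real^'n::finite \<Rightarrow> complex"
  assumes \<eta>: "\<eta> \<in> schwartz" "\<eta> 0 \<noteq> 0" and p: "p > 0" "recip p > 1" and X: "X > 0"
  shows "\<exists>a>0. ennreal X \<le> box_norm p \<eta> (unit_gauss a)"
proof -
  obtain P where P: "P > 0" "p = ennreal P" "recip p = inverse P"
    using p by (cases rule: exponent_cases[OF p(1)]) auto
  have "1 < inverse P" using p(2) P(3) by simp
  then have P1: "P < 1" using P(1) by (simp add: field_simps)
  let ?C = "gauss_mass TYPE('n) 1"
  have C: "?C > 0" by (rule gauss_mass_pos) simp
  define \<kappa> where "\<kappa> = packet_mass TYPE('n) * norm (\<eta> 0)"
  have \<kappa>: "\<kappa> > 0" unfolding \<kappa>_def using \<eta>(2) packet_mass_pos[where 'n='n] by simp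
  define L where "L = (\<integral>x. norm (osc (2 * pi) \<eta> x) \<partial>lborel) + 1"
  have L: "L > 0" unfolding L_def by (intro add_nonneg_pos integral_nonneg_AE) auto
  \<comment> \<open>the height at which \<open>T\<^sup>P\<^sup>-\<^sup>1 * \<kappa> = X\<^sup>P\<close>; \<open>a\<close> is then chosen to push the height \<open>M\<close> below \<open>T\<close>\<close>
  define T where "T = (X powr P / \<kappa>) powr (1 / (P - 1))"
  have T: "T > 0" using X \<kappa> by (simp add: T_def)
  define a where "a = min 1 (T * ?C / L)"
  have a: "a > 0" "a \<le> 1" "a \<le> T * ?C / L" using T C L by (auto simp: a_def)
  define M where "M = a ^ CARD('n) / ?C * L"
  have M: "M > 0" "M \<le> T"
  proof -
    show "M > 0" using a C L by (simp add: M_def)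
    have "a ^ CARD('n) \<le> a ^ 1" using a by (intro power_decreasing) auto
    then have "a ^ CARD('n) \<le> T * ?C / L" using a by simp
    then show "M \<le> T" using C L by (simp add: M_def field_simps)
  qed
  let ?h = "box_fun \<eta> (unit_gauss a)"
  have fi: "integrable lborel (unit_gauss a :: real^'n \<Rightarrow> complex)"
    by (rule schwartz_integrable[OF schwartz_unit_gauss[OF a(1)]])
  have [measurable]: "?h \<in> borel_measurable borel" using \<eta>(1) by (intro box_fun_borel) auto
  have hM: "norm (?h y) \<le> M" for y
  proof -
    have "norm (?h y) \<le> a ^ CARD('n) / ?C * (L - 1)"
      using box_fun_unit_gauss_sup[OF \<eta>(1) a(1)] by (simp add: L_def)
    also have "\<dots> \<le> M" unfolding M_def using a C by (intro mult_left_mono) auto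
    finally show ?thesis .
  qed
  have pt: "M powr (P - 1) * norm (?h y) \<le> norm (?h y) powr P" for y
  proof (cases "norm (?h y) = 0")
    case False
    have "M powr (P - 1) * norm (?h y) \<le> norm (?h y) powr (P - 1) * norm (?h y)"
      using False hM P1 by (intro mult_right_mono powr_mono2') auto
    also have "\<dots> = norm (?h y) powr P" using False by (simp add: powr_diff)
    finally show ?thesis .
  qed simp
  have "X powr P = T powr (P - 1) * \<kappa>"
    using X \<kappa> P1 by (simp add: T_def powr_powr)
  also have "\<dots> \<le> M powr (P - 1) * \<kappa>"
    using M T P1 \<kappa> by (intro mult_right_mono powr_mono2') auto
  finally have "ennreal (X powr P) \<le> ennreal (M powr (P - 1)) * ennreal \<kappa>"
    by (simp add: ennreal_mult'[symmetric] ennreal_leI)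
  also have "\<dots> \<le> ennreal (M powr (P - 1)) * (\<integral>\<^sup>+y. ennreal (norm (?h y)) \<partial>lborel)"
    unfolding \<kappa>_def by (intro mult_left_mono box_fun_unit_gauss_L1 \<eta> a) auto
  also have "\<dots> = (\<integral>\<^sup>+y. ennreal (M powr (P - 1)) * ennreal (norm (?h y)) \<partial>lborel)"
    by (rule nn_integral_cmult[symmetric]) measurable
  also have "\<dots> \<le> (\<integral>\<^sup>+y. ennpow (ennreal (norm (?h y))) P \<partial>lborel)"
    by (intro nn_integral_mono) (auto simp: ennpow_ennreal ennreal_mult'[symmetric] intro!: ennreal_leI pt)
  also have "\<dots> = (\<integral>\<^sup>+y. ennpow (ennreal (norm (?h y))) P \<partial>lebesgue)"
    by (rule nn_integral_completion[symmetric])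
  finally have "ennpow (ennreal (X powr P)) (inverse P) \<le> ennpow (\<integral>\<^sup>+y. ennpow (ennreal (norm (?h y))) P \<partial>lebesgue) (inverse P)"
    using P by (intro ennpow_mono) auto
  moreover have "ennpow (ennreal (X powr P)) (inverse P) = ennreal X"
    using P X by (simp add: ennpow_ennreal powr_powr)
  ultimately have "ennreal X \<le> Lp_norm p ?h" using P by (simp add: Lp_norm_def)
  also have "\<dots> = box_norm p \<eta> (unit_gauss a)"
    unfolding box_op_eq_regular[OF \<eta>(1) fi]
    by (rule Lp_norm_distr_regular[symmetric]) (rule box_fun_representation[OF \<eta>(1) fi])+
  finally show ?thesis using a by blast
qed

section \<open>Power sums over the integer lattice\<close>

lemma bracket_ge1: "1 \<le> bracket k"
  by (simp add: bracket_def)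

lemma card_int_vec: "finite A \<Longrightarrow> finite {k::int^'n::finite. \<forall>i. k $ i \<in> A} \<and> card {k::int^'n. \<forall>i. k $ i \<in> A} = card A ^ CARD('n)"
proof -
  assume A: "finite A"
  have "bij_betw vec_nth {k::int^'n. \<forall>i. k $ i \<in> A} (PiE UNIV (\<lambda>_. A))"
    by (rule bij_betwI[where g = vec_lambda]) (auto simp: PiE_def)
  then show ?thesis
    using bij_betw_finite bij_betw_same_card finite_PiE[of UNIV "\<lambda>_::'n. A"] card_PiE[of UNIV "\<lambda>_::'n. A"] A
    by fastforce
qed

text \<open>Every factor \<open>1 + k\<^sub>i\<^sup>2\<close> is at most \<open>bracket(k)\<^sup>2\<close>, so \<open>bracket(k)\<^sup>t\<close> is at most the product of the powers
  \<open>(1 + k\<^sub>i\<^sup>2)\<^sup>r\<close> with \<open>r = t / (2 n) < - 1/2\<close>. Over a cube the sum of this product factorises into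
  convergent one-dimensional sums.\<close>

lemma lattice_sum_bounded:
  assumes t: "t < - real CARD('n::finite)"
  obtains M where "\<And>K :: (int^'n) set. finite K \<Longrightarrow> (\<Sum>k\<in>K. bracket k powr t) \<le> M"
proof -
  define n where "n = CARD('n)"
  have n: "n > 0" by (simp add: n_def)
  define r where "r = t / (2 * n)"
  have r: "r < -1/2" using t n by (simp add: r_def n_def field_simps)
  define w where "w j = (1 + real_of_int j ^ 2) powr r" for j
  have wnn: "w j \<ge> 0" for j by (simp add: w_def)
  have summ: "summable (\<lambda>m. real m powr (2 * r))"
    using r by (simp add: summable_real_powr_iff)
  define S where "S = 1 + 2 * (\<Sum>m. real m powr (2 * r))"
  have sum1: "(\<Sum>j\<in>{-int N..int N}. w j) \<le> S" for N
  proof -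
    have wle: "w j \<le> real (nat \<bar>j\<bar>) powr (2 * r)" if "j \<noteq> 0" for j
    proof -
      have "w j \<le> (real_of_int j ^ 2) powr r"
        unfolding w_def using r that by (intro powr_mono2') auto
      also have "\<dots> = (\<bar>real_of_int j\<bar> powr 2) powr r"
        using that by simp
      also have "\<dots> = \<bar>real_of_int j\<bar> powr (2 * r)" by (simp only: powr_powr)
      finally show ?thesis by simp
    qed
    have split: "{-int N..int N} = {0} \<union> int ` {1..N} \<union> (\<lambda>m. - int m) ` {1..N}"
    proof (intro equalityI subsetI)
      fix j assume "j \<in> {-int N..int N}"
      then show "j \<in> {0} \<union> int ` {1..N} \<union> (\<lambda>m. - int m) ` {1..N}"
        by (cases j rule: int_cases3) auto
    qed auto
    have "(\<Sum>j\<in>{-int N..int N}. w j) \<le> (\<Sum>j\<in>{0}. w j) + (\<Sum>j\<in>int ` {1..N}. w j) + (\<Sum>j\<in>(\<lambda>m. - int m) ` {1..N}. w j)"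
      unfolding split
      by (subst sum.union_disjoint, simp, simp, force)+ simp
    also have "\<dots> = 1 + (\<Sum>m\<in>{1..N}. w (int m)) + (\<Sum>m\<in>{1..N}. w (- int m))"
      by (simp add: sum.reindex inj_on_def w_def)
    also have "\<dots> \<le> 1 + (\<Sum>m\<in>{1..N}. real m powr (2 * r)) + (\<Sum>m\<in>{1..N}. real m powr (2 * r))"
    proof (intro add_mono sum_mono order_refl)
      fix m assume "m \<in> {1..N}"
      then show "w (int m) \<le> real m powr (2 * r)" "w (- int m) \<le> real m powr (2 * r)"
        using wle[of "int m"] wle[of "- int m"] by auto
    qed
    also have "\<dots> \<le> S"
      unfolding S_def using sum_le_suminf[OF summ, of "{1..N}"] by simp
    finally show ?thesis .
  qed
  have pw: "bracket k powr t \<le> (\<Prod>i\<in>UNIV. w (k $ i))" for k :: "int^'n"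
  proof -
    define P where "P = (\<Prod>i\<in>UNIV. 1 + real_of_int (k $ i) ^ 2)"
    have Ppos: "P > 0" unfolding P_def by (intro prod_pos) (auto intro: add_pos_nonneg)
    have "P \<le> (\<Prod>i\<in>(UNIV::'n set). (bracket k)\<^sup>2)"
      unfolding P_def
    proof (rule prod_mono)
      fix i
      have "\<bar>int_vec k $ i\<bar> \<le> norm (int_vec k)" by (rule component_le_norm_cart)
      then have "(int_vec k $ i)\<^sup>2 \<le> (norm (int_vec k))\<^sup>2" by (metis abs_ge_zero power2_abs power_mono)
      then show "0 \<le> 1 + (real_of_int (k $ i))\<^sup>2 \<and> 1 + (real_of_int (k $ i))\<^sup>2 \<le> (bracket k)\<^sup>2"
        by (simp add: bracket_def int_vec_def)
    qed
    also have "\<dots> = bracket k ^ (2 * n)" by (simp add: n_def power_mult)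
    also have "\<dots> = bracket k powr (2 * n)"
      using bracket_ge1[of k] by (intro powr_realpow[symmetric]) linarith
    finally have "(bracket k powr (2 * n)) powr r \<le> P powr r"
      using r Ppos by (intro powr_mono2') auto
    also have "P powr r = (\<Prod>i\<in>UNIV. w (k $ i))"
      unfolding P_def w_def by (rule prod_powr_distrib)
    finally show ?thesis using n by (simp add: powr_powr r_def)
  qed
  show thesis
  proof
    fix K :: "(int^'n) set" assume K: "finite K"
    define N where "N = nat (Max (insert 0 ((\<lambda>(k, i). \<bar>k $ i\<bar>) ` (K \<times> UNIV))))"
    have N: "\<bar>k $ i\<bar> \<le> int N" if "k \<in> K" for k i
    proof -
      have "\<bar>k $ i\<bar> \<le> Max (insert 0 ((\<lambda>(k, i). \<bar>k $ i\<bar>) ` (K \<times> UNIV)))"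
        using K that by (intro Max_ge) auto
      moreover have "0 \<le> Max (insert 0 ((\<lambda>(k, i). \<bar>k $ i\<bar>) ` (K \<times> UNIV)))"
        using K by (intro Max_ge) auto
      ultimately show ?thesis by (simp add: N_def)
    qed
    let ?A = "{-int N..int N}"
    have bij: "bij_betw vec_lambda (PiE UNIV (\<lambda>_::'n. ?A)) {k::int^'n. \<forall>i. k $ i \<in> ?A}"
      by (rule bij_betwI[where g = vec_nth]) (auto simp: PiE_def)
    have "(\<Sum>k\<in>K. bracket k powr t) \<le> (\<Sum>k\<in>K. \<Prod>i\<in>UNIV. w (k $ i))"
      by (intro sum_mono pw)
    also have "\<dots> \<le> (\<Sum>k\<in>{k::int^'n. \<forall>i. k $ i \<in> ?A}. \<Prod>i\<in>UNIV. w (k $ i))"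
    proof (rule sum_mono2)
      show "finite {k::int^'n. \<forall>i. k $ i \<in> ?A}" using card_int_vec[of ?A] by blast
      show "K \<subseteq> {k. \<forall>i. k $ i \<in> ?A}"
      proof (intro subsetI CollectI allI)
        fix k :: "int^'n" and i assume "k \<in> K"
        then show "k $ i \<in> ?A" using N[of k i] by auto
      qed
    qed (auto intro: prod_nonneg wnn)
    also have "\<dots> = (\<Sum>f\<in>PiE UNIV (\<lambda>_::'n. ?A). \<Prod>i\<in>UNIV. w (f i))"
      by (subst sum.reindex_bij_betw[OF bij, symmetric]) simp
    also have "\<dots> = (\<Prod>i\<in>(UNIV::'n set). \<Sum>j\<in>?A. w j)"
      by (rule prod_sum_PiE[symmetric]) auto
    also have "\<dots> \<le> (\<Prod>i\<in>(UNIV::'n set). S)"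
      by (intro prod_mono conjI sum1 sum_nonneg wnn)
    also have "\<dots> = S ^ n" by (simp add: n_def)
    finally show "(\<Sum>k\<in>K. bracket k powr t) \<le> S ^ n" .
  qed
qed

text \<open>Dyadic cubes in the positive orthant: pairwise disjoint, with \<open>2\<^sup>m\<^sup>n\<close> points of size comparable to \<open>2\<^sup>m\<close>.\<close>

definition shell :: "nat \<Rightarrow> (int^'n::finite) set" where
  "shell m = {k. \<forall>i. k $ i \<in> {2 ^ m..<2 ^ Suc m}}"

text \<open>Each dyadic shell contributes at least one fixed amount \<open>c\<close> already for the exponent \<open>- n\<close>, because its
  cardinality compensates the decay.\<close>

lemma lattice_sum_unbounded:
  assumes t: "- real CARD('n::finite) \<le> t" and bd: "\<And>K :: (int^'n) set. finite K \<Longrightarrow> (\<Sum>k\<in>K. bracket k powr t) \<le> M"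
  shows False
proof -
  define n where "n = CARD('n)"
  define c where "c = (2 * sqrt (1 + real n)) powr (- real n)"
  have c: "c > 0" unfolding c_def by (simp add: add_pos_nonneg)
  have fin: "finite (shell m :: (int^'n) set)" and card: "card (shell m :: (int^'n) set) = (2 ^ m) ^ n" for m
    using card_int_vec[of "{2 ^ m..<2 ^ Suc m}", where 'n='n] by (auto simp: shell_def n_def nat_power_eq)
  have br: "bracket k \<le> 2 * sqrt (1 + real n) * 2 ^ m" if "k \<in> shell m" for k :: "int^'n" and m
  proof -
    have "(norm (int_vec k))\<^sup>2 = (\<Sum>i\<in>UNIV. (real_of_int (k $ i))\<^sup>2)"
      by (simp only: power2_norm_eq_inner inner_vec_def) (simp add: int_vec_def power2_eq_square)
    also have "\<dots> \<le> (\<Sum>i\<in>(UNIV::'n set). (2 * 2 ^ m)\<^sup>2)"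
    proof (intro sum_mono power_mono)
      fix i
      have "2 ^ m \<le> k $ i" "k $ i < 2 ^ Suc m" using that by (auto simp: shell_def)
      then show "0 \<le> real_of_int (k $ i)" "real_of_int (k $ i) \<le> 2 * 2 ^ m"
        by (smt (verit) of_int_0_le_iff zero_le_power) 
          (metis \<open>k $ i < 2 ^ Suc m\<close> less_imp_le of_int_le_iff of_int_numeral of_int_power power_Suc)
    qed
    also have "\<dots> = real n * (2 * 2 ^ m)\<^sup>2" by (simp add: n_def)
    finally have nb: "(norm (int_vec k))\<^sup>2 \<le> real n * (2 * 2 ^ m)\<^sup>2" .
    have "1 + (norm (int_vec k))\<^sup>2 \<le> (1 + real n) * (2 * 2 ^ m)\<^sup>2"
    proof -
      have "(1::real) \<le> 2 * 2 ^ m" by (simp add: add_increasing2 order_trans[OF one_le_power[of 2 m]])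
      then have "(1::real) \<le> (2 * 2 ^ m)\<^sup>2" by (rule one_le_power)
      then show ?thesis using nb by (simp add: distrib_right)
    qed
    then have "bracket k \<le> sqrt ((1 + real n) * (2 * 2 ^ m)\<^sup>2)"
      unfolding bracket_def by (rule real_sqrt_le_mono)
    also have "\<dots> = 2 * sqrt (1 + real n) * 2 ^ m" by (simp add: real_sqrt_mult)
    finally show ?thesis .
  qed
  have shell_sum: "c \<le> (\<Sum>k\<in>(shell m :: (int^'n) set). bracket k powr t)" for m
  proof -
    have "c = (\<Sum>k\<in>(shell m :: (int^'n) set). (2 * sqrt (1 + real n) * 2 ^ m) powr (- real n))"
    proof -
      have "(2 * sqrt (1 + real n) * 2 ^ m) powr (- real n) = c * (2 ^ m) powr (- real n)"
        unfolding c_def by (rule powr_mult)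
      moreover have "(2 ^ m :: real) powr (- real n) = inverse ((2 ^ m) ^ n)"
        by (simp add: powr_minus powr_realpow)
      ultimately have "(2 * sqrt (1 + real n) * 2 ^ m) powr (- real n) * (2 ^ m) ^ n = c" by simp
      then show ?thesis by (simp add: card mult.commute)
    qed
    also have "\<dots> \<le> (\<Sum>k\<in>(shell m :: (int^'n) set). bracket k powr t)"
    proof (rule sum_mono)
      fix k :: "int^'n" assume "k \<in> shell m"
      have "(2 * sqrt (1 + real n) * 2 ^ m) powr (- real n) \<le> bracket k powr (- real n)"
        using br[OF \<open>k \<in> shell m\<close>] bracket_ge1[of k] by (intro powr_mono2') auto
      also have "\<dots> \<le> bracket k powr t"
        using t bracket_ge1[of k] by (intro powr_mono) (auto simp: n_def)
      finally show "(2 * sqrt (1 + real n) * 2 ^ m) powr (- real n) \<le> bracket k powr t" .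
    qed
    finally show ?thesis .
  qed
  have disj: "shell m \<inter> shell m' = ({} :: (int^'n) set)" if "m < m'" for m m'
  proof -
    have "(2::int) ^ Suc m \<le> 2 ^ m'" using that by (intro power_increasing) auto
    moreover have "k $ i < 2 ^ Suc m" "2 ^ m' \<le> k $ i" if "k \<in> shell m \<inter> shell m'" for k :: "int^'n" and i
      using that by (auto simp: shell_def)
    ultimately show ?thesis by (meson equals0I leD less_le_trans)
  qed
  have "real J * c \<le> M" for J
  proof -
    have "real J * c = (\<Sum>m<J. c)" by simp
    also have "\<dots> \<le> (\<Sum>m<J. \<Sum>k\<in>(shell m :: (int^'n) set). bracket k powr t)"
      by (intro sum_mono shell_sum)
    also have "\<dots> = (\<Sum>k\<in>(\<Union>m<J. shell m :: (int^'n) set). bracket k powr t)"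
      using disj by (intro sum.UNION_disjoint[symmetric]) (auto simp: fin, metis disjoint_iff linorder_neqE_nat)
    also have "\<dots> \<le> M" by (intro bd finite_UN_I fin) auto
    finally show ?thesis .
  qed
  moreover obtain J where "M < real J * c" using reals_Archimedean3[OF c] by blast
  ultimately show False by (meson not_le)
qed

lemma bracket_unbounded:
  assumes t: "t > 0" and bd: "\<And>k :: int^'n::finite. bracket k powr t \<le> M"
  shows False
proof -
  obtain j where j: "max M 1 powr (1 / t) < real j" using reals_Archimedean2 by blast
  define k :: "int^'n" where "k = (\<chi> i. int j)"
  have "real j \<le> norm (int_vec k)"
    using component_le_norm_cart[of "int_vec k"] by (simp add: k_def int_vec_def)
  also have "\<dots> \<le> bracket k"
    unfolding bracket_def by (rule real_le_rsqrt) simp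
  finally have "max M 1 powr (1 / t) < bracket k" using j by linarith
  then have "(max M 1 powr (1 / t)) powr t < bracket k powr t"
    using t by (intro powr_less_mono2) auto
  then show False using bd[of k] t by (simp add: powr_powr)
qed

section \<open>Integrable functions as distributions\<close>

lemma integrable_times_schwartz:
  assumes "integrable M f" "\<phi> \<in> schwartz" "\<phi> \<in> borel_measurable M"
  shows "integrable M (\<lambda>x. f x * \<phi> x)"
proof -
  obtain B where B: "B > 0" "\<And>x. norm (\<phi> x) \<le> B" using schwartz_bounded[OF assms(2)] by blast
  have [measurable]: "f \<in> borel_measurable M" "\<phi> \<in> borel_measurable M" using assms by auto
  show ?thesis
    by (rule Bochner_Integration.integrable_bound[OF integrable_mult_left[OF assms(1), of "of_real B"]])
      (use B in \<open>auto simp: norm_mult intro!: AE_I2 mult_left_mono\<close>)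
qed

lemma schwartz_lebesgue_measurable: "\<phi> \<in> schwartz \<Longrightarrow> \<phi> \<in> borel_measurable lebesgue"
  using schwartz_borel[of \<phi>] by (simp add: measurable_completion)

text \<open>Integrable functions are given with respect to the completed measure; passing to a Borel version makes
  product measures and Fubini available.\<close>

lemma L1_space_borel:
  fixes T :: "('n::finite) functional"
  assumes "T \<in> L1_space"
  obtains f where "integrable lborel f" "T = regular_distr f"
proof -
  obtain g :: "real^'n \<Rightarrow> complex" where g: "integrable lebesgue g" "T = regular_distr g"
    using assms by (auto simp: L1_space_def)
  obtain f where f: "f \<in> borel_measurable borel" "AE x in lborel. g x = f x"
    using borel_version[OF borel_measurable_integrable[OF g(1)]] .
  have f': "f \<in> borel_measurable lborel" "f \<in> borel_measurable lebesgue"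
    using f(1) by (simp_all add: measurable_completion)
  have ae: "AE x in lebesgue. g x = f x" using f(2) by (rule AE_completion)
  have "integrable lebesgue f" by (rule integrable_cong_AE_imp[OF g(1) f'(2)]) (use ae in \<open>auto elim: eventually_mono\<close>)
  then have "integrable lborel f" using integrable_completion[OF f'(1)] by blast
  moreover have "T = regular_distr f"
    unfolding g(2) regular_distr_def
  proof (intro restrict_ext integral_cong_AE)
    fix \<phi> :: "real^'n \<Rightarrow> complex" assume \<phi>: "\<phi> \<in> schwartz"
    note [measurable] = schwartz_lebesgue_measurable[OF \<phi>] f'(2) borel_measurable_integrable[OF g(1)]
    show "(\<lambda>x. g x * \<phi> x) \<in> borel_measurable lebesgue" "(\<lambda>x. f x * \<phi> x) \<in> borel_measurable lebesgue"
      by measurable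
    show "AE x in lebesgue. g x * \<phi> x = f x * \<phi> x" using ae by eventually_elim simp
  qed
  ultimately show thesis using that by blast
qed

lemma integrable_lebesgueI:
  fixes f :: "real^'n::finite \<Rightarrow> complex"
  shows "integrable lborel f \<Longrightarrow> integrable lebesgue f"
  using integrable_completion[of f lborel] by auto

lemma regular_distr_L1_space: "integrable lborel f \<Longrightarrow> regular_distr f \<in> L1_space"
  unfolding L1_space_def using integrable_lebesgueI by blast

lemma Lp_norm_distr_1_regular:
  fixes f :: "real^'n::finite \<Rightarrow> complex"
  assumes "integrable lborel f"
  shows "Lp_norm_distr 1 (regular_distr f) = ennreal (L1_norm f)"
proof -
  have i: "integrable lebesgue f" using assms by (rule integrable_lebesgueI)
  have "Lp_norm_distr 1 (regular_distr f) = Lp_norm 1 f"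
    using i by (intro Lp_norm_distr_regular)
      (auto intro!: integrable_times_schwartz schwartz_lebesgue_measurable)
  also have "\<dots> = (\<integral>\<^sup>+x. ennreal (norm (f x)) \<partial>lborel)"
    by (simp add: Lp_norm_def ennpow_def nn_integral_completion ennreal_enn2real_if)
  also have "\<dots> = ennreal (L1_norm f)"
    using assms by (intro nn_integral_eq_integral) auto
  finally show ?thesis .
qed

text \<open>The seminorm of order zero, the supremum of \<open>|\<phi>|\<close>, already controls the pairing with an integrable
  function.\<close>

lemma regular_distr_tempered:
  fixes f :: "real^'n::finite \<Rightarrow> complex"
  assumes "integrable lborel f"
  shows "regular_distr f \<in> tempered"
proof -
  have i: "integrable lebesgue (\<lambda>x. f x * \<phi> x)" if "\<phi> \<in> schwartz" for \<phi>
    using assms that by (intro integrable_times_schwartz integrable_lebesgueI schwartz_lebesgue_measurable)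
  have bd: "norm (regular_distr f \<phi>) \<le> (\<integral>x. norm (f x) \<partial>lebesgue) * schwartz_seminorm 0 \<phi>"
    if \<phi>: "\<phi> \<in> schwartz" for \<phi>
  proof -
    obtain B where "\<And>x. norm (\<phi> x) \<le> B" using schwartz_bounded[OF \<phi>] by blast
    then have "norm (\<phi> x) \<le> schwartz_seminorm 0 \<phi>" for x
      unfolding schwartz_seminorm_def by (intro cSup_upper bdd_aboveI[of _ B]) (auto simp: partial_derivs_def)
    then have le: "norm (f x * \<phi> x) \<le> norm (f x) * schwartz_seminorm 0 \<phi>" for x
      by (simp add: norm_mult mult_left_mono)
    have "norm (\<integral>x. f x * \<phi> x \<partial>lebesgue) \<le> (\<integral>x. norm (f x) * schwartz_seminorm 0 \<phi> \<partial>lebesgue)"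
      by (rule Bochner_Integration.integral_norm_bound_integral[OF i[OF \<phi>] _ le])
        (intro integrable_mult_left integrable_norm integrable_lebesgueI assms)
    then show ?thesis using \<phi> by (simp add: regular_distr_def)
  qed
  show ?thesis
    unfolding tempered_def
  proof (intro CollectI conjI ballI allI exI)
    show "regular_distr f \<in> extensional schwartz" by (simp add: regular_distr_def)
    fix \<phi> \<psi> :: "real^'n \<Rightarrow> complex" and c
    assume \<phi>: "\<phi> \<in> schwartz"
    show "regular_distr f (\<lambda>x. c * \<phi> x) = c * regular_distr f \<phi>"
      using schwartz_scale[OF \<phi>] \<phi> by (simp add: regular_distr_def mult.left_commute)
    show "norm (regular_distr f \<phi>) \<le> (\<integral>x. norm (f x) \<partial>lebesgue) * schwartz_seminorm 0 \<phi>" by (rule bd[OF \<phi>])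
    assume \<psi>: "\<psi> \<in> schwartz"
    show "regular_distr f (\<lambda>x. \<phi> x + \<psi> x) = regular_distr f \<phi> + regular_distr f \<psi>"
      using schwartz_add[OF \<phi> \<psi>] \<phi> \<psi> i by (simp add: regular_distr_def distrib_left)
  qed
qed

section \<open>Bounds for modulation norms\<close>

lemma modulation_norm_infinity_lower:
  assumes "ennreal m \<le> Lp_norm_distr p (box_op (\<eta> k) T)"
  shows "ennreal (bracket k powr (s / (1 - \<alpha>)) * m) \<le> modulation_norm \<eta> s \<alpha> p \<infinity> T"
proof -
  have "ennreal (bracket k powr (s / (1 - \<alpha>)) * m) \<le> ennreal (bracket k powr (s / (1 - \<alpha>))) * Lp_norm_distr p (box_op (\<eta> k) T)"
    using assms by (simp add: ennreal_mult' mult_left_mono)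
  also have "\<dots> \<le> modulation_norm \<eta> s \<alpha> p \<infinity> T"
    unfolding modulation_norm_def if_P[OF refl] by (rule SUP_upper) simp
  finally show ?thesis .
qed

lemma modulation_norm_infinity_upper:
  assumes "\<And>k. Lp_norm_distr p (box_op (\<eta> k) T) \<le> ennreal (m k)"
    and "\<And>k. bracket k powr (s / (1 - \<alpha>)) * m k \<le> B"
  shows "modulation_norm \<eta> s \<alpha> p \<infinity> T \<le> ennreal B"
proof -
  have "ennreal (bracket k powr (s / (1 - \<alpha>))) * Lp_norm_distr p (box_op (\<eta> k) T) \<le> ennreal B" for k
  proof -
    have "ennreal (bracket k powr (s / (1 - \<alpha>))) * Lp_norm_distr p (box_op (\<eta> k) T) \<le>
        ennreal (bracket k powr (s / (1 - \<alpha>))) * ennreal (m k)"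
      by (intro mult_left_mono assms) auto
    also have "\<dots> = ennreal (bracket k powr (s / (1 - \<alpha>)) * m k)" by (simp add: ennreal_mult')
    also have "\<dots> \<le> ennreal B" by (intro ennreal_leI assms)
    finally show ?thesis .
  qed
  then show ?thesis unfolding modulation_norm_def if_P[OF refl] by (rule SUP_least)
qed

lemma modulation_norm_finite:
  assumes "Q > 0"
  shows "modulation_norm \<eta> s \<alpha> p (ennreal Q) T =
    ennpow (\<Sum>\<^sub>\<infinity>k. ennreal (bracket k powr (s / (1 - \<alpha>) * Q)) * ennpow (Lp_norm_distr p (box_op (\<eta> k) T)) Q) (inverse Q)"
  using assms by (simp add: modulation_norm_def recip_ennreal)

lemma modulation_norm_lower:
  assumes Q: "Q > 0" and K: "finite K" and m: "\<And>k. k \<in> K \<Longrightarrow> 0 \<le> m k"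
    "\<And>k. k \<in> K \<Longrightarrow> ennreal (m k) \<le> Lp_norm_distr p (box_op (\<eta> k) T)"
  shows "ennreal ((\<Sum>k\<in>K. (bracket k powr (s / (1 - \<alpha>)) * m k) powr Q) powr inverse Q)
    \<le> modulation_norm \<eta> s \<alpha> p (ennreal Q) T"
proof -
  let ?a = "\<lambda>k. ennreal (bracket k powr (s / (1 - \<alpha>) * Q)) * ennpow (Lp_norm_distr p (box_op (\<eta> k) T)) Q"
  have "ennreal (\<Sum>k\<in>K. (bracket k powr (s / (1 - \<alpha>)) * m k) powr Q) =
      (\<Sum>k\<in>K. ennreal ((bracket k powr (s / (1 - \<alpha>)) * m k) powr Q))"
    by (rule sum_ennreal[symmetric]) simp
  also have "\<dots> \<le> (\<Sum>k\<in>K. ?a k)"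
  proof (rule sum_mono)
    fix k assume k: "k \<in> K"
    have "ennreal ((bracket k powr (s / (1 - \<alpha>)) * m k) powr Q) = ennreal (bracket k powr (s / (1 - \<alpha>) * Q)) * ennpow (ennreal (m k)) Q"
      using m(1)[OF k] by (simp add: powr_mult powr_powr ennpow_ennreal ennreal_mult')
    also have "\<dots> \<le> ?a k" using Q by (intro mult_left_mono ennpow_mono m k) auto
    finally show "ennreal ((bracket k powr (s / (1 - \<alpha>)) * m k) powr Q) \<le> ?a k" .
  qed
  also have "\<dots> \<le> infsum ?a UNIV"
    by (subst nonneg_infsum_complete) (auto intro!: SUP_upper K)
  finally have "ennpow (ennreal (\<Sum>k\<in>K. (bracket k powr (s / (1 - \<alpha>)) * m k) powr Q)) (inverse Q) \<le> ennpow (infsum ?a UNIV) (inverse Q)"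
    using Q by (intro ennpow_mono) auto
  then show ?thesis using Q by (simp add: modulation_norm_finite ennpow_ennreal sum_nonneg)
qed

lemma modulation_norm_upper:
  assumes Q: "Q > 0" and m: "\<And>k. 0 \<le> m k" "\<And>k. Lp_norm_distr p (box_op (\<eta> k) T) \<le> ennreal (m k)"
    and B: "\<And>K. finite K \<Longrightarrow> (\<Sum>k\<in>K. (bracket k powr (s / (1 - \<alpha>)) * m k) powr Q) \<le> B"
  shows "modulation_norm \<eta> s \<alpha> p (ennreal Q) T \<le> ennreal (B powr inverse Q)"
proof -
  let ?a = "\<lambda>k. ennreal (bracket k powr (s / (1 - \<alpha>) * Q)) * ennpow (Lp_norm_distr p (box_op (\<eta> k) T)) Q"
  have B0: "B \<ge> 0" using B[of "{}"] by simp
  have "infsum ?a UNIV \<le> ennreal B"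
  proof (rule infsum_le_finite_sums)
    show "?a summable_on UNIV" by (rule nonneg_summable_on_complete) simp
    fix K :: "(int^'a) set" assume K: "finite K"
    have "(\<Sum>k\<in>K. ?a k) \<le> (\<Sum>k\<in>K. ennreal ((bracket k powr (s / (1 - \<alpha>)) * m k) powr Q))"
    proof (rule sum_mono)
      fix k
      have "?a k \<le> ennreal (bracket k powr (s / (1 - \<alpha>) * Q)) * ennpow (ennreal (m k)) Q"
        using Q by (intro mult_left_mono ennpow_mono m) auto
      also have "\<dots> = ennreal ((bracket k powr (s / (1 - \<alpha>)) * m k) powr Q)"
        using m(1) by (simp add: powr_mult powr_powr ennpow_ennreal ennreal_mult')
      finally show "?a k \<le> ennreal ((bracket k powr (s / (1 - \<alpha>)) * m k) powr Q)" .
    qed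
    also have "\<dots> = ennreal (\<Sum>k\<in>K. (bracket k powr (s / (1 - \<alpha>)) * m k) powr Q)"
      by (rule sum_ennreal) simp
    also have "\<dots> \<le> ennreal B" by (intro ennreal_leI B K)
    finally show "(\<Sum>k\<in>K. ?a k) \<le> ennreal B" .
  qed
  then have "ennpow (infsum ?a UNIV) (inverse Q) \<le> ennpow (ennreal B) (inverse Q)"
    using Q by (intro ennpow_mono) auto
  then show ?thesis using Q B0 by (simp add: modulation_norm_finite ennpow_ennreal)
qed

text \<open>The terms of the minimum are \<open>0\<close>, \<open>- n/q\<close> and \<open>n (1 - 1/q)\<close>, of which the second is the least.\<close>

lemma A_index_1: "q > 0 \<Longrightarrow> A_index n 1 q = - (real n * recip q)"
proof -
  have "recip q \<ge> 0" by (simp add: recip_def)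
  then have "0 \<le> real n * recip q" by simp
  then show ?thesis by (simp add: A_index_def algebra_simps min_def)
qed

section \<open>Decompositions\<close>

text \<open>The common order of magnitude of the radii of the \<open>k\<close>-th frequency ball, and the factor by which its
  centre is stretched relative to the lattice point \<open>k\<close>.\<close>

definition side :: "real \<Rightarrow> int^'n::finite \<Rightarrow> real" where
  "side \<alpha> k = bracket k powr (\<alpha> / (1 - \<alpha>))"

lemma side_pos: "side \<alpha> k > 0"
  using bracket_ge1[of k] by (simp add: side_def)

lemma side_power: "bracket k powr (- (\<alpha> * real m / (1 - \<alpha>))) = 1 / side \<alpha> k ^ m"
  using bracket_ge1[of k] side_pos[of \<alpha> k]
  by (simp add: side_def powr_realpow[symmetric] powr_powr powr_minus_divide)

text \<open>What the estimates for the box operators use of a decomposition: one constant \<open>D\<close> for the orders zero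
  and \<open>2 n\<close> of differentiation, and a Lipschitz constant for \<open>\<eta>\<^sub>k\<close> of order \<open>1 / R\<^sub>k\<close> obtained from the first-order
  bounds.\<close>

lemma alpha_decomposition_bounds:
  fixes \<eta> :: "int^'n::finite \<Rightarrow> real^'n \<Rightarrow> complex"
  assumes "alpha_decomposition \<alpha> \<eta>"
  obtains c D L where "\<And>k. \<eta> k \<in> schwartz" "c > 0" "D \<ge> 0" "L \<ge> 0"
    "\<And>k. 1 \<le> norm (\<eta> k (side \<alpha> k *\<^sub>R int_vec k))"
    "\<And>k. closure {\<xi>. \<eta> k \<xi> \<noteq> 0} \<subseteq> ball (side \<alpha> k *\<^sub>R int_vec k) (c * side \<alpha> k)"
    "\<And>k \<xi>. norm (\<eta> k \<xi>) \<le> D"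
    "\<And>k j \<xi>. norm (partial_derivs (replicate (2 * CARD('n)) j) (\<eta> k) \<xi>) \<le> D / side \<alpha> k ^ (2 * CARD('n))"
    "\<And>k \<xi>. norm (\<eta> k \<xi> - \<eta> k (side \<alpha> k *\<^sub>R int_vec k)) \<le> L / side \<alpha> k * norm (\<xi> - side \<alpha> k *\<^sub>R int_vec k)"
proof -
  note ad = assms[unfolded alpha_decomposition_def, folded side_def]
  have \<eta>: "\<eta> k \<in> schwartz" for k using ad by blast
  obtain c0 where c0: "c0 > 0" "\<And>k \<xi>. norm (\<xi> - side \<alpha> k *\<^sub>R int_vec k) < c0 * side \<alpha> k \<Longrightarrow> 1 \<le> norm (\<eta> k \<xi>)"
    using ad by blast
  have one: "1 \<le> norm (\<eta> k (side \<alpha> k *\<^sub>R int_vec k))" for k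
    using c0 side_pos[of \<alpha> k] by (intro c0(2)) simp
  obtain c where c: "c > 0" "\<And>k. closure {\<xi>. \<eta> k \<xi> \<noteq> 0} \<subseteq> {\<xi>. norm (\<xi> - side \<alpha> k *\<^sub>R int_vec k) < c * side \<alpha> k}"
    using ad by blast
  have supp: "closure {\<xi>. \<eta> k \<xi> \<noteq> 0} \<subseteq> ball (side \<alpha> k *\<^sub>R int_vec k) (c * side \<alpha> k)" for k
    using c(2)[of k] by (auto simp: ball_def dist_norm norm_minus_commute)
  have "\<forall>\<gamma>. \<exists>C. \<forall>\<xi> k. norm (partial_derivs \<gamma> (\<eta> k) \<xi>) \<le> C * bracket k powr (- (\<alpha> * real (length \<gamma>) / (1 - \<alpha>)))"
    using ad by blast
  then obtain E where E: "\<And>\<gamma> \<xi> k. norm (partial_derivs \<gamma> (\<eta> k) \<xi>) \<le> E \<gamma> * bracket k powr (- (\<alpha> * real (length \<gamma>) / (1 - \<alpha>)))"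
    by metis
  have E: "norm (partial_derivs \<gamma> (\<eta> k) \<xi>) \<le> E \<gamma> / side \<alpha> k ^ length \<gamma>" for \<gamma> \<xi> k
    using E[of \<gamma> k \<xi>] by (simp add: side_power)
  define D where "D = \<bar>E []\<bar> + (\<Sum>j\<in>UNIV. \<bar>E (replicate (2 * CARD('n)) (j::'n))\<bar>)"
  have D0: "D \<ge> 0" by (simp add: D_def sum_nonneg)
  have D1: "norm (\<eta> k \<xi>) \<le> D" for k \<xi>
    using E[of "[]" k \<xi>] by (simp add: partial_derivs_def D_def add_increasing2 sum_nonneg)
  have D2: "norm (partial_derivs (replicate (2 * CARD('n)) j) (\<eta> k) \<xi>) \<le> D / side \<alpha> k ^ (2 * CARD('n))" for k j \<xi>
  proof -
    have "\<bar>E (replicate (2 * CARD('n)) j)\<bar> \<le> (\<Sum>j\<in>UNIV. \<bar>E (replicate (2 * CARD('n)) (j::'n))\<bar>)"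
      by (rule member_le_sum) auto
    then have "E (replicate (2 * CARD('n)) j) \<le> D" by (simp add: D_def)
    then have "E (replicate (2 * CARD('n)) j) / side \<alpha> k ^ (2 * CARD('n)) \<le> D / side \<alpha> k ^ (2 * CARD('n))"
      using side_pos[of \<alpha> k] by (intro divide_right_mono) auto
    then show ?thesis using E[of "replicate (2 * CARD('n)) j" k \<xi>] by simp
  qed
  have lip: "norm (\<eta> k \<xi> - \<eta> k \<xi>') \<le> (\<Sum>j\<in>UNIV. \<bar>E [j]\<bar>) / side \<alpha> k * norm (\<xi> - \<xi>')" for k \<xi> \<xi>'
  proof -
    have "norm (partial_deriv j (\<eta> k) \<xi>) \<le> \<bar>E [j]\<bar> / side \<alpha> k" for j \<xi>
      using E[of "[j]" k \<xi>] side_pos[of \<alpha> k]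
      by (intro order_trans[OF _ divide_right_mono[OF abs_ge_self]]) (auto simp: partial_derivs_def)
    from lipschitz_of_partial_deriv_bound[OF \<eta> this] show ?thesis
      by (simp add: sum_divide_distrib)
  qed
  show thesis
    by (rule that[OF \<eta> c(1) D0 _ one supp D1 D2 lip]) (simp add: sum_nonneg)
qed

theorem theorem1p3:
  fixes \<alpha> s :: real and p q :: ennreal
    and \<eta> :: "int^'n::finite \<Rightarrow> real^'n \<Rightarrow> complex"
  assumes "0 \<le> \<alpha>" and "\<alpha> < 1" and "0 < p" and "0 < q"
    and "alpha_decomposition \<alpha> \<eta>"
  shows "embedded L1_space (Lp_norm_distr 1)
           (modulation_space \<eta> s \<alpha> p q) (modulation_norm \<eta> s \<alpha> p q) \<longleftrightarrow>
         recip p \<le> 1 \<and>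
         s \<le> real CARD('n) * \<alpha> * (recip p - 1) + (1 - \<alpha>) * A_index CARD('n) 1 q \<and>
         (q < \<infinity> \<longrightarrow>
            s < real CARD('n) * \<alpha> * (recip p - 1) + (1 - \<alpha>) * A_index CARD('n) 1 q)"
    (is "?emb \<longleftrightarrow> _")
proof -
  let ?n = "CARD('n)" and ?r = "recip p"
  let ?\<xi> = "\<lambda>k. side \<alpha> k *\<^sub>R int_vec k :: real^'n"
  obtain c D L where \<eta>: "\<And>k. \<eta> k \<in> schwartz" and c: "c > 0" and D: "D \<ge> 0" and L: "L \<ge> 0"
    and one: "\<And>k. 1 \<le> norm (\<eta> k (?\<xi> k))"
    and supp: "\<And>k. closure {\<xi>. \<eta> k \<xi> \<noteq> 0} \<subseteq> ball (?\<xi> k) (c * side \<alpha> k)"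
    and D0: "\<And>k \<xi>. norm (\<eta> k \<xi>) \<le> D"
    and Dn: "\<And>k j \<xi>. norm (partial_derivs (replicate (2 * ?n) j) (\<eta> k) \<xi>) \<le> D / side \<alpha> k ^ (2 * ?n)"
    and lip: "\<And>k \<xi>. norm (\<eta> k \<xi> - \<eta> k (?\<xi> k)) \<le> L / side \<alpha> k * norm (\<xi> - ?\<xi> k)"
    by (rule alpha_decomposition_bounds[OF assms(5)]) (rule that; assumption)
  \<comment> \<open>the exponent of the bracket when the weight is combined with the norm of the box operator\<close>
  define t where "t = (s + ?n * \<alpha> * (1 - ?r)) / (1 - \<alpha>)"
  have expo: "bracket k powr (s / (1 - \<alpha>)) * (x * side \<alpha> k powr (?n * (1 - ?r))) = x * bracket k powr t" for x and k :: "int^'n"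
  proof -
    have "s / (1 - \<alpha>) + \<alpha> / (1 - \<alpha>) * (?n * (1 - ?r)) = t"
      by (simp add: t_def add_divide_distrib mult_ac)
    then show ?thesis by (simp add: side_def powr_powr powr_add[symmetric] mult_ac)
  qed
  \<comment> \<open>every element of the source space has a Borel representative, and its norm is the integral of the modulus\<close>
  have emb_iff: "?emb \<longleftrightarrow> (\<exists>C\<ge>0. \<forall>f. integrable lborel f \<longrightarrow>
      modulation_norm \<eta> s \<alpha> p q (regular_distr f) \<le> ennreal (C * L1_norm f))" (is "_ \<longleftrightarrow> ?bounded")
  proof
    assume ?emb
    then obtain C where C: "\<And>T. T \<in> L1_space \<Longrightarrow> modulation_norm \<eta> s \<alpha> p q T \<le> ennreal C * Lp_norm_distr 1 T"
      unfolding embedded_def by blast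
    have "modulation_norm \<eta> s \<alpha> p q (regular_distr f) \<le> ennreal (max C 0 * L1_norm f)"
      if f: "integrable lborel f" for f
    proof -
      have "ennreal C = ennreal (max C 0)" by (simp add: max_def ennreal_neg)
      then show ?thesis
        using C[OF regular_distr_L1_space[OF f]] by (simp add: Lp_norm_distr_1_regular[OF f] ennreal_mult')
    qed
    then show ?bounded
      by (intro exI[of _ "max C 0"]) auto
  next
    assume ?bounded
    then obtain C where C: "C \<ge> 0" "\<And>f. integrable lborel f \<Longrightarrow>
        modulation_norm \<eta> s \<alpha> p q (regular_distr f) \<le> ennreal (C * L1_norm f)"
      by blast
    have "T \<in> modulation_space \<eta> s \<alpha> p q \<and> modulation_norm \<eta> s \<alpha> p q T \<le> ennreal C * Lp_norm_distr 1 T"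
      if T: "T \<in> L1_space" for T
    proof -
      obtain f where f: "integrable lborel f" "T = regular_distr f" using L1_space_borel[OF T] .
      have "modulation_norm \<eta> s \<alpha> p q T < \<infinity>"
        using C(2)[OF f(1)] f(2) by (auto intro: le_less_trans)
      then show ?thesis
        using C(1) C(2)[OF f(1)] regular_distr_tempered[OF f(1)]
        by (simp add: modulation_space_def f(2) Lp_norm_distr_1_regular[OF f(1)] ennreal_mult)
    qed
    then show ?emb unfolding embedded_def by blast
  qed
  show ?thesis
  proof
    assume ?emb
    then obtain C where C: "C \<ge> 0" "\<And>f. integrable lborel f \<Longrightarrow>
        modulation_norm \<eta> s \<alpha> p q (regular_distr f) \<le> ennreal (C * L1_norm f)"
      unfolding emb_iff by blast
    have Ca: "modulation_norm \<eta> s \<alpha> p q (regular_distr (unit_gauss a)) \<le> ennreal C" if "a > 0" for a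
      using C(2)[OF schwartz_integrable[OF schwartz_unit_gauss[OF that]]] integral_norm_unit_gauss[OF that, where 'n='n] by simp
    have r: "?r \<le> 1"
    proof (rule ccontr)
      \<comment> \<open>at the lattice point zero the weight is one, so this single block already bounds the modulation norm from below\<close>
      assume "\<not> ?r \<le> 1"
      moreover have b0: "bracket (0::int^'n) = 1" "int_vec (0::int^'n) = 0"
        by (auto simp: bracket_def int_vec_def vec_eq_iff norm_eq_zero)
      moreover have "\<eta> 0 0 \<noteq> 0" using one[of 0] b0(2) by auto
      ultimately obtain a where a: "a > 0" "ennreal (C + 1) \<le> box_norm p (\<eta> 0) (unit_gauss a)"
        using box_norm_unbounded[OF \<eta>, of 0 p "C + 1"] C(1) assms(3) by auto
      have "ennreal (C + 1) \<le> modulation_norm \<eta> s \<alpha> p q (regular_distr (unit_gauss a))"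
        using assms(4)
      proof (cases rule: exponent_cases)
        case 1
        then show ?thesis using modulation_norm_infinity_lower[of "C + 1" p \<eta> 0 _ s \<alpha>, OF a(2)] b0 by simp
      next
        case (2 Q)
        then show ?thesis
          using modulation_norm_lower[of Q "{0}" "\<lambda>_. C + 1" p \<eta> _ s \<alpha>] a(2) b0 C(1) by (auto simp: powr_powr)
      qed
      also have "\<dots> \<le> ennreal C" by (rule Ca[OF a(1)])
      finally show False using C(1) by (simp add: ennreal_le_iff)
    qed
    obtain c0 where c0: "c0 > 0" "\<And>K. finite K \<Longrightarrow> \<exists>a>0. \<forall>k\<in>K. ennreal (c0 * side \<alpha> k powr (?n * (1 - ?r)))
        \<le> box_norm p (\<eta> k) (unit_gauss a)"
      using box_norm_lower[of \<eta> "side \<alpha>" ?\<xi> L p, OF \<eta> side_pos one L lip assms(3) r] by blast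
    show "?r \<le> 1 \<and> s \<le> ?n * \<alpha> * (?r - 1) + (1 - \<alpha>) * A_index ?n 1 q \<and>
         (q < \<infinity> \<longrightarrow> s < ?n * \<alpha> * (?r - 1) + (1 - \<alpha>) * A_index ?n 1 q)"
      using assms(4)
    proof (cases rule: exponent_cases)
      case 1
      have "bracket k powr t \<le> C / c0" for k :: "int^'n"
      proof -
        obtain a where a: "a > 0" "ennreal (c0 * side \<alpha> k powr (?n * (1 - ?r))) \<le> box_norm p (\<eta> k) (unit_gauss a)"
          using c0(2)[of "{k}"] by auto
        have "ennreal (c0 * bracket k powr t) \<le> ennreal C"
          using order_trans[OF modulation_norm_infinity_lower[of _ p \<eta> k _ s \<alpha>, OF a(2)] Ca[OF a(1), unfolded 1]]
          unfolding expo .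
        then show ?thesis using C(1) c0(1) by (simp add: ennreal_le_iff field_simps)
      qed
      then have "t \<le> 0" using bracket_unbounded[of t "C / c0"] by (meson not_le)
      then have "s + ?n * \<alpha> * (1 - ?r) \<le> 0" using assms(2) by (simp add: t_def divide_le_0_iff)
      then show ?thesis using r 1 by (simp add: A_index_1 algebra_simps)
    next
      case (2 Q)
      have "(\<Sum>k\<in>K. bracket k powr (t * Q)) \<le> C powr Q / c0 powr Q" if K: "finite K" for K :: "(int^'n) set"
      proof -
        obtain a where a: "a > 0" "\<And>k. k \<in> K \<Longrightarrow> ennreal (c0 * side \<alpha> k powr (?n * (1 - ?r))) \<le> box_norm p (\<eta> k) (unit_gauss a)"
          using c0(2)[OF K] by blast
        let ?S = "\<Sum>k\<in>K. bracket k powr (t * Q)"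
        have "ennreal ((\<Sum>k\<in>K. (bracket k powr (s / (1 - \<alpha>)) * (c0 * side \<alpha> k powr (?n * (1 - ?r)))) powr Q) powr inverse Q) \<le> ennreal C"
          using c0(1) a(2) by (intro order_trans[OF modulation_norm_lower[OF \<open>Q > 0\<close> K] Ca[OF a(1), unfolded 2(2)]]) auto
        then have "(\<Sum>k\<in>K. (c0 * bracket k powr t) powr Q) powr inverse Q \<le> C"
          using C(1) unfolding expo by (simp add: ennreal_le_iff)
        then have "((\<Sum>k\<in>K. (c0 * bracket k powr t) powr Q) powr inverse Q) powr Q \<le> C powr Q"
          using 2 by (intro powr_mono2) auto
        moreover have "(\<Sum>k\<in>K. (c0 * bracket k powr t) powr Q) = c0 powr Q * ?S"
          by (simp add: powr_mult powr_powr sum_distrib_left)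
        ultimately have "c0 powr Q * ?S \<le> C powr Q"
          using 2 c0(1) by (simp add: powr_powr sum_nonneg)
        then show ?thesis using c0(1) by (simp add: field_simps)
      qed
      then have "t * Q < - real ?n"
        using lattice_sum_unbounded[of "t * Q" "C powr Q / c0 powr Q", where 'n='n] by (meson not_le)
      then have "t < - (real ?n * inverse Q)" using 2 by (simp add: field_simps)
      then have "s + ?n * \<alpha> * (1 - ?r) < - (real ?n * inverse Q) * (1 - \<alpha>)"
        using assms(2) by (simp only: t_def pos_divide_less_eq diff_gt_0_iff_gt)
      then have "s < ?n * \<alpha> * (?r - 1) + (1 - \<alpha>) * A_index ?n 1 q"
        using assms(4) 2 by (simp add: A_index_1 algebra_simps)
      then show ?thesis using r by simp
    qed
  next
    assume cond: "?r \<le> 1 \<and> s \<le> ?n * \<alpha> * (?r - 1) + (1 - \<alpha>) * A_index ?n 1 q \<and>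
         (q < \<infinity> \<longrightarrow> s < ?n * \<alpha> * (?r - 1) + (1 - \<alpha>) * A_index ?n 1 q)"
    then have r: "?r \<le> 1" by simp
    obtain c1 where c1: "c1 > 0" "\<And>k f. integrable lborel f \<Longrightarrow>
        box_norm p (\<eta> k) f \<le>
          ennreal (c1 * side \<alpha> k powr (?n * (1 - ?r)) * L1_norm f)"
      using box_norm_upper[of \<eta> "side \<alpha>" c ?\<xi> D p, OF \<eta> side_pos c supp D D0 Dn assms(3) r] by blast
    have c1': "box_norm p (\<eta> k) f \<le>
        ennreal (c1 * L1_norm f * side \<alpha> k powr (?n * (1 - ?r)))" if "integrable lborel f" for k f
      using c1(2)[OF that, of k] by (simp add: mult_ac)
    have "\<exists>C\<ge>0. \<forall>f. integrable lborel f \<longrightarrow> modulation_norm \<eta> s \<alpha> p q (regular_distr f) \<le> ennreal (C * L1_norm f)"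
      using assms(4)
    proof (cases rule: exponent_cases)
      case 1
      have "s + ?n * \<alpha> * (1 - ?r) \<le> 0" using cond 1 by (simp add: A_index_1 algebra_simps)
      then have "t \<le> 0" using assms(2) by (simp add: t_def divide_le_0_iff)
      then have bt: "bracket k powr t \<le> 1" for k :: "int^'n"
        using bracket_ge1[of k] powr_mono[of t 0 "bracket k"] by simp
      have "modulation_norm \<eta> s \<alpha> p q (regular_distr f) \<le> ennreal (c1 * L1_norm f)"
        if f: "integrable lborel f" for f
        unfolding 1
      proof (rule modulation_norm_infinity_upper[OF c1'[OF f]], unfold expo)
        fix k :: "int^'n"
        have "c1 * L1_norm f * bracket k powr t \<le> c1 * L1_norm f * 1"
          using c1(1) by (intro mult_left_mono bt) auto
        then show "c1 * L1_norm f * bracket k powr t \<le> c1 * L1_norm f" by simp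
      qed
      then show ?thesis
        using c1(1) by (intro exI[of _ c1]) auto
    next
      case (2 Q)
      have "s < ?n * \<alpha> * (?r - 1) + (1 - \<alpha>) * A_index ?n 1 q" using cond 2 by simp
      then have "s + ?n * \<alpha> * (1 - ?r) < - (real ?n * inverse Q) * (1 - \<alpha>)"
        using assms(4) 2 by (simp add: A_index_1 algebra_simps)
      then have "t < - (real ?n * inverse Q)"
        using assms(2) by (simp only: t_def pos_divide_less_eq diff_gt_0_iff_gt)
      then have "t * Q < - real ?n" using 2 by (simp add: field_simps)
      then obtain M where M: "\<And>K :: (int^'n) set. finite K \<Longrightarrow> (\<Sum>k\<in>K. bracket k powr (t * Q)) \<le> M"
        using lattice_sum_bounded[of "t * Q", where 'n='n] by blast
      have M0: "M \<ge> 0" using M[of "{}"] by simp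
      have "modulation_norm \<eta> s \<alpha> p q (regular_distr f) \<le> ennreal (c1 * M powr inverse Q * L1_norm f)"
        if f: "integrable lborel f" for f
      proof -
        let ?F = "L1_norm f"
        have "modulation_norm \<eta> s \<alpha> p (ennreal Q) (regular_distr f) \<le> ennreal (((c1 * ?F) powr Q * M) powr inverse Q)"
        proof (rule modulation_norm_upper[OF \<open>Q > 0\<close> _ c1'[OF f]], unfold expo)
          fix K :: "(int^'n) set" assume K: "finite K"
          have "(\<Sum>k\<in>K. (c1 * ?F * bracket k powr t) powr Q) = (c1 * ?F) powr Q * (\<Sum>k\<in>K. bracket k powr (t * Q))"
            by (simp add: powr_mult powr_powr sum_distrib_left)
          also have "\<dots> \<le> (c1 * ?F) powr Q * M" by (intro mult_left_mono M K) auto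
          finally show "(\<Sum>k\<in>K. (c1 * ?F * bracket k powr t) powr Q) \<le> (c1 * ?F) powr Q * M" .
        qed (use c1(1) in auto)
        also have "((c1 * ?F) powr Q * M) powr inverse Q = c1 * M powr inverse Q * ?F"
          using 2 c1(1) by (simp add: powr_mult powr_powr)
        finally show ?thesis using 2 by simp
      qed
      then show ?thesis
        using c1(1) by (intro exI[of _ "c1 * M powr inverse Q"]) auto
    qed
    then show ?emb by (simp only: emb_iff)
  qed
qed

end
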